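(* Let $s\in(0,1)$. Let $\Omega$ be a possibly unbounded open set of $\mathbb{R}^N$ satisfying the uniform exterior cone condition with opening $\theta\in(0,\pi/2)$. Let $g\in L^\infty(\Omega)$ and let $u\in L^\infty(\mathbb{R}^N)$ be a solution to $$(-\Delta)^s u=g(x)\ \text{ in }\Omega,\qquad u=0\ \text{ in }\mathbb{R}^N\setminus\Omega.$$ Then there exist $\alpha\in(0,s)$ and $C>0$, both depending only on $\theta$, $s$ and $N$ (and not on $\Omega$, $g$, $u$), such that $u\in\mathcal{C}^{0,\alpha}(\mathbb{R}^N)$ and $$\|u\|_{\mathcal{C}^{0,\alpha}(\mathbb{R}^N)}\le C\left[\left(1+\|u\|_{L^\infty(\mathbb{R}^N)}\right)\left(1+\|g\|_{L^\infty(\Omega)}^{\frac{\alpha}{2s-2\alpha}}\right)+\|g\|_{L^\infty(\Omega)}\right].$$ Also, for any $s\in(0,1)$, the map $\theta\mapsto\alpha(\theta,s)$ is monotone non-decreasing.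
   Context: For $e\in\mathbb{S}^{N-1}$ and $\theta\in(0,\pi)$, $\Sigma_{e,\theta}$ is the open, rotationally symmetric cone of axis $e$ and opening $\theta$, i.e. the set of all vectors $v\in\mathbb{R}^N$ forming with $e$ an angle less than $\theta$. An open set $\Omega$ satisfies the uniform exterior cone condition with opening $\theta$ if for every $x\in\partial\Omega$ there is a direction $e\in\mathbb{S}^{N-1}$ (possibly depending on $x$) such that the cone $x+\Sigma_{e,\theta}$ is exterior to $\Omega$ (contained in $\mathbb{R}^N\setminus\Omega$) and tangent to $\Omega$ at $x$ (i.e. touching it at its vertex $x\in\partial\Omega$); $\theta$ is the same for all boundary points. For $s\in(0,1)$ the fractional Laplacian is $(-\Delta)^s u(x)=c_{N,s}\lim_{\varepsilon\to0^+}\int_{\mathbb{R}^N\setminus B_\varepsilon(x)}\frac{u(x)-u(y)}{|x-y|^{N+2s}}\,dy$, where $c_{N,s}>0$ is a normalizing constant. "Solution" means classical solution: a continuous function $u:\mathbb{R}^N\to\mathbb{R}$ such that $(-\Delta)^s u(x)$ is well defined and equal to the right-hand side at every point $x$ of $\Omega$, and which satisfies the prescribed exterior condition a.e. in $\mathbb{R}^N\setminus\Omega$. In the last sentence of the claim, $\alpha(\theta,s)$ denotes the exponent $\alpha$ of the estimate as a function of $\theta$ and $s$ ($N$ fixed). *)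

theory Defs
  imports "HOL-Analysis.Analysis" "HOL-Probability.Essential_Supremum"
begin

text \<open>The angle between a unit vector \<open>e\<close> and \<open>v \<noteq> 0\<close> is \<open>arccos (e \<bullet> v / norm v)\<close>.\<close>

definition angular_cone :: "'a::euclidean_space \<Rightarrow> real \<Rightarrow> 'a set"
  where "angular_cone e \<theta> = {v. v \<noteq> 0 \<and> arccos (e \<bullet> v / norm v) < \<theta>}"

text \<open>The translated cone touches \<open>\<Omega>\<close> at its vertex \<open>x\<close> automatically: \<open>x\<close> is a limit point
  of the cone and lies on the boundary of \<open>\<Omega>\<close>.\<close>

definition uniform_exterior_cone :: "real \<Rightarrow> 'a::euclidean_space set \<Rightarrow> bool"
  where "uniform_exterior_cone \<theta> \<Omega> \<longleftrightarrow>
    (\<forall>x\<in>frontier \<Omega>. \<exists>e. norm e = 1 \<and> (\<lambda>v. x + v) ` angular_cone e \<theta> \<subseteq> - \<Omega>)"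

definition Linfty :: "'a::euclidean_space set \<Rightarrow> ('a \<Rightarrow> real) \<Rightarrow> bool"
  where "Linfty S f \<longleftrightarrow>
    f \<in> borel_measurable (lebesgue_on S) \<and> esssup (lebesgue_on S) (\<lambda>x. ennreal \<bar>f x\<bar>) < \<infinity>"

definition Linfty_norm :: "'a::euclidean_space set \<Rightarrow> ('a \<Rightarrow> real) \<Rightarrow> real"
  where "Linfty_norm S f = enn2real (esssup (lebesgue_on S) (\<lambda>x. ennreal \<bar>f x\<bar>))"

text \<open>The standard normalization, for which \<open>(-\<Delta>)\<^sup>s\<close> has Fourier symbol \<open>\<bar>\<xi>\<bar>\<^sup>2\<^sup>s\<close>; the argument
  \<open>N\<close> is the dimension.\<close>

definition frac_const :: "nat \<Rightarrow> real \<Rightarrow> real"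
  where "frac_const N s =
    4 powr s * Gamma (real N / 2 + s) / (pi powr (real N / 2) * \<bar>Gamma (- s)\<bar>)"

text \<open>\<open>has_frac_laplacian s u x L\<close>: the principal value defining \<open>(-\<Delta>)\<^sup>s u(x)\<close> is well defined
  and equal to \<open>L\<close>. Integrability is required separately because the library integral of a
  non-integrable function is \<open>0\<close>.\<close>

definition frac_kernel :: "real \<Rightarrow> ('a::euclidean_space \<Rightarrow> real) \<Rightarrow> 'a \<Rightarrow> 'a \<Rightarrow> real"
  where "frac_kernel s u x y = (u x - u y) / norm (x - y) powr (real DIM('a) + 2 * s)"

definition has_frac_laplacian ::
    "real \<Rightarrow> ('a::euclidean_space \<Rightarrow> real) \<Rightarrow> 'a \<Rightarrow> real \<Rightarrow> bool"
  where "has_frac_laplacian s u x L \<longleftrightarrow>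
    (\<forall>\<epsilon>>0. set_integrable lebesgue (- ball x \<epsilon>) (frac_kernel s u x)) \<and>
    ((\<lambda>\<epsilon>. frac_const DIM('a) s * (LINT y:(- ball x \<epsilon>)|lebesgue. frac_kernel s u x y))
      \<longlongrightarrow> L) (at_right 0)"

definition classical_solution ::
    "real \<Rightarrow> 'a::euclidean_space set \<Rightarrow> ('a \<Rightarrow> real) \<Rightarrow> ('a \<Rightarrow> real) \<Rightarrow> bool"
  where "classical_solution s \<Omega> g u \<longleftrightarrow>
    continuous_on UNIV u \<and>
    (\<forall>x\<in>\<Omega>. has_frac_laplacian s u x (g x)) \<and>
    (AE x in lebesgue. x \<notin> \<Omega> \<longrightarrow> u x = 0)"

text \<open>Global Hoelder space \<open>C\<^sup>0\<^sup>,\<^sup>\<alpha>(\<real>\<^sup>N)\<close> and its norm, the sum of the sup norm and the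
  Hoelder seminorm; the norm is meaningful only for members of the space.\<close>

definition holder_space :: "real \<Rightarrow> ('a::euclidean_space \<Rightarrow> real) \<Rightarrow> bool"
  where "holder_space \<alpha> u \<longleftrightarrow>
    bounded (range u) \<and> (\<exists>K. \<forall>x y. \<bar>u x - u y\<bar> \<le> K * norm (x - y) powr \<alpha>)"

definition holder_norm :: "real \<Rightarrow> ('a::euclidean_space \<Rightarrow> real) \<Rightarrow> real"
  where "holder_norm \<alpha> u =
    (SUP x. \<bar>u x\<bar>) + (SUP (x, y)\<in>{(x, y). x \<noteq> y}. \<bar>u x - u y\<bar> / norm (x - y) powr \<alpha>)"

end

theory Submission
  imports Defs
begin

text \<open>The proof is the oscillation decay argument of Silvestre. If \<open>v \<le> 1\<close> in the unit ball and
  \<open>{v \<le> 0}\<close> has definite measure there, then at a maximum point of \<open>v\<close> plus a small bump the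
  fractional Laplacian of \<open>v\<close> would be bounded below by a positive constant, unless \<open>v \<le> 1 - \<gamma>\<close> in
  the quarter ball. Iterating over the scales \<open>(1/4)\<^sup>k\<close> gives a Hoelder estimate that is linear in the
  two norms. Boundary points need no barrier: near them the exterior cone provides the set of
  definite measure.

  The bound on \<open>g\<close> holds only almost everywhere, while the maximum point is a single point. So one
  first subtracts from \<open>v\<close> a uniformly small potential \<open>w\<close> whose fractional Laplacian is almost
  nonnegative everywhere and infinite on the exceptional null set. Both properties follow from an
  explicit computation when the kernel is truncated in the time variable of its representation as a
  superposition of heat kernels instead of in space; the principal value controls the truncated
  operators because the time truncation is an average of truncations in space.\<close>

section \<open>Integration over Euclidean space\<close>

text \<open>At an exceptional point the value of \<open>g\<close> is a real number without any
  bound, and the maximum point may well be such a point. There the truncated operators of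
  \<open>v\<close> converge to a finite limit while those of the potential outgrow every real
  number, which is the contradiction. Only truncated operators of bounded functions are ever
  compared, so the potential need not have a fractional Laplacian anywhere, and the solution enters
  only through its principal values. The potential is a Riesz integral, in time, of the heat flow of
  a density that is infinite on the null set. The semigroup law reduces its truncated operator to a
  one-dimensional integral with an elementary primitive. The decay lemma admits growth at infinity
  with a small exponent: this is what the Hoelder bounds at the coarser scales become after
  rescaling to the unit ball. The bound obtained is a multiple of \<open>1 + U + G\<close>, with
  \<open>U\<close> and \<open>G\<close> the norms of \<open>u\<close> and \<open>g\<close>; the
  right-hand side of the claim dominates it because the power of \<open>G\<close> is
  nonnegative.\<close>

lemma nn_integral_lborel_affine:
  fixes f :: "'a::euclidean_space \<Rightarrow> ennreal" and t :: 'a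
  assumes [measurable]: "f \<in> borel_measurable borel" and c: "c \<noteq> 0"
  shows "(\<integral>\<^sup>+x. f x \<partial>lborel) = ennreal (\<bar>c\<bar> ^ DIM('a)) * (\<integral>\<^sup>+x. f (t + c *\<^sub>R x) \<partial>lborel)"
  by (subst lborel_affine[OF c, of t])
     (simp add: nn_integral_density nn_integral_distr nn_integral_cmult)

lemma integral_lborel_affine:
  fixes f :: "'a::euclidean_space \<Rightarrow> real" and t :: 'a
  assumes [measurable]: "f \<in> borel_measurable borel" and c: "c \<noteq> 0"
  shows "(\<integral>x. f x \<partial>lborel) = \<bar>c\<bar> ^ DIM('a) * (\<integral>x. f (t + c *\<^sub>R x) \<partial>lborel)"
  by (subst lborel_affine[OF c, of t]) (simp add: integral_density integral_distr)

lemma integrable_lborel_affine: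
  fixes f :: "'a::euclidean_space \<Rightarrow> real" and t :: 'a
  assumes f: "integrable lborel f" and c: "c \<noteq> 0"
  shows "integrable lborel (\<lambda>x. f (t + c *\<^sub>R x))"
proof -
  have [measurable]: "f \<in> borel_measurable borel" using f by auto
  have "(\<integral>\<^sup>+x. ennreal \<bar>f x\<bar> \<partial>lborel) < \<infinity>"
    using f unfolding integrable_iff_bounded by simp
  then have "ennreal (\<bar>c\<bar> ^ DIM('a)) * (\<integral>\<^sup>+x. ennreal \<bar>f (t + c *\<^sub>R x)\<bar> \<partial>lborel) < \<infinity>"
    by (subst (asm) nn_integral_lborel_affine[OF _ c, of _ t]) auto
  then have "(\<integral>\<^sup>+x. ennreal \<bar>f (t + c *\<^sub>R x)\<bar> \<partial>lborel) < \<infinity>"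
    using c by (auto simp: ennreal_mult_less_top power_less_top_ennreal)
  then show ?thesis unfolding integrable_iff_bounded by simp
qed

lemma tonelli_lborel:
  fixes f :: "'a::euclidean_space \<Rightarrow> 'b::euclidean_space \<Rightarrow> ennreal"
  assumes "(\<lambda>(x, y). f x y) \<in> borel_measurable (borel \<Otimes>\<^sub>M borel)"
  shows "(\<integral>\<^sup>+x. (\<integral>\<^sup>+y. f x y \<partial>lborel) \<partial>lborel) = (\<integral>\<^sup>+y. (\<integral>\<^sup>+x. f x y \<partial>lborel) \<partial>lborel)"
  by (rule lborel_pair.Fubini'[symmetric])
     (use assms in \<open>simp add: measurable_cong_sets[OF sets_pair_measure_cong[OF sets_lborel sets_lborel] refl]\<close>)

text \<open>The substitution \<open>y = norm h / sqrt t\<close> turns the time integral of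
  \<open>t powr (- 1 - s) * heat t h\<close> into an integral of this weight with
  \<open>p = N + 2 * s - 1\<close>, where \<open>N\<close> is the dimension; the factor 2 is the
  derivative of the square in \<open>t = (norm h)\<^sup>2 / y\<^sup>2\<close>.\<close>

definition radius_weight :: "real \<Rightarrow> real \<Rightarrow> real"
  where "radius_weight p y = 2 * y powr p * exp (- y\<^sup>2)"

lemma radius_weight_nonneg: "0 \<le> radius_weight p y"
  by (simp add: radius_weight_def)

lemma radius_weight_measurable [measurable]: "radius_weight p \<in> borel_measurable borel"
  unfolding radius_weight_def by measurable

text \<open>Since \<open>- y\<^sup>2 \<le> 1 - y\<close>, the weight is at most
  \<open>2 * exp 1\<close> times the integrand of the Gamma integral at
  \<open>p + 1\<close>.\<close>

lemma radius_weight_integrable: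
  assumes "0 \<le> p"
  shows "set_integrable lborel {0..} (radius_weight p)"
proof -
  have 1: "(\<lambda>t::real. t powr p / exp t) absolutely_integrable_on {0<..}"
  proof -
    have "set_integrable lebesgue {0<..} (\<lambda>t::real. norm (complex_of_real t powr complex_of_real p / complex_of_real (exp t)))"
      using absolutely_integrable_Gamma_integral[of "complex_of_real (p+1)" 1] assms
      by (intro set_integrable_norm) simp
    then show ?thesis
      by (rule set_integrable_cong[THEN iffD1, rotated 3]) (auto simp: norm_divide powr_of_real)
  qed
  have 2: "set_integrable lborel {0<..} (\<lambda>t::real. 2 * exp 1 * (t powr p / exp t))"
  proof (rule set_integrable_mult_right)
    show "set_integrable lborel {0<..} (\<lambda>t::real. t powr p / exp t)"
      using 1 unfolding set_integrable_def by (subst (asm) integrable_completion) auto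
  qed
  have 3: "set_integrable lborel {0<..} (radius_weight p)"
  proof (rule set_integrable_bound[OF 2])
    show "AE x in lborel. x \<in> {0<..} \<longrightarrow> norm (radius_weight p x) \<le> norm (2 * exp 1 * (x powr p / exp x))"
    proof (intro AE_I2 impI)
      fix x :: real
      have "0 \<le> (x - 1/2)\<^sup>2" by simp
      then have "- x\<^sup>2 \<le> 1 - x" by (simp add: power2_eq_square algebra_simps)
      then have "exp (- x\<^sup>2) \<le> exp 1 / exp x" by (simp add: exp_diff[symmetric])
      then have "2 * x powr p * exp (- x\<^sup>2) \<le> 2 * x powr p * (exp 1 / exp x)"
        by (intro mult_left_mono) auto
      then show "norm (radius_weight p x) \<le> norm (2 * exp 1 * (x powr p / exp x))"
        by (simp add: radius_weight_def abs_mult mult_ac)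
    qed
  qed (auto simp: set_borel_measurable_def)
  have 4: "AE x in lborel. indicat_real {0<..} x *\<^sub>R radius_weight p x = indicat_real {0..} x *\<^sub>R radius_weight p x"
    using AE_lborel_singleton[of 0] by eventually_elim (auto simp: indicator_def)
  show ?thesis unfolding set_integrable_def
    by (rule integrable_cong_AE_imp[OF 3[unfolded set_integrable_def] _ 4]) measurable
qed

lemma emeasure_ball_scale:
  fixes x :: "'a::euclidean_space"
  assumes "0 < r"
  shows "emeasure lborel (ball x r) = ennreal (r ^ DIM('a)) * emeasure lborel (ball (0::'a) 1)"
proof -
  have "emeasure lborel (ball x r) = (\<integral>\<^sup>+y. indicator (ball x r) y \<partial>lborel)" by simp
  also have "\<dots> = ennreal (\<bar>r\<bar> ^ DIM('a)) * (\<integral>\<^sup>+y. indicator (ball x r) (x + r *\<^sub>R y) \<partial>lborel)"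
    by (rule nn_integral_lborel_affine) (use assms in \<open>auto intro!: borel_measurable_indicator\<close>)
  also have "(\<lambda>y. indicator (ball x r) (x + r *\<^sub>R y) :: ennreal) = indicator (ball 0 1)"
    using assms by (auto simp: fun_eq_iff indicator_def dist_norm)
  finally show ?thesis using assms by simp
qed

text \<open>Layer-cake argument: the Gaussian is the integral of
  \<open>2 * y * exp (- y\<^sup>2)\<close> over \<open>y \<ge> norm x\<close>, and exchanging the
  integrals leaves the volume of a ball of radius \<open>y\<close>, of order \<open>y ^ N\<close>.
  What remains is the integral of \<open>radius_weight (N + 1)\<close>.\<close>

lemma gauss_integrable: "integrable lborel (\<lambda>x::'a::euclidean_space. exp (- (norm x)\<^sup>2))"
proof -
  let ?B = "emeasure lborel (ball (0::'a) 1)"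
  have B: "?B < \<infinity>" by (rule emeasure_lborel_ball_finite)
  have F: "ennreal (exp (- (norm x)\<^sup>2)) = (\<integral>\<^sup>+y. ennreal (2 * y * exp (- y\<^sup>2)) * indicator {norm x ..} y \<partial>lborel)" for x :: 'a
  proof (subst nn_integral_FTC_atLeast[where F="\<lambda>y. - exp (- y\<^sup>2)" and T=0])
    show "((\<lambda>y::real. - exp (- y\<^sup>2)) \<longlongrightarrow> 0) at_top"
      by (rule tendsto_eq_intros filterlim_compose[OF exp_at_bot] filterlim_compose[OF filterlim_uminus_at_bot_at_top]
          filterlim_pow_at_top filterlim_ident | simp)+
  qed (auto intro!: derivative_eq_intros mult_nonneg_nonneg intro: order_trans[OF norm_ge_zero])
  have "(\<integral>\<^sup>+(x::'a). ennreal (exp (- (norm x)\<^sup>2)) \<partial>lborel)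
     = (\<integral>\<^sup>+(x::'a). (\<integral>\<^sup>+y. ennreal (2 * y * exp (- y\<^sup>2)) * indicator {norm x ..} y \<partial>lborel) \<partial>lborel)"
    by (simp add: F)
  also have "\<dots> = (\<integral>\<^sup>+y. (\<integral>\<^sup>+(x::'a). ennreal (2 * y * exp (- y\<^sup>2)) * indicator {norm x ..} y \<partial>lborel) \<partial>lborel)"
    by (rule tonelli_lborel) (unfold indicator_def atLeast_iff, measurable)
  also have "\<dots> \<le> (\<integral>\<^sup>+y. ennreal (indicator {0..} y *\<^sub>R radius_weight (real DIM('a) + 1) y) * (2 ^ DIM('a) * ?B) \<partial>lborel)"
  proof (rule nn_integral_mono)
    fix y :: real
    have "(\<integral>\<^sup>+(x::'a). ennreal (2 * y * exp (- y\<^sup>2)) * indicator {norm x ..} y \<partial>lborel)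
        = ennreal (2 * y * exp (- y\<^sup>2)) * (\<integral>\<^sup>+(x::'a). indicator (cball 0 y) x \<partial>lborel)"
      by (subst nn_integral_cmult[symmetric])
         (auto intro!: nn_integral_cong borel_measurable_indicator simp: indicator_def)
    also have "\<dots> \<le> ennreal (indicator {0..} y *\<^sub>R radius_weight (real DIM('a) + 1) y) * (2 ^ DIM('a) * ?B)"
    proof (cases "0 < y")
      case True
      have "emeasure lborel (cball (0::'a) y) \<le> emeasure lborel (ball (0::'a) (2 * y))"
        using True by (intro emeasure_mono) auto
      also have "\<dots> = ennreal ((2 * y) ^ DIM('a)) * ?B" using True by (intro emeasure_ball_scale) auto
      finally have "emeasure lborel (cball (0::'a) y) \<le> ennreal ((2 * y) ^ DIM('a)) * ?B" .
      then have "ennreal (2 * y * exp (- y\<^sup>2)) * emeasure lborel (cball (0::'a) y)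
          \<le> ennreal (2 * y * exp (- y\<^sup>2)) * (ennreal ((2 * y) ^ DIM('a)) * ?B)" by (rule mult_left_mono) simp
      also have "\<dots> = ennreal (radius_weight (real DIM('a) + 1) y) * (2 ^ DIM('a) * ?B)"
      proof -
        have e: "2 * y * exp (- y\<^sup>2) * (2 * y) ^ DIM('a) = radius_weight (real DIM('a) + 1) y * 2 ^ DIM('a)"
          using True unfolding radius_weight_def powr_add by (simp add: powr_realpow power_mult_distrib)
        have "ennreal (2 * y * exp (- y\<^sup>2)) * (ennreal ((2 * y) ^ DIM('a)) * ?B)
            = ennreal (2 * y * exp (- y\<^sup>2) * (2 * y) ^ DIM('a)) * ?B"
          using True by (subst ennreal_mult) (auto simp: mult.assoc)
        also have "\<dots> = ennreal (radius_weight (real DIM('a) + 1) y) * (ennreal (2 ^ DIM('a)) * ?B)"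
          unfolding e by (subst ennreal_mult) (auto simp: mult.assoc radius_weight_nonneg)
        finally show ?thesis by (simp add: ennreal_power[symmetric])
      qed
      finally show ?thesis using True by simp
    next
      case False
      then have "ennreal (2 * y * exp (- y\<^sup>2)) = 0"
        by (intro ennreal_neg) (simp add: mult_nonpos_nonneg)
      then show ?thesis by simp
    qed
    finally show "(\<integral>\<^sup>+(x::'a). ennreal (2 * y * exp (- y\<^sup>2)) * indicator {norm x ..} y \<partial>lborel) \<le> \<dots>" .
  qed
  also have "\<dots> = (\<integral>\<^sup>+y. ennreal (indicator {0..} y *\<^sub>R radius_weight (real DIM('a) + 1) y) \<partial>lborel) * (2 ^ DIM('a) * ?B)"
    by (rule nn_integral_multc) measurable
  also have "\<dots> < \<infinity>"
  proof -
    have "(\<integral>\<^sup>+y. ennreal (norm (indicator {0..} y *\<^sub>R radius_weight (real DIM('a) + 1) y)) \<partial>lborel) < \<infinity>"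
      using radius_weight_integrable[of "real DIM('a) + 1"] unfolding set_integrable_def integrable_iff_bounded by simp
    then show ?thesis using B by (simp add: radius_weight_nonneg ennreal_mult_less_top power_less_top_ennreal)
  qed
  finally show ?thesis unfolding integrable_iff_bounded by simp
qed

section \<open>The heat kernel and the jump kernel truncated in time\<close>

definition gauss_mass :: "'a::euclidean_space itself \<Rightarrow> real"
  where "gauss_mass _ = (\<integral>(x::'a). exp (- (norm x)\<^sup>2) \<partial>lborel)"

lemma gauss_mass_pos: "0 < gauss_mass TYPE('a::euclidean_space)"
proof -
  have "gauss_mass TYPE('a) \<noteq> 0"
  proof
    assume "gauss_mass TYPE('a) = 0"
    then have "AE x::'a in lborel. exp (- (norm x)\<^sup>2) = 0"
      unfolding gauss_mass_def by (subst (asm) integral_nonneg_eq_0_iff_AE[OF gauss_integrable]) auto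
    then have "AE x::'a in lborel. False" by simp
    then have "emeasure lborel (UNIV :: 'a set) = 0" by (subst (asm) AE_iff_measurable[OF _ refl]) auto
    then show False by simp
  qed
  moreover have "0 \<le> gauss_mass TYPE('a)" unfolding gauss_mass_def by (rule integral_nonneg_AE) simp
  ultimately show ?thesis by simp
qed

text \<open>Time is rescaled by the factor \<open>4\<close> with respect to the usual heat kernel.\<close>

definition heat :: "real \<Rightarrow> 'a::euclidean_space \<Rightarrow> real"
  where "heat t h = exp (- (norm h)\<^sup>2 / t) / (t powr (real DIM('a) / 2) * gauss_mass TYPE('a))"

lemma heat_measurable [measurable (raw)]:
  fixes h :: "'b \<Rightarrow> 'a::euclidean_space"
  assumes [measurable]: "t \<in> borel_measurable M" "h \<in> borel_measurable M"
  shows "(\<lambda>x. heat (t x) (h x)) \<in> borel_measurable M"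
  unfolding heat_def by measurable

lemma heat_nonneg: "0 \<le> heat t (h::'a::euclidean_space)"
  unfolding heat_def using gauss_mass_pos[where 'a='a] by (simp add: less_imp_le)

lemma heat_minus [simp]: "heat t (- h) = heat t h"
  by (simp add: heat_def)

lemma heat_le:
  fixes h :: "'a::euclidean_space"
  assumes "0 < t"
  shows "heat t h \<le> 1 / (t powr (real DIM('a) / 2) * gauss_mass TYPE('a))"
  unfolding heat_def using assms gauss_mass_pos[where 'a='a]
  by (intro divide_right_mono) auto

section \<open>Scaling, mass and semigroup law of the heat kernel\<close>

lemma nn_integral_heat_scale:
  fixes f :: "'a::euclidean_space \<Rightarrow> ennreal"
  assumes [measurable]: "f \<in> borel_measurable borel" and t: "0 < t"
  shows "(\<integral>\<^sup>+h. f h * heat t h \<partial>lborel) = (\<integral>\<^sup>+h. f (sqrt t *\<^sub>R h) * heat 1 h \<partial>lborel)"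
proof -
  have e: "ennreal (sqrt t ^ DIM('a)) * (f (sqrt t *\<^sub>R h) * ennreal (heat t (sqrt t *\<^sub>R h)))
      = f (sqrt t *\<^sub>R h) * heat 1 h" for h :: 'a
  proof -
    have "sqrt t ^ DIM('a) = t powr (real DIM('a) / 2)"
      using t by (simp add: powr_half_sqrt[symmetric] powr_powr powr_realpow[symmetric])
    then have "sqrt t ^ DIM('a) * heat t (sqrt t *\<^sub>R h) = heat 1 h"
      using t by (simp add: heat_def power_mult_distrib)
    then show ?thesis
      using t by (subst mult.left_commute, subst ennreal_mult'[symmetric]) auto
  qed
  show ?thesis
    by (subst nn_integral_lborel_affine[where c="sqrt t" and t=0])
       (use t in \<open>auto simp: nn_integral_cmult[symmetric] e\<close>)
qed

lemma nn_integral_heat: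
  assumes "0 < t"
  shows "(\<integral>\<^sup>+(h::'a::euclidean_space). heat t h \<partial>lborel) = 1"
proof -
  have "(\<integral>\<^sup>+(h::'a). 1 * ennreal (heat t h) \<partial>lborel) = (\<integral>\<^sup>+(h::'a). 1 * ennreal (heat 1 h) \<partial>lborel)"
    by (rule nn_integral_heat_scale[OF _ assms]) simp
  also have "\<dots> = ennreal (\<integral>(h::'a). heat 1 h \<partial>lborel)"
    unfolding mult_1_left
    by (intro nn_integral_eq_integral) (auto simp: heat_nonneg, auto simp: heat_def gauss_integrable)
  also have "(\<integral>(h::'a). heat 1 h \<partial>lborel) = 1"
    unfolding heat_def using gauss_mass_pos[where 'a='a] by (simp add: gauss_mass_def)
  finally show ?thesis by simp
qed

text \<open>Completing the square in \<open>y\<close>: the product is again Gaussian in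
  \<open>y\<close>, with centre \<open>(r / (t + r)) *\<^sub>R a\<close> and time
  \<open>t * r / (t + r)\<close>. The normalisations agree because \<open>t * r\<close> is the
  product of \<open>t + r\<close> and that time. Integration in \<open>y\<close> then yields the
  semigroup law.\<close>

lemma heat_mult:
  fixes a :: "'a::euclidean_space"
  assumes t: "0 < t" and r: "0 < r"
  shows "heat t (a - y) * heat r y = heat (t + r) a * heat (t * r / (t + r)) (y - (r / (t + r)) *\<^sub>R a)"
proof -
  have "(norm (a - y))\<^sup>2 / t + (norm y)\<^sup>2 / r
      = (norm a)\<^sup>2 / (t + r) + (norm (y - (r / (t + r)) *\<^sub>R a))\<^sup>2 / (t * r / (t + r))"
  proof -
    define p where "p = a \<bullet> a" define q where "q = a \<bullet> y" define w where "w = y \<bullet> y"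
    define k where "k = t + r"
    have k: "0 < k" using t r by (auto simp: k_def)
    have 1: "(norm (a - y))\<^sup>2 = p - 2 * q + w"
      by (simp add: power2_norm_eq_inner inner_diff_left inner_diff_right inner_commute p_def q_def w_def)
    have 2: "(norm (y - (r / k) *\<^sub>R a))\<^sup>2 = w - 2 * (r/k) * q + (r/k)\<^sup>2 * p"
      unfolding power2_norm_eq_inner
      by (simp add: inner_diff_left inner_diff_right inner_commute p_def q_def w_def power2_eq_square algebra_simps)
    have 3: "(norm a)\<^sup>2 = p" "(norm y)\<^sup>2 = w" by (simp_all add: power2_norm_eq_inner p_def w_def)
    have 4: "w * k / (t * r) = w / r + w / t" using t r by (simp add: k_def add_divide_distrib distrib_left)
    have "p / k + r * p / (k * t) = (t * p + r * p) / (k * t)" using t k by (simp add: add_divide_distrib)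
    also have "\<dots> = p / t" using t k by (simp add: k_def distrib_right[symmetric])
    finally have 5: "p / k + r * p / (k * t) = p / t" .
    have 6: "(w - 2 * (r/k) * q + (r/k)\<^sup>2 * p) / (t * r / k) = w * k / (t * r) - 2 * q / t + r * p / (k * t)"
      using t r k by (simp add: divide_simps power2_eq_square)
    show ?thesis unfolding k_def[symmetric] 1 2 3 6 4
      using 5 by (simp add: add_divide_distrib diff_divide_distrib)
  qed
  then have e: "exp (- (norm (a - y))\<^sup>2 / t) * exp (- (norm y)\<^sup>2 / r)
      = exp (- (norm a)\<^sup>2 / (t + r)) * exp (- (norm (y - (r / (t + r)) *\<^sub>R a))\<^sup>2 / (t * r / (t + r)))"
    unfolding exp_add[symmetric] by simp
  have p: "t powr q * r powr q = (t + r) powr q * (t * r / (t + r)) powr q" for q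
    using t r by (subst (1 2) powr_mult[symmetric]) auto
  show ?thesis unfolding heat_def times_divide_times_eq e
    using p[of "real DIM('a) / 2"] by (simp add: mult_ac)
qed

lemma heat_semigroup:
  fixes a :: "'a::euclidean_space"
  assumes t: "0 < t" and r: "0 < r"
  shows "(\<integral>\<^sup>+y. ennreal (heat t (a - y)) * heat r y \<partial>lborel) = heat (t + r) a"
proof -
  let ?q = "t * r / (t + r)" and ?m = "(r / (t + r)) *\<^sub>R a"
  have q: "0 < ?q" using t r by simp
  have "(\<integral>\<^sup>+y. ennreal (heat t (a - y)) * heat r y \<partial>lborel)
      = (\<integral>\<^sup>+y. ennreal (heat (t + r) a) * heat ?q (y - ?m) \<partial>lborel)"
    by (intro nn_integral_cong) (simp add: ennreal_mult''[symmetric] heat_nonneg heat_mult[OF t r])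
  also have "\<dots> = ennreal (heat (t + r) a) * (\<integral>\<^sup>+y. heat ?q (y - ?m) \<partial>lborel)"
    by (rule nn_integral_cmult) measurable
  also have "(\<integral>\<^sup>+y. heat ?q (y - ?m) \<partial>lborel) = (\<integral>\<^sup>+(y::'a). heat ?q y \<partial>lborel)"
    by (subst nn_integral_lborel_affine[where c=1 and t="?m"]) auto
  finally show ?thesis using nn_integral_heat[OF q, where 'a='a] by simp
qed

text \<open>Extended values, because the density built later is infinite on the exceptional null
  set.\<close>

definition heat_flow :: "real \<Rightarrow> ('a::euclidean_space \<Rightarrow> ennreal) \<Rightarrow> 'a \<Rightarrow> ennreal"
  where "heat_flow t f x = (\<integral>\<^sup>+h. f (x + h) * heat t h \<partial>lborel)"

lemma heat_flow_measurable [measurable (raw)]: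
  fixes h :: "'b \<Rightarrow> 'a::euclidean_space"
  assumes [measurable]: "f \<in> borel_measurable borel" "t \<in> borel_measurable M" "h \<in> borel_measurable M"
  shows "(\<lambda>x. heat_flow (t x) f (h x)) \<in> borel_measurable M"
  unfolding heat_flow_def by measurable

lemma heat_flow_alt:
  fixes f :: "'a::euclidean_space \<Rightarrow> ennreal"
  assumes [measurable]: "f \<in> borel_measurable borel"
  shows "heat_flow t f x = (\<integral>\<^sup>+y. f y * heat t (y - x) \<partial>lborel)"
  unfolding heat_flow_def
  by (subst (2) nn_integral_lborel_affine[where c=1 and t=x]) auto

lemma heat_flow_heat_flow:
  fixes f :: "'a::euclidean_space \<Rightarrow> ennreal"
  assumes [measurable]: "f \<in> borel_measurable borel" and t: "0 < t" and r: "0 < r"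
  shows "heat_flow t (heat_flow r f) x = heat_flow (r + t) f x"
proof -
  have "heat_flow t (heat_flow r f) x = (\<integral>\<^sup>+h. (\<integral>\<^sup>+y. f y * heat r (y - (x + h)) \<partial>lborel) * heat t h \<partial>lborel)"
    unfolding heat_flow_def[of t] by (simp add: heat_flow_alt)
  also have "\<dots> = (\<integral>\<^sup>+h. (\<integral>\<^sup>+y. f y * (ennreal (heat r ((y - x) - h)) * heat t h) \<partial>lborel) \<partial>lborel)"
    by (intro nn_integral_cong, subst nn_integral_multc[symmetric]) (auto simp: mult.assoc diff_diff_eq)
  also have "\<dots> = (\<integral>\<^sup>+y. (\<integral>\<^sup>+h. f y * (ennreal (heat r ((y - x) - h)) * heat t h) \<partial>lborel) \<partial>lborel)"
    by (rule tonelli_lborel) measurable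
  also have "\<dots> = (\<integral>\<^sup>+y. f y * heat (r + t) (y - x) \<partial>lborel)"
    by (intro nn_integral_cong, subst nn_integral_cmult) (auto simp: heat_semigroup[OF r t])
  finally show ?thesis by (simp add: heat_flow_alt)
qed

lemma nn_integral_powr_atLeast:
  assumes "0 < \<tau>" "0 < s"
  shows "(\<integral>\<^sup>+t. ennreal (t powr (- 1 - s)) * indicator {\<tau>..} t \<partial>lborel) = ennreal (\<tau> powr (- s) / s)"
proof (subst nn_integral_FTC_atLeast[where F="\<lambda>t. - (t powr (- s)) / s" and T=0])
  show "((\<lambda>t. - (t powr (- s)) / s) \<longlongrightarrow> 0) at_top"
  proof -
    have "((\<lambda>t. t powr (- s)) \<longlongrightarrow> 0) at_top"
      using assms by (intro tendsto_neg_powr filterlim_ident) auto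
    from tendsto_divide[OF tendsto_minus[OF this] tendsto_const[of s]] show ?thesis using assms by simp
  qed
  fix t :: real assume "\<tau> \<le> t"
  then have "((\<lambda>t. t powr (- s)) has_real_derivative - s * t powr (- s - 1)) (at t)"
    using assms by (intro has_real_derivative_powr) auto
  from DERIV_cdivide[OF DERIV_minus[OF this], of s]
  show "((\<lambda>t. - (t powr (- s)) / s) has_real_derivative t powr (- 1 - s)) (at t)"
    using assms by (simp add: minus_diff_commute[of s 1, symmetric])
qed (use assms in auto)

lemma nn_integral_powr_Ioc:
  assumes "- 1 < p" "0 \<le> b"
  shows "(\<integral>\<^sup>+t. ennreal (t powr p) * indicator {0..b} t \<partial>lborel) = ennreal (b powr (p + 1) / (p + 1))"
proof -
  have 1: "((\<lambda>t. t powr p) has_integral (b powr (p + 1) / (p + 1))) {0..b}"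
    using has_integral_powr_from_0[OF assms] .
  show ?thesis
    using nn_integral_has_integral_lebesgue[OF _ 1] by (simp add: mult.commute ennreal_indicator[symmetric] ennreal_mult')
qed

section \<open>The time-truncated jump kernel: mass, lower bound and moments\<close>

abbreviation time_weight :: "real \<Rightarrow> real \<Rightarrow> real \<Rightarrow> ennreal"
  where "time_weight s \<tau> t \<equiv> ennreal (t powr (- 1 - s)) * indicator {\<tau>..} t"

text \<open>For \<open>\<tau> = 0\<close> this is a multiple of \<open>norm h powr (- N - 2 * s)\<close>.\<close>

definition jump_kernel :: "real \<Rightarrow> real \<Rightarrow> 'a::euclidean_space \<Rightarrow> ennreal"
  where "jump_kernel s \<tau> h = (\<integral>\<^sup>+t. time_weight s \<tau> t * heat t h \<partial>lborel)"

lemma jump_kernel_measurable [measurable]: "jump_kernel s \<tau> \<in> borel_measurable borel"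
  unfolding jump_kernel_def by measurable

lemma nn_integral_jump_kernel:
  fixes f :: "'a::euclidean_space \<Rightarrow> ennreal"
  assumes [measurable]: "f \<in> borel_measurable borel"
  shows "(\<integral>\<^sup>+h. f h * jump_kernel s \<tau> h \<partial>lborel)
    = (\<integral>\<^sup>+t. time_weight s \<tau> t * (\<integral>\<^sup>+h. f h * heat t h \<partial>lborel) \<partial>lborel)"
proof -
  have "(\<integral>\<^sup>+h. f h * jump_kernel s \<tau> h \<partial>lborel)
     = (\<integral>\<^sup>+h. (\<integral>\<^sup>+t. f h * (time_weight s \<tau> t * heat t h) \<partial>lborel) \<partial>lborel)"
    unfolding jump_kernel_def by (intro nn_integral_cong, subst nn_integral_cmult) auto
  also have "\<dots> = (\<integral>\<^sup>+t. (\<integral>\<^sup>+h. f h * (time_weight s \<tau> t * heat t h) \<partial>lborel) \<partial>lborel)"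
    by (rule tonelli_lborel) measurable
  also have "\<dots> = (\<integral>\<^sup>+t. time_weight s \<tau> t * (\<integral>\<^sup>+h. f h * heat t h \<partial>lborel) \<partial>lborel)"
    by (intro nn_integral_cong, subst nn_integral_cmult[symmetric]) (auto simp: mult_ac)
  finally show ?thesis .
qed

text \<open>Each \<open>heat t\<close> has mass 1, so only the time integral is left. Finiteness of
  the mass is the point of the truncation: the truncated operator then acts on every bounded
  measurable function, without any regularity.\<close>

lemma jump_kernel_mass:
  assumes "0 < \<tau>" "0 < s"
  shows "(\<integral>\<^sup>+(h::'a::euclidean_space). jump_kernel s \<tau> h \<partial>lborel) = ennreal (\<tau> powr (- s) / s)"
proof -
  have "(\<integral>\<^sup>+(h::'a). 1 * jump_kernel s \<tau> h \<partial>lborel)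
    = (\<integral>\<^sup>+t. time_weight s \<tau> t * (\<integral>\<^sup>+(h::'a). 1 * ennreal (heat t h) \<partial>lborel) \<partial>lborel)"
    by (rule nn_integral_jump_kernel) simp
  also have "\<dots> = (\<integral>\<^sup>+t. ennreal (t powr (- 1 - s)) * indicator {\<tau>..} t \<partial>lborel)"
    using assms nn_integral_heat[where 'a='a] by (intro nn_integral_cong) (auto simp: indicator_def)
  finally show ?thesis using nn_integral_powr_atLeast[OF assms] by simp
qed

lemma jump_kernel_minus [simp]: "jump_kernel s \<tau> (- h) = jump_kernel s \<tau> h"
  by (simp add: jump_kernel_def)

lemma jump_kernel_finite:
  fixes h :: "'a::euclidean_space"
  assumes "0 < \<tau>" "0 < s"
  shows "jump_kernel s \<tau> h < \<infinity>"
proof -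
  let ?c = "1 / (\<tau> powr (real DIM('a) / 2) * gauss_mass TYPE('a))"
  have "heat t h \<le> ?c" if "\<tau> \<le> t" for t
  proof -
    have "heat t h \<le> 1 / (t powr (real DIM('a) / 2) * gauss_mass TYPE('a))"
      using heat_le[of t h] assms that by simp
    also have "\<dots> \<le> ?c"
      using assms that gauss_mass_pos[where 'a='a] by (intro divide_left_mono mult_right_mono powr_mono2 mult_pos_pos) auto
    finally show ?thesis .
  qed
  then have "jump_kernel s \<tau> h \<le> (\<integral>\<^sup>+t. time_weight s \<tau> t * ennreal ?c \<partial>lborel)"
    unfolding jump_kernel_def by (intro nn_integral_mono) (auto split: split_indicator intro!: mult_left_mono ennreal_leI)
  also have "\<dots> = ennreal (\<tau> powr (- s) / s) * ennreal ?c"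
    by (subst nn_integral_multc) (auto simp: nn_integral_powr_atLeast[OF assms])
  also have "\<dots> < \<infinity>" by (simp add: ennreal_mult_less_top)
  finally show ?thesis .
qed

text \<open>The times between 1 and 2 survive every truncation with \<open>\<tau> \<le> 1\<close>,
  so \<open>\<kappa>\<close> does not depend on \<open>\<tau>\<close>. The range
  \<open>norm h \<le> 2\<close> covers the difference of any two points of the unit ball.\<close>

lemma jump_kernel_lower:
  obtains \<kappa> :: real where "0 < \<kappa>"
    "\<And>\<tau> (h::'a::euclidean_space). 0 < \<tau> \<Longrightarrow> \<tau> \<le> 1 \<Longrightarrow> norm h \<le> 2 \<Longrightarrow> ennreal \<kappa> \<le> jump_kernel s \<tau> h"
proof
  let ?c = "exp (- 4) / (2 powr (real DIM('a) / 2) * gauss_mass TYPE('a))"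
  \<comment> \<open>The sign of the exponent \<open>- 1 - s\<close> is not fixed here, so the
    minimum over both ends of the time interval serves as the lower bound of the power.\<close>
  let ?m = "min (2 powr (- 1 - s)) (1 powr (- 1 - s))"
  show "0 < ?m * ?c" using gauss_mass_pos[where 'a='a] by auto
  fix \<tau> :: real and h :: 'a assume \<tau>: "0 < \<tau>" "\<tau> \<le> 1" "norm h \<le> 2"
  have h: "(norm h)\<^sup>2 \<le> 4" using power_mono[OF \<tau>(3), of 2] by simp
  have heat: "?c \<le> heat t h" if "1 \<le> t" "t \<le> 2" for t
  proof -
    have "(norm h)\<^sup>2 / t \<le> (norm h)\<^sup>2 / 1" using that by (intro divide_left_mono) auto
    then have "- 4 \<le> - (norm h)\<^sup>2 / t" using h by simp
    then show ?thesis
      unfolding heat_def using that gauss_mass_pos[where 'a='a]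
      by (intro frac_le mult_right_mono powr_mono2 mult_pos_pos) auto
  qed
  have pw: "?m \<le> t powr (- 1 - s)" if "1 \<le> t" "t \<le> 2" for t
  proof (cases "- 1 - s \<le> 0")
    case True
    then have "2 powr (- 1 - s) \<le> t powr (- 1 - s)" using that by (intro powr_mono2') auto
    then show ?thesis by auto
  next
    case False
    then have "1 powr (- 1 - s) \<le> t powr (- 1 - s)" using that by (intro powr_mono2) auto
    then show ?thesis by auto
  qed
  have "ennreal (?m * ?c) = (\<integral>\<^sup>+t. ennreal (?m * ?c) * indicator {1..2::real} t \<partial>lborel)"
    by (subst nn_integral_cmult_indicator) auto
  also have "\<dots> \<le> jump_kernel s \<tau> h"
    unfolding jump_kernel_def
  proof (intro nn_integral_mono)
    fix t :: real
    show "ennreal (?m * ?c) * indicator {1..2} t \<le> time_weight s \<tau> t * ennreal (heat t h)"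
    proof (cases "t \<in> {1..2}")
      case True
      have "?m * ?c \<le> t powr (- 1 - s) * heat t h"
        using True heat[of t] pw[of t] gauss_mass_pos[where 'a='a] by (intro mult_mono) auto
      then show ?thesis using True \<tau> by (simp add: ennreal_mult'[symmetric] ennreal_leI)
    qed auto
  qed
  finally show "ennreal (?m * ?c) \<le> jump_kernel s \<tau> h" .
qed

text \<open>The inequality \<open>x \<le> 2 * exp (x / 2)\<close> trades the factor
  \<open>(norm h)\<^sup>2\<close> for half of the exponent, and a wider Gaussian remains.\<close>

lemma heat_second_moment: "(\<integral>\<^sup>+(h::'a::euclidean_space). ennreal ((norm h)\<^sup>2) * heat 1 h \<partial>lborel) < \<infinity>"
proof -
  let ?g = "\<lambda>h::'a. exp (- (norm h)\<^sup>2)"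
  have i: "integrable lborel (\<lambda>h::'a. 2 / gauss_mass TYPE('a) * ?g (0 + (1 / sqrt 2) *\<^sub>R h))"
    by (intro integrable_mult_right integrable_lborel_affine gauss_integrable) simp
  have "(\<integral>\<^sup>+(h::'a). ennreal ((norm h)\<^sup>2) * heat 1 h \<partial>lborel)
      \<le> (\<integral>\<^sup>+(h::'a). ennreal (norm (2 / gauss_mass TYPE('a) * ?g (0 + (1 / sqrt 2) *\<^sub>R h))) \<partial>lborel)"
  proof (intro nn_integral_mono)
    fix h :: 'a
    let ?x = "(norm h)\<^sup>2"
    have "?x \<le> 2 * exp (?x / 2)" using exp_ge_add_one_self[of "?x / 2"] by linarith
    then have "?x * exp (- ?x) \<le> 2 * exp (?x / 2) * exp (- ?x)" by (intro mult_right_mono) auto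
    also have "\<dots> = 2 * exp (- ?x / 2)" by (simp add: exp_add[symmetric])
    finally have "?x * exp (- ?x) \<le> 2 * exp (- ?x / 2)" .
    then have "?x * heat 1 h \<le> 2 * exp (- ?x / 2) / gauss_mass TYPE('a)"
      unfolding heat_def using gauss_mass_pos[where 'a='a] by (simp add: divide_right_mono)
    also have "\<dots> = norm (2 / gauss_mass TYPE('a) * ?g (0 + (1 / sqrt 2) *\<^sub>R h))"
      using gauss_mass_pos[where 'a='a] by (simp add: power_divide abs_mult)
    finally show "ennreal ?x * heat 1 h \<le> ennreal (norm (2 / gauss_mass TYPE('a) * ?g (0 + (1 / sqrt 2) *\<^sub>R h)))"
      by (simp add: ennreal_mult'[symmetric] ennreal_leI)
  qed
  also have "\<dots> < \<infinity>" using i unfolding integrable_iff_bounded by auto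
  finally show ?thesis .
qed

text \<open>By scaling, the mean of this function under \<open>heat t\<close> is at most
  \<open>min t (t powr (s / 2))\<close> times a moment at time 1. Multiplied by
  \<open>t powr (- 1 - s)\<close> this is integrable at 0 because \<open>s < 1\<close> and at
  infinity because \<open>0 < s\<close>, whence a bound uniform in \<open>\<tau>\<close>. The
  function is the error allowed at a contact point: quadratic nearby, of growth
  \<open>norm h powr s\<close> far away.\<close>

lemma jump_kernel_moment:
  assumes s: "0 < s" "s < 1"
  obtains C :: real where "0 < C"
    "\<And>\<tau>. 0 < \<tau> \<Longrightarrow>
      (\<integral>\<^sup>+(h::'a::euclidean_space). ennreal (min ((norm h)\<^sup>2) (norm h powr s)) * jump_kernel s \<tau> h \<partial>lborel) \<le> ennreal C"
proof -
  define M where "M = (\<integral>\<^sup>+(h::'a). ennreal (1 + (norm h)\<^sup>2) * heat 1 h \<partial>lborel)"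
  have "M = (\<integral>\<^sup>+(h::'a). (ennreal (heat 1 h) + ennreal ((norm h)\<^sup>2) * heat 1 h) \<partial>lborel)"
    unfolding M_def by (intro nn_integral_cong) (simp add: distrib_right)
  also have "\<dots> = 1 + (\<integral>\<^sup>+(h::'a). ennreal ((norm h)\<^sup>2) * heat 1 h \<partial>lborel)"
    by (subst nn_integral_add) (auto simp: nn_integral_heat)
  finally have M: "M < \<infinity>" using heat_second_moment[where 'a='a] by (simp add: less_top)
  let ?\<Phi> = "\<lambda>h::'a. min ((norm h)\<^sup>2) (norm h powr s)"
  have b: "(\<integral>\<^sup>+h. ennreal (?\<Phi> h) * heat t h \<partial>lborel) \<le> ennreal (min t (t powr (s/2))) * M" if t: "0 < t" for t
  proof -
    have "(\<integral>\<^sup>+h. ennreal (?\<Phi> h) * heat t h \<partial>lborel) = (\<integral>\<^sup>+h. ennreal (?\<Phi> (sqrt t *\<^sub>R h)) * heat 1 h \<partial>lborel)"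
      by (rule nn_integral_heat_scale[OF _ t]) measurable
    also have "\<dots> \<le> (\<integral>\<^sup>+(h::'a). ennreal (min t (t powr (s/2))) * (ennreal (1 + (norm h)\<^sup>2) * heat 1 h) \<partial>lborel)"
    proof (intro nn_integral_mono)
      fix h :: 'a
      have p: "norm h powr s \<le> 1 + (norm h)\<^sup>2"
      proof (cases "norm h \<le> 1")
        case True
        then have "norm h powr s \<le> 1" using s by (intro powr_le1) auto
        then show ?thesis by (simp add: add_increasing2)
      next
        case False
        then have "norm h powr s \<le> norm h powr 2" using s by (intro powr_mono) auto
        then show ?thesis using False by simp
      qed
      have a: "(norm (sqrt t *\<^sub>R h))\<^sup>2 = t * (norm h)\<^sup>2" using t by (simp add: power_mult_distrib)
      have c: "norm (sqrt t *\<^sub>R h) powr s = t powr (s/2) * norm h powr s"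
        using t by (simp add: powr_mult powr_half_sqrt[symmetric] powr_powr)
      have "?\<Phi> (sqrt t *\<^sub>R h) \<le> min (t * (1 + (norm h)\<^sup>2)) (t powr (s/2) * (1 + (norm h)\<^sup>2))"
        unfolding a c using t p by (intro min.mono mult_left_mono) auto
      also have "\<dots> = min t (t powr (s/2)) * (1 + (norm h)\<^sup>2)"
        by (simp add: min_mult_distrib_right)
      finally have "?\<Phi> (sqrt t *\<^sub>R h) * heat 1 h \<le> min t (t powr (s/2)) * ((1 + (norm h)\<^sup>2) * heat 1 h)"
        using heat_nonneg[of 1 h] by (simp add: mult.assoc[symmetric] mult_right_mono)
      then show "ennreal (?\<Phi> (sqrt t *\<^sub>R h)) * heat 1 h \<le> ennreal (min t (t powr (s/2))) * (ennreal (1 + (norm h)\<^sup>2) * heat 1 h)"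
        using t by (simp add: ennreal_mult'[symmetric] ennreal_mult''[symmetric] heat_nonneg ennreal_leI del: ennreal_plus)
    qed
    also have "\<dots> = ennreal (min t (t powr (s/2))) * M"
      unfolding M_def by (rule nn_integral_cmult) measurable
    finally show ?thesis .
  qed
  let ?C = "1 / (1 - s) + 2 / s"
  have main: "(\<integral>\<^sup>+h. ennreal (?\<Phi> h) * jump_kernel s \<tau> h \<partial>lborel) \<le> ennreal ?C * M" if \<tau>: "0 < \<tau>" for \<tau>
  proof -
    have "(\<integral>\<^sup>+h. ennreal (?\<Phi> h) * jump_kernel s \<tau> h \<partial>lborel)
      = (\<integral>\<^sup>+t. time_weight s \<tau> t * (\<integral>\<^sup>+h. ennreal (?\<Phi> h) * heat t h \<partial>lborel) \<partial>lborel)"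
      by (rule nn_integral_jump_kernel) measurable
    also have "\<dots> \<le> (\<integral>\<^sup>+t. (ennreal (t powr (- s)) * indicator {0..1} t + ennreal (t powr (- 1 - s/2)) * indicator {1..} t) * M \<partial>lborel)"
    proof (intro nn_integral_mono)
      fix t :: real
      show "time_weight s \<tau> t * (\<integral>\<^sup>+h. ennreal (?\<Phi> h) * heat t h \<partial>lborel)
         \<le> (ennreal (t powr (- s)) * indicator {0..1} t + ennreal (t powr (- 1 - s/2)) * indicator {1..} t) * M"
      proof (cases "\<tau> \<le> t")
        case True
        then have t: "0 < t" using \<tau> by simp
        have "t powr (- 1 - s) * min t (t powr (s/2)) \<le> t powr (- s) * indicator {0..1} t + t powr (- 1 - s/2) * indicator {1..} t"
        proof (cases "t \<le> 1")
          case True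
          have "t powr (- 1 - s) * min t (t powr (s/2)) \<le> t powr (- 1 - s) * t powr 1" using t by (intro mult_left_mono) auto
          also have "\<dots> = t powr (- s)" unfolding powr_add[symmetric] by simp
          finally have "t powr (- 1 - s) * min t (t powr (s/2)) \<le> t powr (- s)" .
          moreover have i: "indicator {0..1} t = (1::real)" and "0 \<le> t powr (- 1 - s/2) * indicator {1..} t" using True t by auto
          ultimately show ?thesis unfolding i by linarith
        next
          case False
          have "t powr (- 1 - s) * min t (t powr (s/2)) \<le> t powr (- 1 - s) * t powr (s/2)" using t by (intro mult_left_mono) auto
          also have "\<dots> = t powr (- 1 - s/2)" unfolding powr_add[symmetric] by (rule arg_cong[where f="\<lambda>x. t powr x"]) simp
          finally have "t powr (- 1 - s) * min t (t powr (s/2)) \<le> t powr (- 1 - s/2)" .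
          moreover have i: "indicator {1..} t = (1::real)" and "0 \<le> t powr (- s) * indicator {0..1} t" using False t by auto
          ultimately show ?thesis unfolding i by linarith
        qed
        then have e: "ennreal (t powr (- 1 - s)) * ennreal (min t (t powr (s/2)))
           \<le> ennreal (t powr (- s)) * indicator {0..1} t + ennreal (t powr (- 1 - s/2)) * indicator {1..} t"
          unfolding ennreal_indicator[symmetric] ennreal_mult'[OF powr_ge_zero, symmetric]
          by (subst ennreal_plus[symmetric]) (auto intro: ennreal_leI simp del: ennreal_plus)
        have "time_weight s \<tau> t * (\<integral>\<^sup>+h. ennreal (?\<Phi> h) * heat t h \<partial>lborel)
          \<le> ennreal (t powr (- 1 - s)) * (ennreal (min t (t powr (s/2))) * M)"
        proof -
          have "indicator {\<tau>..} t = (1::ennreal)" using True by simp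
          then show ?thesis using b[OF t] by (simp only: mult_1_right) (rule mult_left_mono, auto)
        qed
        also have "\<dots> \<le> (ennreal (t powr (- s)) * indicator {0..1} t + ennreal (t powr (- 1 - s/2)) * indicator {1..} t) * M"
          unfolding mult.assoc[symmetric] using e by (rule mult_right_mono) simp
        finally show ?thesis .
      next
        case False
        then have "indicator {\<tau>..} t = (0::ennreal)" by simp
        then show ?thesis by (simp only: mult_zero_left mult_zero_right zero_le)
      qed
    qed
    also have "\<dots> = (ennreal (1 / (1 - s)) + ennreal (1 / (s / 2))) * M"
    proof -
      have 1: "(\<integral>\<^sup>+t. ennreal (t powr (- s)) * indicator {0..1} t \<partial>lborel) = ennreal (1 / (1 - s))"
        using nn_integral_powr_Ioc[of "-s" 1] s by simp
      have 2: "(\<integral>\<^sup>+t. ennreal (t powr (- 1 - s/2)) * indicator {1..} t \<partial>lborel) = ennreal (1 / (s / 2))"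
        using nn_integral_powr_atLeast[of 1 "s/2"] s by simp
      show ?thesis unfolding 1[symmetric] 2[symmetric]
        by (subst nn_integral_add[symmetric], measurable, rule nn_integral_multc, measurable)
    qed
    also have "\<dots> = ennreal ?C * M" using s by (simp add: ennreal_plus[symmetric] del: ennreal_plus)
    finally show ?thesis .
  qed
  show ?thesis
  proof
    \<comment> \<open>Adding 1 makes the constant positive without a lower bound for
      \<open>M\<close>.\<close>
    show "0 < ?C * enn2real M + 1" using s by (intro add_nonneg_pos mult_nonneg_nonneg) auto
    fix \<tau> :: real assume "0 < \<tau>"
    then have "(\<integral>\<^sup>+h. ennreal (?\<Phi> h) * jump_kernel s \<tau> h \<partial>lborel) \<le> ennreal ?C * M" by (rule main)
    also have "\<dots> = ennreal (?C * enn2real M)" using M s by (subst ennreal_mult'') auto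
    also have "\<dots> \<le> ennreal (?C * enn2real M + 1)" by (intro ennreal_leI) simp
    finally show "(\<integral>\<^sup>+h. ennreal (?\<Phi> h) * jump_kernel s \<tau> h \<partial>lborel) \<le> ennreal (?C * enn2real M + 1)" .
  qed
qed

section \<open>Time truncation as an average of truncations in space\<close>

lemma radius_weight_primitive:
  assumes "0 < p" "0 < z"
  shows "((\<lambda>z. integral {0..z} (radius_weight p)) has_real_derivative radius_weight p z) (at z)"
proof -
  have "continuous_on {0..z+1} (radius_weight p)"
    unfolding radius_weight_def using assms by (auto intro!: continuous_intros continuous_on_powr')
  then have "((\<lambda>z. integral {0..z} (radius_weight p)) has_real_derivative radius_weight p z) (at z within {0..z+1})"
    using assms by (intro integral_has_real_derivative) auto
  then show ?thesis
    using assms by (subst (asm) at_within_Icc_at) auto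
qed

lemma nn_integral_radius_weight:
  assumes "0 < p" "0 \<le> z"
  shows "(\<integral>\<^sup>+y. ennreal (radius_weight p y) * indicator {0..z} y \<partial>lborel) = ennreal (integral {0..z} (radius_weight p))"
proof -
  have "continuous_on {0..z} (radius_weight p)"
    unfolding radius_weight_def using assms by (auto intro!: continuous_intros continuous_on_powr')
  then have "((radius_weight p) has_integral (integral {0..z} (radius_weight p))) {0..z}"
    by (intro integrable_integral integrable_continuous_interval)
  then show ?thesis
    using nn_integral_has_integral_lebesgue[of "{0..z}" "radius_weight p"] radius_weight_nonneg
    by (simp add: mult.commute ennreal_indicator[symmetric] ennreal_mult')
qed

text \<open>The truncation in time averages the kernels truncated at the radii \<open>y * sqrt \<tau>\<close>, with
  weight \<open>radius_weight\<close> in \<open>y\<close>. Parametrising by the radius keeps the weight continuous at \<open>0\<close>.\<close>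

lemma jump_kernel_eq:
  fixes h :: "'a::euclidean_space"
  assumes s: "0 < s" and \<tau>: "0 < \<tau>" and h: "h \<noteq> 0"
  shows "jump_kernel s \<tau> h = ennreal (1 / (gauss_mass TYPE('a) * norm h powr (real DIM('a) + 2 * s)))
     * (\<integral>\<^sup>+y. ennreal (radius_weight (real DIM('a) + 2 * s - 1) y) * indicator {0..norm h / sqrt \<tau>} y \<partial>lborel)"
proof -
  define a where "a = norm h"
  have a: "0 < a" using h by (simp add: a_def)
  define p where "p = real DIM('a) + 2 * s - 1"
  have p: "0 < p" using s DIM_positive[where 'a='a] unfolding p_def by linarith
  define c where "c = 1 / (gauss_mass TYPE('a) * a powr (p + 1))"
  have c: "0 < c" using a gauss_mass_pos[where 'a='a] by (simp add: c_def)
  \<comment> \<open>The antiderivative in time is read off from the substitution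
    \<open>y = a / sqrt t\<close>; since \<open>y\<close> decreases in \<open>t\<close>, it carries
    a minus sign and tends to 0 at infinity.\<close>
  let ?F = "\<lambda>t. - (c * integral {0..a / sqrt t} (radius_weight p))"
  have "jump_kernel s \<tau> h = (\<integral>\<^sup>+t. ennreal (t powr (- 1 - s) * heat t h) * indicator {\<tau>..} t \<partial>lborel)"
    unfolding jump_kernel_def by (intro nn_integral_cong) (simp add: ennreal_mult heat_nonneg mult_ac)
  also have "\<dots> = ennreal (0 - ?F \<tau>)"
  proof (rule nn_integral_FTC_atLeast)
    fix t assume "\<tau> \<le> t"
    then have t: "0 < t" using \<tau> by simp
    have d: "((\<lambda>t. a / sqrt t) has_real_derivative (- (a * t powr (- 3/2) / 2))) (at t)"
    proof -
      have 1: "((\<lambda>t. t powr (- 1/2)) has_real_derivative (- 1/2) * t powr (- 1/2 - 1)) (at t)"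
        using t by (intro has_real_derivative_powr)
      have A: "((\<lambda>t. a * t powr (- 1/2)) has_real_derivative (- (a * t powr (- 3/2) / 2))) (at t)"
        using DERIV_cmult[OF 1, of a] by simp
      have B: "a * t powr (- 1/2) = a / sqrt t" if "t \<in> {0<..}" for t
      proof -
        have "t powr (- 1/2) = t powr (- (1/2))" by simp
        also have "\<dots> = inverse (sqrt t)" using that unfolding powr_minus by (subst powr_half_sqrt) auto
        finally have e: "t powr (- 1/2) = inverse (sqrt t)" .
        show ?thesis unfolding e by (rule divide_inverse[symmetric])
      qed
      show ?thesis
        by (rule has_field_derivative_transform_within_open[OF A, of "{0<..}"]) (use t B in auto)
    qed
    have v: "c * (radius_weight p (a / sqrt t) * (a * t powr (- 3/2) / 2)) = t powr (- 1 - s) * heat t h"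
    proof -
      have s1: "(a / sqrt t) powr p = a powr p * t powr (- p / 2)"
      proof -
        have "sqrt t powr p = t powr (p / 2)" using t by (simp add: powr_half_sqrt[symmetric] powr_powr)
        then show ?thesis using a t by (simp add: powr_divide powr_minus_divide)
      qed
      have s2: "(a / sqrt t)\<^sup>2 = a\<^sup>2 / t" using t by (simp add: power_divide)
      have s3: "a powr (p + 1) = a powr p * a" using a by (simp add: powr_add)
      have s4: "t powr (- p / 2) * t powr (- 3/2) = t powr (- 1 - s) / t powr (real DIM('a) / 2)"
        unfolding powr_add[symmetric] powr_diff[symmetric]
        by (rule arg_cong[where f="\<lambda>x. t powr x"]) (simp add: p_def field_simps)
      have "c * (radius_weight p (a / sqrt t) * (a * t powr (- 3/2) / 2))
         = (c * (a powr p * a)) * exp (- (a\<^sup>2 / t)) * (t powr (- p / 2) * t powr (- 3/2))"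
        unfolding radius_weight_def s1 s2 by simp
      also have "\<dots> = (1 / gauss_mass TYPE('a)) * exp (- (a\<^sup>2 / t)) * (t powr (- 1 - s) / t powr (real DIM('a) / 2))"
        unfolding s4 c_def s3 using a by simp
      also have "\<dots> = t powr (- 1 - s) * heat t h"
        by (simp add: heat_def a_def mult_ac)
      finally show ?thesis .
    qed
    have at: "0 < a / sqrt t" using a t by simp
    have "((\<lambda>t. integral {0..a / sqrt t} (radius_weight p)) has_real_derivative
        radius_weight p (a / sqrt t) * (- (a * t powr (- 3/2) / 2))) (at t)"
      using DERIV_chain2[OF radius_weight_primitive[OF p at] d] .
    from DERIV_minus[OF DERIV_cmult[OF this, of c]]
    show "(?F has_real_derivative t powr (- 1 - s) * heat t h) (at t)"
      unfolding v[symmetric] by simp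
  next
    \<comment> \<open>For \<open>z \<le> 1\<close> the weight is at most 2 on \<open>{0..z}\<close>,
      so the integral is at most \<open>2 * z\<close>, and \<open>z = a / sqrt t\<close> tends to
      0.\<close>
    have "((\<lambda>t. integral {0..a / sqrt t} (radius_weight p)) \<longlongrightarrow> 0) at_top"
    proof (rule tendsto_sandwich[OF _ _ tendsto_const])
      show "\<forall>\<^sub>F t in at_top. 0 \<le> integral {0..a / sqrt t} (radius_weight p)"
      proof (intro always_eventually allI)
        fix t
        have "continuous_on {0..a / sqrt t} (radius_weight p)"
          unfolding radius_weight_def using p by (auto intro!: continuous_intros continuous_on_powr')
        then show "0 \<le> integral {0..a / sqrt t} (radius_weight p)"
          by (intro Henstock_Kurzweil_Integration.integral_nonneg integrable_continuous_interval) (auto simp: radius_weight_nonneg)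
      qed
      show "\<forall>\<^sub>F t in at_top. integral {0..a / sqrt t} (radius_weight p) \<le> 2 * (a / sqrt t)"
        using eventually_ge_at_top[of "a\<^sup>2"] eventually_gt_at_top[of 0]
      proof eventually_elim
        case (elim t)
        let ?z = "a / sqrt t"
        have z: "0 \<le> ?z" "?z \<le> 1"
          using elim a real_le_rsqrt[of a t] by auto
        have cont: "continuous_on {0..?z} (radius_weight p)"
          unfolding radius_weight_def using p by (auto intro!: continuous_intros continuous_on_powr')
        have "integral {0..?z} (radius_weight p) \<le> integral {0..?z} (\<lambda>_. 2)"
        proof (rule integral_le)
          fix y assume y: "y \<in> {0..?z}"
          have "y powr p \<le> 1" using y z p by (intro powr_le1) auto
          then have "y powr p * exp (- y\<^sup>2) \<le> 1 * 1" by (intro mult_mono) auto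
          then show "radius_weight p y \<le> 2" by (simp add: radius_weight_def)
        qed (use cont in \<open>auto intro!: integrable_continuous_interval\<close>)
        then show ?case using z by (simp add: mult.commute)
      qed
      show "((\<lambda>t. 2 * (a / sqrt t)) \<longlongrightarrow> 0) at_top"
        by (intro tendsto_mult_right_zero real_tendsto_divide_at_top[OF tendsto_const] sqrt_at_top)
    qed
    from tendsto_minus[OF tendsto_mult_right_zero[OF this, of c]]
    show "(?F \<longlongrightarrow> 0) at_top" by simp
  qed (auto simp: heat_nonneg)
  also have "\<dots> = ennreal c * ennreal (integral {0..a / sqrt \<tau>} (radius_weight p))"
    using c by (simp add: ennreal_mult')
  also have "ennreal (integral {0..a / sqrt \<tau>} (radius_weight p)) = (\<integral>\<^sup>+y. ennreal (radius_weight p y) * indicator {0..a / sqrt \<tau>} y \<partial>lborel)"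
    using a \<tau> by (intro nn_integral_radius_weight[symmetric] p) auto
  finally show ?thesis
    by (simp add: c_def p_def a_def)
qed

lemma radius_weight_integral_pos: "0 < p \<Longrightarrow> 0 < (LINT y:{0..}|lborel. radius_weight p y)"
proof -
  assume p: "0 < p"
  have i: "set_integrable lborel {0..} (radius_weight p)" using p by (intro radius_weight_integrable) simp
  have "(LINT y:{0..}|lborel. radius_weight p y) \<noteq> 0"
  proof
    assume "(LINT y:{0..}|lborel. radius_weight p y) = 0"
    then have "AE y in lborel. indicator {0..} y *\<^sub>R radius_weight p y = 0"
      unfolding set_lebesgue_integral_def
      by (subst (asm) integral_nonneg_eq_0_iff_AE[OF i[unfolded set_integrable_def]]) (auto simp: radius_weight_nonneg)
    then have "AE y in lborel. y \<notin> {0<..<1::real}"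
      by eventually_elim (auto simp: radius_weight_def indicator_def split: if_splits)
    then have "emeasure lborel {0<..<1::real} = 0"
      by (subst (asm) AE_iff_measurable[OF _ refl]) (auto simp: greaterThanLessThan_def Collect_conj_eq greaterThan_def lessThan_def)
    then show False by simp
  qed
  moreover have "0 \<le> (LINT y:{0..}|lborel. radius_weight p y)"
    unfolding set_lebesgue_integral_def by (rule integral_nonneg_AE) (auto simp: radius_weight_nonneg)
  ultimately show ?thesis by simp
qed

text \<open>Signed integrands call for a real kernel. By \<open>jump_kernel_finite\<close> the
  conversion loses nothing when \<open>0 < \<tau>\<close> and \<open>0 < s\<close>.\<close>

definition jump_ker :: "real \<Rightarrow> real \<Rightarrow> 'a::euclidean_space \<Rightarrow> real"
  where "jump_ker s \<tau> h = enn2real (jump_kernel s \<tau> h)"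

lemma jump_ker_measurable [measurable]: "jump_ker s \<tau> \<in> borel_measurable borel"
  unfolding jump_ker_def by measurable

lemma jump_ker_nonneg: "0 \<le> jump_ker s \<tau> h"
  by (simp add: jump_ker_def)

lemma ennreal_jump_ker: "0 < \<tau> \<Longrightarrow> 0 < s \<Longrightarrow> ennreal (jump_ker s \<tau> h) = jump_kernel s \<tau> h"
  using jump_kernel_finite[of \<tau> s h] by (simp add: jump_ker_def)

lemma jump_ker_minus [simp]: "jump_ker s \<tau> (- h) = jump_ker s \<tau> h"
  by (simp add: jump_ker_def)

lemma jump_ker_integrable:
  assumes "0 < \<tau>" "0 < s"
  shows "integrable lborel (jump_ker s \<tau> :: 'a::euclidean_space \<Rightarrow> real)"
  unfolding integrable_iff_bounded
  using jump_kernel_mass[OF assms, where 'a='a] by (simp add: jump_ker_nonneg ennreal_jump_ker assms)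

lemma jump_ker_integrable_mult:
  fixes f :: "'a::euclidean_space \<Rightarrow> real"
  assumes [measurable]: "f \<in> borel_measurable borel" and "0 < \<tau>" "0 < s" and f: "\<And>h. \<bar>f h\<bar> \<le> M"
  shows "integrable lborel (\<lambda>h. f h * jump_ker s \<tau> h)"
proof (rule Bochner_Integration.integrable_bound)
  show "integrable lborel (\<lambda>h::'a. M * jump_ker s \<tau> h)"
    using jump_ker_integrable[OF assms(2,3)] by (rule integrable_mult_right)
  show "AE h in lborel. norm (f h * jump_ker s \<tau> h) \<le> norm (M * jump_ker s \<tau> h)"
    using f order_trans[OF abs_ge_zero f] by (intro AE_I2) (auto simp: abs_mult jump_ker_nonneg intro!: mult_right_mono)
qed measurable

lemma jump_ker_eq:
  fixes h :: "'a::euclidean_space"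
  assumes s: "0 < s" and \<tau>: "0 < \<tau>" and h: "h \<noteq> 0"
  shows "jump_ker s \<tau> h = (\<integral>y. 1 / (gauss_mass TYPE('a) * norm h powr (real DIM('a) + 2 * s))
     * (radius_weight (real DIM('a) + 2 * s - 1) y * indicator {0..norm h / sqrt \<tau>} y) \<partial>lborel)"
    and "integrable lborel (\<lambda>y. 1 / (gauss_mass TYPE('a) * norm h powr (real DIM('a) + 2 * s))
     * (radius_weight (real DIM('a) + 2 * s - 1) y * indicator {0..norm h / sqrt \<tau>} y))"
proof -
  let ?f = "\<lambda>y. 1 / (gauss_mass TYPE('a) * norm h powr (real DIM('a) + 2 * s))
     * (radius_weight (real DIM('a) + 2 * s - 1) y * indicator {0..norm h / sqrt \<tau>} y)"
  define f where "f = ?f"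
  have "(\<integral>\<^sup>+y. ennreal (?f y) \<partial>lborel) = jump_kernel s \<tau> h"
    unfolding jump_kernel_eq[OF assms]
    by (subst nn_integral_cmult[symmetric])
       (auto intro!: nn_integral_cong simp: ennreal_mult'[symmetric] ennreal_indicator[symmetric] radius_weight_nonneg
         ennreal_mult''[symmetric] less_imp_le[OF gauss_mass_pos[where 'a='a]])
  then have e: "(\<integral>\<^sup>+y. ennreal (f y) \<partial>lborel) = jump_kernel s \<tau> h" by (simp only: f_def)
  have "0 \<le> ?f y" for y
    using gauss_mass_pos[where 'a='a] by (auto intro!: mult_nonneg_nonneg simp: radius_weight_nonneg less_imp_le)
  then have nn: "0 \<le> f y" for y by (simp only: f_def)
  have "?f \<in> borel_measurable lborel" by measurable
  then have [measurable]: "f \<in> borel_measurable lborel" by (simp only: f_def)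
  have "integrable lborel f"
    using jump_kernel_finite[OF \<tau> s, of h] by (simp add: integrable_iff_bounded nn e)
  moreover have "jump_ker s \<tau> h = integral\<^sup>L lborel f"
    by (simp add: jump_ker_def integral_eq_nn_integral nn e)
  ultimately show "integrable lborel ?f" "jump_ker s \<tau> h = integral\<^sup>L lborel ?f"
    by (simp_all only: f_def)
qed

text \<open>Fubini and \<open>jump_ker_eq\<close> write the integral against the jump kernel as the
  mean of the space-truncated integrals \<open>I (y * sqrt \<tau>)\<close> under a fixed integrable
  weight in \<open>y\<close>. These integrals are bounded, so dominated convergence carries the
  principal value over to the truncation in time.\<close>

lemma tendsto_jump_ker:
  fixes D :: "'a::euclidean_space \<Rightarrow> real"
  assumes s: "0 < s"
    and D [measurable]: "D \<in> borel_measurable borel" and M: "\<And>h. \<bar>D h\<bar> \<le> M"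
    and i: "\<And>\<delta>. 0 < \<delta> \<Longrightarrow> integrable lborel (\<lambda>h. if \<delta> \<le> norm h then D h / norm h powr (real DIM('a) + 2 * s) else 0)"
    and L: "((\<lambda>\<delta>. \<integral>h. (if \<delta> \<le> norm h then D h / norm h powr (real DIM('a) + 2 * s) else 0) \<partial>lborel) \<longlongrightarrow> L) (at_right 0)"
    and \<tau>: "\<And>n. 0 < \<tau> n" "\<tau> \<longlonglongrightarrow> 0"
  shows "(\<lambda>n. \<integral>h. D h * jump_ker s (\<tau> n) h \<partial>lborel) \<longlonglongrightarrow>
     (LINT y:{0..}|lborel. radius_weight (real DIM('a) + 2 * s - 1) y) / gauss_mass TYPE('a) * L"
proof -
  define q where "q = real DIM('a) + 2 * s"
  define p where "p = q - 1"
  define Z where "Z = gauss_mass TYPE('a)"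
  have Z: "0 < Z" unfolding Z_def by (rule gauss_mass_pos)
  have p: "0 < p" using s DIM_positive[where 'a='a] unfolding p_def q_def by linarith
  define I where "I \<delta> = (\<integral>h. (if \<delta> \<le> norm h then D h / norm h powr q else 0) \<partial>lborel)" for \<delta>
  have [measurable]: "I \<in> borel_measurable borel"
    unfolding I_def by measurable
  define G where "G = (\<lambda>y. indicator {0..} y * radius_weight p y / Z)"
  have [measurable]: "G \<in> borel_measurable borel" unfolding G_def by measurable
  have Gi: "integrable lborel G"
    using radius_weight_integrable[of p] p unfolding G_def set_integrable_def by simp
  have L': "(I \<longlongrightarrow> L) (at_right 0)" using L unfolding I_def q_def .
  have eq: "(\<integral>h. D h * jump_ker s \<tau> h \<partial>lborel) = (\<integral>y. G y * I (y * sqrt \<tau>) \<partial>lborel)"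
    if \<tau>: "0 < \<tau>" for \<tau>
  proof -
    let ?g = "\<lambda>h y. 1 / (Z * norm h powr q) * (radius_weight p y * indicator {0..norm h / sqrt \<tau>} y)"
    let ?f = "\<lambda>(h::'a) y. D h * ?g h y"
    note je = jump_ker_eq[OF s \<tau>, where 'a='a, folded q_def Z_def, folded p_def]
    have nz: "AE h::'a in lborel. h \<noteq> 0" by (rule AE_lborel_singleton)
    have gnn: "0 \<le> ?g h y" for h :: 'a and y
      using Z by (auto intro!: mult_nonneg_nonneg simp: radius_weight_nonneg less_imp_le)
    have m: "(\<lambda>(h, y). ?f h y) \<in> borel_measurable (lborel \<Otimes>\<^sub>M lborel)"
      unfolding indicator_def atLeastAtMost_iff by measurable
    have int: "integrable (lborel \<Otimes>\<^sub>M lborel) (\<lambda>(h, y). ?f h y)"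
    proof (rule lborel_pair.Fubini_integrable[OF m])
      show "AE h in lborel. integrable lborel (\<lambda>y. case (h, y) of (h, y) \<Rightarrow> ?f h y)"
        using nz
      proof eventually_elim
        case (elim h)
        show ?case using je(2)[OF elim] unfolding prod.case by (rule integrable_mult_right)
      qed
      have j: "integrable lborel (\<lambda>h. \<bar>D h\<bar> * jump_ker s \<tau> h)"
        by (rule jump_ker_integrable_mult[OF _ \<tau> s]) (use M in auto)
      have "AE h in lborel. \<bar>D h\<bar> * jump_ker s \<tau> h = (\<integral>y. norm (case (h, y) of (h, y) \<Rightarrow> ?f h y) \<partial>lborel)"
        using nz
      proof eventually_elim
        case (elim h)
        have "(\<integral>y. norm (?f h y) \<partial>lborel) = (\<integral>y. \<bar>D h\<bar> * ?g h y \<partial>lborel)"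
          unfolding real_norm_def abs_mult[of "D h"] abs_of_nonneg[OF gnn] ..
        also have "\<dots> = \<bar>D h\<bar> * jump_ker s \<tau> h"
          unfolding je(1)[OF elim] by (rule Bochner_Integration.integral_mult_right_zero)
        finally show ?case unfolding prod.case by (rule sym)
      qed
      then show "integrable lborel (\<lambda>h. \<integral>y. norm (case (h, y) of (h, y) \<Rightarrow> ?f h y) \<partial>lborel)"
        by (rule integrable_cong_AE_imp[OF j, rotated]) (unfold prod.case indicator_def atLeastAtMost_iff, measurable)
    qed
    have "(\<integral>h. D h * jump_ker s \<tau> h \<partial>lborel) = (\<integral>h. (\<integral>y. ?f h y \<partial>lborel) \<partial>lborel)"
    proof (rule integral_cong_AE)
      show "AE h in lborel. D h * jump_ker s \<tau> h = (\<integral>y. ?f h y \<partial>lborel)"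
        using nz
      proof eventually_elim
        case (elim h)
        show ?case unfolding je(1)[OF elim] by (rule Bochner_Integration.integral_mult_right_zero[symmetric])
      qed
    qed (unfold indicator_def atLeastAtMost_iff, measurable)
    also have "\<dots> = (\<integral>y. (\<integral>h. ?f h y \<partial>lborel) \<partial>lborel)"
      using lborel_pair.Fubini_integral[OF int] by simp
    also have "\<dots> = (\<integral>y. G y * I (y * sqrt \<tau>) \<partial>lborel)"
    proof (rule Bochner_Integration.integral_cong[OF refl])
      fix y :: real
      have "?f h y = G y * (if y * sqrt \<tau> \<le> norm h then D h / norm h powr q else 0)" for h
        using \<tau> by (auto simp: G_def indicator_def pos_le_divide_eq mult_ac)
      then have "(\<integral>h. ?f h y \<partial>lborel) = (\<integral>h. G y * (if y * sqrt \<tau> \<le> norm h then D h / norm h powr q else 0) \<partial>lborel)"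
        by (simp only:)
      also have "\<dots> = G y * I (y * sqrt \<tau>)"
        unfolding I_def by (rule Bochner_Integration.integral_mult_right_zero)
      finally show "(\<integral>h. ?f h y \<partial>lborel) = G y * I (y * sqrt \<tau>)" .
    qed
    finally show ?thesis .
  qed
  obtain \<delta> where \<delta>: "0 < \<delta>" "\<And>x. 0 < x \<Longrightarrow> x < \<delta> \<Longrightarrow> \<bar>I x\<bar> \<le> \<bar>L\<bar> + 1"
  proof -
    have "\<forall>\<^sub>F x in at_right 0. dist (I x) L < 1" using tendstoD[OF L', of 1] by simp
    then obtain b where "0 < b" "\<And>x. 0 < x \<Longrightarrow> x < b \<Longrightarrow> dist (I x) L < 1"
      unfolding eventually_at_right_field by auto
    then show ?thesis by (intro that[of b]) (force simp: dist_real_def)+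
  qed
  \<comment> \<open>Small radii are controlled by the convergence of \<open>I\<close> at 0, radii
    beyond \<open>\<delta>\<close> by the absolute integral at radius
    \<open>\<delta>\<close>.\<close>
  define B where "B = (\<integral>h. \<bar>if \<delta> \<le> norm h then D h / norm h powr q else 0\<bar> \<partial>lborel)"
  have I1: "\<bar>I x\<bar> \<le> B" if "\<delta> \<le> x" for x
  proof -
    have x: "0 < x" using that \<delta> by simp
    have "\<bar>I x\<bar> \<le> (\<integral>h. \<bar>if x \<le> norm h then D h / norm h powr q else 0\<bar> \<partial>lborel)"
      unfolding I_def by (rule integral_abs_bound)
    also have "\<dots> \<le> B"
      unfolding B_def using that
      by (intro integral_mono integrable_abs i[OF x, folded q_def] i[OF \<delta>(1), folded q_def]) auto
    finally show ?thesis .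
  qed
  have Ib: "\<bar>I x\<bar> \<le> max (\<bar>L\<bar> + 1) B" if "0 < x" for x
    using \<delta>(2)[of x] I1[of x] that by fastforce
  have "(\<lambda>n. \<integral>y. G y * I (y * sqrt (\<tau> n)) \<partial>lborel) \<longlonglongrightarrow> (\<integral>y. G y * L \<partial>lborel)"
  proof (rule integral_dominated_convergence[where w="\<lambda>y. \<bar>G y\<bar> * max (\<bar>L\<bar> + 1) B"])
    \<comment> \<open>The weight vanishes at \<open>y = 0\<close>, so the truncation radius 0, at
      which nothing is known about \<open>I\<close>, does not contribute.\<close>
    have Gz: "G y = 0" if "y \<le> 0" for y using that p by (auto simp: G_def radius_weight_def indicator_def)
    show "integrable lborel (\<lambda>y. \<bar>G y\<bar> * max (\<bar>L\<bar> + 1) B)"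
      using Gi by (intro integrable_mult_left integrable_abs)
    show "AE y in lborel. (\<lambda>n. G y * I (y * sqrt (\<tau> n))) \<longlonglongrightarrow> G y * L"
    proof (intro AE_I2)
      fix y :: real
      show "(\<lambda>n. G y * I (y * sqrt (\<tau> n))) \<longlonglongrightarrow> G y * L"
      proof (cases "0 < y")
        case True
        have "(\<lambda>n. y * sqrt (\<tau> n)) \<longlonglongrightarrow> y * sqrt 0"
          by (intro tendsto_intros \<tau>)
        then have "filterlim (\<lambda>n. y * sqrt (\<tau> n)) (at_right 0) sequentially"
          using True \<tau> less_imp_neq[OF \<tau>(1), symmetric] by (auto simp: filterlim_at)
        from filterlim_compose[OF L' this] show ?thesis by (rule tendsto_mult_left)
      qed (auto simp: Gz)
    qed
    show "AE y in lborel. norm (G y * I (y * sqrt (\<tau> n))) \<le> \<bar>G y\<bar> * max (\<bar>L\<bar> + 1) B" for n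
    proof (intro AE_I2)
      fix y :: real
      show "norm (G y * I (y * sqrt (\<tau> n))) \<le> \<bar>G y\<bar> * max (\<bar>L\<bar> + 1) B"
      proof (cases "0 < y")
        case True
        then show ?thesis unfolding real_norm_def abs_mult using \<tau>(1)[of n]
          by (intro mult_left_mono Ib) auto
      qed (simp add: Gz)
    qed
  qed measurable
  also have "(\<integral>y. G y * L \<partial>lborel) = (LINT y:{0..}|lborel. radius_weight p y) / Z * L"
    unfolding G_def set_lebesgue_integral_def by simp
  finally show ?thesis
    unfolding eq[OF \<tau>(1)] p_def q_def Z_def by simp
qed

section \<open>A small potential with infinite fractional Laplacian on a null set\<close>

text \<open>The exponents add up to -2, so in the variable \<open>(r - t) / t\<close>, whose
  derivative is \<open>- r / t\<^sup>2\<close>, the integrand is a pure power and the incomplete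
  Beta integral has an elementary primitive.\<close>

lemma nn_integral_beta_tail:
  assumes s: "0 < s" and m: "0 < m" "m < r"
  shows "(\<integral>\<^sup>+t. ennreal (t powr (- 1 - s) * (r - t) powr (s - 1)) * indicator {m..r} t \<partial>lborel)
    = ennreal (((r - m) / m) powr s / (s * r))"
proof -
  let ?F = "\<lambda>t. - (((r - t) / t) powr s / (s * r))"
  have d: "(?F has_real_derivative t powr (- 1 - s) * (r - t) powr (s - 1)) (at t)" if t: "m < t" "t < r" for t
  proof -
    have t0: "0 < t" using t m by simp
    have 1: "((\<lambda>t. (r - t) / t) has_real_derivative - (r / t\<^sup>2)) (at t)"
      using t0 by (auto intro!: derivative_eq_intros simp: power2_eq_square field_simps)
    have 2: "0 < (r - t) / t" using t t0 by simp
    have "((\<lambda>t. ((r - t) / t) powr s) has_real_derivative s * ((r - t) / t) powr (s - 1) * - (r / t\<^sup>2)) (at t)"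
      using DERIV_chain2[OF has_real_derivative_powr[OF 2] 1] .
    from DERIV_minus[OF DERIV_cdivide[OF this, of "s * r"]]
    have "(?F has_real_derivative - (s * ((r - t) / t) powr (s - 1) * - (r / t\<^sup>2) / (s * r))) (at t)" .
    moreover have "- (s * ((r - t) / t) powr (s - 1) * - (r / t\<^sup>2) / (s * r)) = ((r - t) / t) powr (s - 1) / t\<^sup>2"
      using s m by simp
    also have "\<dots> = (r - t) powr (s - 1) / (t powr (s - 1) * t powr 2)"
      using t t0 by (simp add: powr_divide)
    also have "t powr (s - 1) * t powr 2 = t powr (s + 1)"
      unfolding powr_add[symmetric] by (rule arg_cong[where f="\<lambda>x. t powr x"]) simp
    also have "(r - t) powr (s - 1) / t powr (s + 1) = (r - t) powr (s - 1) * t powr (- (s + 1))"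
      unfolding powr_minus divide_inverse ..
    also have "- (s + 1) = - 1 - s" by simp
    also have "(r - t) powr (s - 1) * t powr (- 1 - s) = t powr (- 1 - s) * (r - t) powr (s - 1)" by (rule mult.commute)
    finally show ?thesis by (simp only:)
  qed
  have "((\<lambda>t. t powr (- 1 - s) * (r - t) powr (s - 1)) has_integral (?F r - ?F m)) {m..r}"
  proof (rule fundamental_theorem_of_calculus_interior)
    show "continuous_on {m..r} ?F"
      using s m by (auto intro!: continuous_intros continuous_on_powr')
    show "(?F has_vector_derivative t powr (- 1 - s) * (r - t) powr (s - 1)) (at t)" if "t \<in> {m<..<r}" for t
      using d[of t] that by (simp add: has_real_derivative_iff_has_vector_derivative[symmetric])
  qed (use m in simp)
  then have "((\<lambda>t. t powr (- 1 - s) * (r - t) powr (s - 1)) has_integral (((r - m) / m) powr s / (s * r))) {m..r}"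
    using s by simp
  from nn_integral_has_integral_lebesgue[OF _ this]
  show ?thesis by (simp add: mult.commute ennreal_indicator[symmetric] ennreal_mult'[symmetric])
qed

text \<open>Integrating the heat flow against \<open>r powr (s - 1)\<close> over all times gives a
  multiple of the Riesz potential of order \<open>2 * s\<close>. The cut-off at time 1 avoids the
  divergence at large times, which occurs in dimension 1 when \<open>1 \<le> 2 * s\<close>.\<close>

abbreviation riesz_weight :: "real \<Rightarrow> real \<Rightarrow> ennreal"
  where "riesz_weight s r \<equiv> ennreal (r powr (s - 1)) * indicator {0..1} r"

text \<open>Superharmonicity of the Riesz potential, reduced to one time variable: \<open>\<phi> r\<close> stands for the
  heat flow of the density at time \<open>r\<close>. Only times beyond the cut-off \<open>1\<close> of the potential
  contribute to the error.\<close>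

lemma potential_time_estimate:
  fixes \<phi> :: "real \<Rightarrow> ennreal"
  assumes s: "0 < s" "s < 1" and [measurable]: "\<phi> \<in> borel_measurable borel"
    and A: "0 \<le> A" "\<And>r. 1 \<le> r \<Longrightarrow> \<phi> r \<le> ennreal A" and \<tau>: "0 < \<tau>" "\<tau> \<le> 1"
  shows "(\<integral>\<^sup>+t. time_weight s \<tau> t *
           (\<integral>\<^sup>+r. riesz_weight s r * \<phi> (r + t) \<partial>lborel) \<partial>lborel)
       + ennreal (\<tau> powr (- s) / s) * (\<integral>\<^sup>+r. ennreal (r powr (s - 1)) * indicator {0..<\<tau>} r * \<phi> r \<partial>lborel)
     \<le> ennreal (\<tau> powr (- s) / s) * (\<integral>\<^sup>+r. riesz_weight s r * \<phi> r \<partial>lborel)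
       + ennreal (A * ((1 / (1 - s) + 1 / s) / s))"
proof -
  let ?c = "\<tau> powr (- s) / s"
  \<comment> \<open>After the shift of \<open>r\<close> by \<open>t\<close> and an exchange of the
    integrals, \<open>?N r\<close> is the total weight with which \<open>\<phi> r\<close>
    enters.\<close>
  let ?N = "\<lambda>r. (\<integral>\<^sup>+t. time_weight s \<tau> t * (ennreal ((r - t) powr (s - 1)) * indicator {0..1} (r - t)) \<partial>lborel)"
  let ?tail = "\<lambda>r. ennreal ((r - 1) powr (- s) / (s * r)) * indicator {1<..} r"
  have X: "(\<integral>\<^sup>+t. time_weight s \<tau> t *
           (\<integral>\<^sup>+r. riesz_weight s r * \<phi> (r + t) \<partial>lborel) \<partial>lborel)
    = (\<integral>\<^sup>+r. ?N r * \<phi> r \<partial>lborel)"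
  proof -
    have "(\<integral>\<^sup>+r. riesz_weight s r * \<phi> (r + t) \<partial>lborel)
        = (\<integral>\<^sup>+r. ennreal ((r - t) powr (s - 1)) * indicator {0..1} (r - t) * \<phi> r \<partial>lborel)" for t
      by (subst nn_integral_real_affine[where c=1 and t="-t"]) (auto simp: indicator_def)
    then have "(\<integral>\<^sup>+t. time_weight s \<tau> t *
           (\<integral>\<^sup>+r. riesz_weight s r * \<phi> (r + t) \<partial>lborel) \<partial>lborel)
       = (\<integral>\<^sup>+t. (\<integral>\<^sup>+r. time_weight s \<tau> t *
          (ennreal ((r - t) powr (s - 1)) * indicator {0..1} (r - t) * \<phi> r) \<partial>lborel) \<partial>lborel)"
      by (simp add: nn_integral_cmult)
    also have "\<dots> = (\<integral>\<^sup>+r. (\<integral>\<^sup>+t. time_weight s \<tau> t *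
          (ennreal ((r - t) powr (s - 1)) * indicator {0..1} (r - t) * \<phi> r) \<partial>lborel) \<partial>lborel)"
      by (rule tonelli_lborel) (unfold indicator_def atLeast_iff atLeastAtMost_iff, measurable)
    also have "\<dots> = (\<integral>\<^sup>+r. ?N r * \<phi> r \<partial>lborel)"
      by (intro nn_integral_cong, subst nn_integral_multc[symmetric]) (auto simp: mult.assoc)
    finally show ?thesis .
  qed
  have N0: "?N r = 0" if "r < \<tau>" for r
  proof -
    have "(\<lambda>t. time_weight s \<tau> t * (ennreal ((r - t) powr (s - 1)) * indicator {0..1} (r - t))) = (\<lambda>_. 0)"
      using that by (auto simp: indicator_def fun_eq_iff)
    then show ?thesis by simp
  qed
  have N1: "?N r \<le> ennreal (((r - m) / m) powr s / (s * r))" if m: "0 < m" "m < r" "m = max \<tau> (r - 1)" for r m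
  proof -
    have "?N r \<le> (\<integral>\<^sup>+t. ennreal (t powr (- 1 - s) * (r - t) powr (s - 1)) * indicator {m..r} t \<partial>lborel)"
      using m by (intro nn_integral_mono) (auto simp: indicator_def ennreal_mult')
    then show ?thesis using nn_integral_beta_tail[OF s(1) m(1,2)] by simp
  qed
  \<comment> \<open>Below \<open>\<tau>\<close> no time contributes to \<open>?N\<close>, so the
    full weight \<open>?c * r powr (s - 1)\<close> is left over as a gain. Between
    \<open>\<tau>\<close> and 1 the Beta integral is at most this weight. Beyond 1 the cut-off
    forces \<open>t \<ge> r - 1\<close>, which leaves the tail. At \<open>r = \<tau>\<close> the
    interval of the Beta integral may degenerate to a point.\<close>
  have bd: "?N r * \<phi> r + ennreal ?c * (ennreal (r powr (s - 1)) * indicator {0..<\<tau>} r * \<phi> r)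
      \<le> ennreal ?c * (riesz_weight s r * \<phi> r) + ennreal A * ?tail r" if rt: "r \<noteq> \<tau>" for r
  proof -
    consider "r < \<tau>" | "\<tau> < r" "r \<le> 1" | "1 < r" "\<tau> < r" using \<tau> rt by linarith
    then show ?thesis
    proof cases
      case 1
      then show ?thesis using N0[OF 1] \<tau>
        by (cases "0 \<le> r") (auto simp: indicator_def)
    next
      case 2
      then have r0: "0 < r" using \<tau> by simp
      have "?N r \<le> ennreal (((r - \<tau>) / \<tau>) powr s / (s * r))"
        using 2 \<tau> by (intro N1) auto
      also have "\<dots> \<le> ennreal (?c * r powr (s - 1))"
      proof (rule ennreal_leI)
        have "((r - \<tau>) / \<tau>) powr s \<le> (r / \<tau>) powr s" using 2 \<tau> s by (intro powr_mono2 divide_right_mono) auto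
        also have "\<dots> = r powr s * \<tau> powr (- s)" using r0 \<tau> by (simp add: powr_divide powr_minus_divide)
        finally have "((r - \<tau>) / \<tau>) powr s / (s * r) \<le> r powr s * \<tau> powr (- s) / (s * r)"
          using s r0 by (intro divide_right_mono) auto
        also have "\<dots> = ?c * (r powr s / r powr 1)" using r0 by simp
        also have "r powr s / r powr 1 = r powr (s - 1)" by (rule powr_diff[symmetric])
        finally show "((r - \<tau>) / \<tau>) powr s / (s * r) \<le> ?c * r powr (s - 1)" .
      qed
      also have "\<dots> = ennreal ?c * ennreal (r powr (s - 1))" using s by (intro ennreal_mult) auto
      finally have "?N r * \<phi> r \<le> ennreal ?c * ennreal (r powr (s - 1)) * \<phi> r" by (rule mult_right_mono) simp
      then show ?thesis using 2 r0 by (auto simp: mult.assoc)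
    next
      case 3
      let ?m = "max \<tau> (r - 1)"
      have m: "0 < ?m" "?m < r" using 3 \<tau> by auto
      have "?N r \<le> ennreal (((r - ?m) / ?m) powr s / (s * r))" by (rule N1[OF m refl])
      also have "\<dots> \<le> ennreal ((r - 1) powr (- s) / (s * r))"
      proof (intro ennreal_leI divide_right_mono)
        have "((r - ?m) / ?m) powr s \<le> (1 / (r - 1)) powr s"
          using m 3 s by (intro powr_mono2 frac_le) auto
        also have "\<dots> = (r - 1) powr (- s)" using 3 by (simp add: powr_divide powr_minus_divide)
        finally show "((r - ?m) / ?m) powr s \<le> (r - 1) powr (- s)" .
      qed (use 3 s \<tau> in auto)
      finally have "?N r * \<phi> r \<le> ennreal ((r - 1) powr (- s) / (s * r)) * ennreal A"
        using A(2)[of r] 3 by (intro mult_mono) auto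
      then show ?thesis using 3 by (simp add: mult.commute)
    qed
  qed
  have tail: "(\<integral>\<^sup>+r. ?tail r \<partial>lborel) \<le> ennreal ((1 / (1 - s) + 1 / s) / s)"
  proof -
    have "(\<integral>\<^sup>+r. ?tail r \<partial>lborel) = (\<integral>\<^sup>+r. ennreal (r powr (- s) / (s * (r + 1))) * indicator {0<..} r \<partial>lborel)"
      by (subst nn_integral_real_affine[where c=1 and t=1]) (auto simp: indicator_def add.commute)
    also have "\<dots> \<le> (\<integral>\<^sup>+r. ennreal (1 / s) * (ennreal (r powr (- s)) * indicator {0..1} r + ennreal (r powr (- 1 - s)) * indicator {1..} r) \<partial>lborel)"
    proof (intro nn_integral_mono)
      fix r :: real
      show "ennreal (r powr (- s) / (s * (r + 1))) * indicator {0<..} r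
         \<le> ennreal (1 / s) * (ennreal (r powr (- s)) * indicator {0..1} r + ennreal (r powr (- 1 - s)) * indicator {1..} r)"
      proof -
        consider "r \<le> 0" | "0 < r" "r \<le> 1" | "1 < r" by linarith
        then show ?thesis
        proof cases
          case 2
          have "r powr (- s) / (s * (r + 1)) \<le> r powr (- s) / (s * 1)"
            using 2 s by (intro divide_left_mono mult_left_mono mult_pos_pos) auto
          then have "ennreal (r powr (- s) / (s * (r + 1))) \<le> ennreal (1 / s) * ennreal (r powr (- s))"
            using s by (subst ennreal_mult[symmetric]) (auto intro: ennreal_leI)
          also have "\<dots> \<le> ennreal (1 / s) * (ennreal (r powr (- s)) * indicator {0..1} r + ennreal (r powr (- 1 - s)) * indicator {1..} r)"
            using 2 by (intro mult_left_mono) (auto simp: indicator_def)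
          finally show ?thesis using 2 by simp
        next
          case 3
          have e: "r powr (- 1 - s) = r powr (- s) / r"
            using 3 powr_add[of r "- 1" "- s"] by (simp add: powr_minus_divide)
          have "r powr (- s) / (s * (r + 1)) \<le> r powr (- s) / (s * r)"
            using 3 s by (intro divide_left_mono mult_left_mono mult_pos_pos) auto
          also have "\<dots> = (1 / s) * r powr (- 1 - s)" unfolding e by simp
          finally have "ennreal (r powr (- s) / (s * (r + 1))) \<le> ennreal (1 / s) * ennreal (r powr (- 1 - s))"
            using s by (subst ennreal_mult[symmetric]) (auto intro: ennreal_leI)
          also have "\<dots> \<le> ennreal (1 / s) * (ennreal (r powr (- s)) * indicator {0..1} r + ennreal (r powr (- 1 - s)) * indicator {1..} r)"
            using 3 by (intro mult_left_mono) (auto simp: indicator_def)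
          finally show ?thesis using 3 by simp
        qed simp
      qed
    qed
    also have "\<dots> = ennreal (1 / s) * (ennreal (1 / (1 - s)) + ennreal (1 / s))"
    proof -
      have 1: "(\<integral>\<^sup>+t. ennreal (t powr (- s)) * indicator {0..1} t \<partial>lborel) = ennreal (1 / (1 - s))"
        using nn_integral_powr_Ioc[of "-s" 1] s by simp
      have 2: "(\<integral>\<^sup>+t. ennreal (t powr (- 1 - s)) * indicator {1..} t \<partial>lborel) = ennreal (1 / s)"
        using nn_integral_powr_atLeast[of 1 s] s by simp
      show ?thesis unfolding 1[symmetric] 2[symmetric]
        by (subst nn_integral_add[symmetric], measurable, rule nn_integral_cmult, measurable)
    qed
    also have "\<dots> = ennreal ((1 / (1 - s) + 1 / s) / s)"
      using s by (subst ennreal_plus[symmetric]) (auto simp: ennreal_mult'[symmetric] simp del: ennreal_plus)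
    finally show ?thesis .
  qed
  have "(\<integral>\<^sup>+r. ?N r * \<phi> r \<partial>lborel) + ennreal ?c * (\<integral>\<^sup>+r. ennreal (r powr (s - 1)) * indicator {0..<\<tau>} r * \<phi> r \<partial>lborel)
     = (\<integral>\<^sup>+r. ?N r * \<phi> r + ennreal ?c * (ennreal (r powr (s - 1)) * indicator {0..<\<tau>} r * \<phi> r) \<partial>lborel)"
    by (subst nn_integral_add, unfold indicator_def atLeast_iff atLeastAtMost_iff, measurable)
       (subst nn_integral_cmult, measurable)
  also have "\<dots> \<le> (\<integral>\<^sup>+r. ennreal ?c * (riesz_weight s r * \<phi> r) + ennreal A * ?tail r \<partial>lborel)"
  proof (rule nn_integral_mono_AE)
    show "AE r in lborel. ?N r * \<phi> r + ennreal ?c * (ennreal (r powr (s - 1)) * indicator {0..<\<tau>} r * \<phi> r)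
      \<le> ennreal ?c * (riesz_weight s r * \<phi> r) + ennreal A * ?tail r"
      using AE_lborel_singleton[of \<tau>] by eventually_elim (rule bd)
  qed
  also have "\<dots> = ennreal ?c * (\<integral>\<^sup>+r. riesz_weight s r * \<phi> r \<partial>lborel) + ennreal A * (\<integral>\<^sup>+r. ?tail r \<partial>lborel)"
    by (subst nn_integral_add, measurable) (subst (1 2) nn_integral_cmult, measurable)
  also have "\<dots> \<le> ennreal ?c * (\<integral>\<^sup>+r. riesz_weight s r * \<phi> r \<partial>lborel) + ennreal A * ennreal ((1 / (1 - s) + 1 / s) / s)"
    by (intro add_left_mono mult_left_mono tail) simp
  finally show ?thesis unfolding X using A s by (subst ennreal_mult) auto
qed

text \<open>Two bounds are interpolated: 1, from the mass of the heat kernel, and \<open>v\<close>,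
  from its maximum times the measure of \<open>U\<close>. For an exponent in (0,1] the smaller of 1
  and \<open>v\<close> is at most that power of \<open>v\<close>. The exponent \<open>s / N\<close>
  produces \<open>r powr (- s / 2)\<close>, whose product with \<open>r powr (s - 1)\<close> is
  still integrable at 0.\<close>

lemma heat_flow_indicator_le:
  fixes U :: "'a::euclidean_space set"
  assumes U: "U \<in> sets borel" and s: "0 < s" "s < 1" and r: "0 < r"
    and u: "0 \<le> u" "emeasure lborel U \<le> ennreal (gauss_mass TYPE('a) * u powr (DIM('a) / s))"
  shows "heat_flow r (indicator U) x \<le> ennreal (r powr (- s / 2) * u)"
proof -
  define N where "N = real DIM('a)"
  have N: "1 \<le> N" using DIM_positive[where 'a='a] unfolding N_def by linarith
  define Z where "Z = gauss_mass TYPE('a)"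
  have Z: "0 < Z" unfolding Z_def by (rule gauss_mass_pos)
  define v where "v = u powr (N / s) / r powr (N / 2)"
  have v0: "0 \<le> v" using r by (simp add: v_def)
  have 1: "heat_flow r (indicator U) x \<le> 1"
  proof -
    have "heat_flow r (indicator U) x \<le> (\<integral>\<^sup>+(h::'a). heat r h \<partial>lborel)"
      unfolding heat_flow_def by (intro nn_integral_mono) (auto simp: indicator_def)
    then show ?thesis using nn_integral_heat[OF r, where 'a='a] by simp
  qed
  have 2: "heat_flow r (indicator U) x \<le> ennreal v"
  proof -
    have "heat_flow r (indicator U) x = (\<integral>\<^sup>+y. indicator U y * ennreal (heat r (y - x)) \<partial>lborel)"
      using U by (intro heat_flow_alt) (auto intro!: borel_measurable_indicator)
    also have "\<dots> \<le> (\<integral>\<^sup>+y. ennreal (1 / (r powr (N / 2) * Z)) * indicator U y \<partial>lborel)"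
      using heat_le[OF r, where 'a='a] unfolding N_def Z_def
      by (intro nn_integral_mono) (auto simp: indicator_def intro: ennreal_leI)
    also have "\<dots> = ennreal (1 / (r powr (N / 2) * Z)) * emeasure lborel U"
      using U by (intro nn_integral_cmult_indicator) simp
    also have "\<dots> \<le> ennreal (1 / (r powr (N / 2) * Z)) * ennreal (Z * u powr (N / s))"
      using u(2) unfolding N_def Z_def by (intro mult_left_mono) auto
    also have "\<dots> = ennreal v"
      using Z r by (subst ennreal_mult[symmetric]) (auto simp: v_def)
    finally show ?thesis .
  qed
  have q: "s / N \<le> 1" "0 < s / N" using s N by auto
  have 3: "heat_flow r (indicator U) x \<le> ennreal (v powr (s / N))"
  proof (cases "v \<le> 1")
    case True
    have "v powr 1 \<le> v powr (s / N)" if "0 < v" using True that q by (intro powr_mono') auto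
    then have "v \<le> v powr (s / N)" using v0 by (cases "v = 0") auto
    then show ?thesis using 2 by (meson ennreal_leI order_trans)
  next
    case False
    then have "1 \<le> v powr (s / N)" using q by (intro ge_one_powr_ge_zero) auto
    then have "1 \<le> ennreal (v powr (s / N))" by (metis ennreal_1 ennreal_leI)
    then show ?thesis using 1 by (rule order_trans[rotated])
  qed
  also have "v powr (s / N) = r powr (- s / 2) * u"
    using u r s N by (simp add: v_def powr_divide powr_powr powr_minus_divide)
  finally show ?thesis .
qed

text \<open>The density is the sum of the indicators of open sets around \<open>E\<close> whose
  measures shrink so fast that the bounds of \<open>heat_flow_indicator_le\<close> sum up to the one
  for \<open>e\<close>. A point of \<open>E\<close> has, for each \<open>M\<close>, a neighbourhood
  contained in the first \<open>M\<close> sets, where the density is at least \<open>M\<close>; at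
  small times at least a fixed fraction \<open>c\<close> of the heat mass stays in it.\<close>

lemma null_set_density:
  fixes E :: "'a::euclidean_space set"
  assumes E: "E \<in> null_sets lebesgue" and s: "0 < s" "s < 1" and e: "0 < e"
  obtains f :: "'a \<Rightarrow> ennreal" where "f \<in> borel_measurable borel" "integral\<^sup>N lborel f < \<infinity>"
    "\<And>r x. 0 < r \<Longrightarrow> heat_flow r f x \<le> ennreal (r powr (- s / 2) * e)"
    "\<And>x m. x \<in> E \<Longrightarrow> \<exists>r0>0. \<forall>r. 0 < r \<and> r \<le> r0 \<longrightarrow> of_nat m \<le> heat_flow r f x"
proof -
  define u where "u k = e * (1/2) ^ Suc k" for k :: nat
  have u: "0 < u k" for k using e by (simp add: u_def)
  \<comment> \<open>The first bound is the measure allowed by \<open>heat_flow_indicator_le\<close>,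
    the second makes the density integrable.\<close>
  define b where "b k = min (gauss_mass TYPE('a) * u k powr (DIM('a) / s)) ((1/2) ^ Suc k)" for k
  have b: "0 < b k" for k using u[of k] gauss_mass_pos[where 'a='a] by (simp add: b_def)
  have "\<exists>U. open U \<and> E \<subseteq> U \<and> emeasure lborel U \<le> ennreal (b k)" for k
  proof -
    have El: "E \<in> sets lebesgue" and E0: "emeasure lebesgue E = 0" using E by auto
    obtain T where T: "open T" "E \<subseteq> T" "T - E \<in> lmeasurable" "emeasure lebesgue (T - E) < ennreal (b k)"
      using sets_lebesgue_outer_open[OF El b[of k]] by metis
    have "emeasure lebesgue T = emeasure lebesgue (T - E)"
      using emeasure_Diff_null_set[OF E, of T] T(1) by auto
    then have "emeasure lborel T \<le> ennreal (b k)" using T by simp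
    then show ?thesis using T by auto
  qed
  then obtain U where U: "\<And>k. open (U k)" "\<And>k. E \<subseteq> U k" "\<And>k. emeasure lborel (U k) \<le> ennreal (b k)" by metis
  have Ub [measurable]: "U k \<in> sets borel" for k using U(1) by auto
  define f where "f x = (\<Sum>k. indicator (U k) x :: ennreal)" for x
  have fm [measurable]: "f \<in> borel_measurable borel" unfolding f_def by measurable
  have hf: "heat_flow r f x = (\<Sum>k. heat_flow r (indicator (U k)) x)" for r x
    unfolding heat_flow_def f_def
    by (subst nn_integral_suminf[symmetric]) (auto intro!: nn_integral_cong simp: ennreal_suminf_multc)
  have sums: "(\<lambda>k. c * (1/2) ^ Suc k) sums c" for c :: real
    using sums_mult[OF power_half_series, of c] by simp
  have hk: "heat_flow r (indicator (U k)) x \<le> ennreal (r powr (- s / 2) * u k)" if "0 < r" for r x k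
  proof (rule heat_flow_indicator_le[OF Ub s that less_imp_le[OF u]])
    show "emeasure lborel (U k) \<le> ennreal (gauss_mass TYPE('a) * u k powr (DIM('a) / s))"
      using U(3)[of k] by (rule order_trans) (auto simp: b_def intro: ennreal_leI)
  qed
  show ?thesis
  proof
    show "f \<in> borel_measurable borel" by fact
    have "integral\<^sup>N lborel f = (\<Sum>k. emeasure lborel (U k))"
      unfolding f_def by (subst nn_integral_suminf) auto
    also have "\<dots> \<le> (\<Sum>k. ennreal ((1/2) ^ Suc k))"
      using U(3) by (intro suminf_le) (auto intro: order_trans[OF U(3)] ennreal_leI simp: b_def)
    also have "\<dots> = ennreal 1"
      using sums[of 1] by (intro suminf_ennreal_eq) auto
    finally show "integral\<^sup>N lborel f < \<infinity>" by (auto simp: top.extremum_strict intro: le_less_trans)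
    show "heat_flow r f x \<le> ennreal (r powr (- s / 2) * e)" if "0 < r" for r x
    proof -
      have "heat_flow r f x \<le> (\<Sum>k. ennreal (r powr (- s / 2) * u k))"
        unfolding hf using hk[OF that] by (intro suminf_le) auto
      also have "\<dots> = ennreal (r powr (- s / 2) * e)"
        using sums[of "r powr (- s / 2) * e"] e
        by (intro suminf_ennreal_eq) (auto simp: u_def mult_ac)
      finally show ?thesis .
    qed
    fix x :: 'a and m :: nat assume x: "x \<in> E"
    have [measurable]: "ball (0::'a) 1 \<in> sets borel" by simp
    define c where "c = (\<integral>\<^sup>+(h::'a). indicator (ball 0 1) h * ennreal (heat 1 h) \<partial>lborel)"
    have c0: "0 < c"
    proof -
      let ?l = "exp (- 1) / gauss_mass TYPE('a)"
      have "0 < ennreal ?l * emeasure lborel (ball (0::'a) 1)"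
        using gauss_mass_pos[where 'a='a]
        by (auto simp: ennreal_zero_less_mult_iff emeasure_ball)
      also have "\<dots> = (\<integral>\<^sup>+(h::'a). ennreal ?l * indicator (ball 0 1) h \<partial>lborel)"
        by (intro nn_integral_cmult_indicator[symmetric]) auto
      also have "\<dots> \<le> c"
        unfolding c_def
      proof (intro nn_integral_mono)
        fix h :: 'a
        have "?l \<le> heat 1 h" if "norm h < 1"
        proof -
          have "(norm h)\<^sup>2 \<le> 1" using that by (simp add: power_le_one)
          then show ?thesis unfolding heat_def using gauss_mass_pos[where 'a='a] by (simp add: divide_right_mono)
        qed
        then show "ennreal ?l * indicator (ball 0 1) h \<le> indicator (ball 0 1) h * ennreal (heat 1 h)"
          by (auto simp: indicator_def intro: ennreal_leI)
      qed
      finally show ?thesis .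
    qed
    have "c \<le> (\<integral>\<^sup>+(h::'a). ennreal (heat 1 h) \<partial>lborel)"
      unfolding c_def by (intro nn_integral_mono) (auto simp: indicator_def)
    then have c1: "c \<le> 1" using nn_integral_heat[of 1, where 'a='a] by simp
    obtain M :: nat where M: "of_nat m \<le> of_nat M * c"
    proof -
      define d where "d = enn2real c"
      have "c < top" using c1 by (rule le_less_trans) simp
      then have cd: "c = ennreal d" "0 < d" using c0 by (simp_all add: d_def enn2real_positive_iff)
      obtain M :: nat where "real m / d \<le> real M" using real_arch_simple by blast
      then have "real m \<le> real M * d" using cd by (simp add: field_simps)
      then have "ennreal (real m) \<le> ennreal (real M * d)" by (rule ennreal_leI)
      then show ?thesis using cd by (intro that[of M]) (simp add: ennreal_mult' ennreal_of_nat_eq_real_of_nat)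
    qed
    have "open (\<Inter>k<M. U k)" using U(1) by auto
    moreover have "x \<in> (\<Inter>k<M. U k)" using U(2) x by auto
    ultimately obtain \<rho> where \<rho>: "0 < \<rho>" "ball x \<rho> \<subseteq> (\<Inter>k<M. U k)"
      by (meson open_contains_ball)
    have fM: "of_nat M \<le> f y" if "y \<in> ball x \<rho>" for y
    proof -
      have "of_nat M = (\<Sum>k<M. indicator (U k) y :: ennreal)"
        using that \<rho> by (subst sum.cong[OF refl, of _ _ "\<lambda>_. 1"]) (auto simp: indicator_def)
      also have "\<dots> \<le> f y" unfolding f_def by (intro sum_le_suminf) auto
      finally show ?thesis .
    qed
    show "\<exists>r0>0. \<forall>r. 0 < r \<and> r \<le> r0 \<longrightarrow> of_nat m \<le> heat_flow r f x"
    proof (intro exI[of _ "\<rho>\<^sup>2"] conjI allI impI)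
      show "0 < \<rho>\<^sup>2" using \<rho> by simp
      fix r assume r: "0 < r \<and> r \<le> \<rho>\<^sup>2"
      have sr: "sqrt r \<le> \<rho>" using r \<rho> by (simp add: real_le_lsqrt)
      have "of_nat m \<le> of_nat M * c" by (rule M)
      also have "\<dots> = (\<integral>\<^sup>+(h::'a). of_nat M * (indicator (ball 0 1) h * ennreal (heat 1 h)) \<partial>lborel)"
        unfolding c_def by (rule nn_integral_cmult[symmetric]) measurable
      also have "\<dots> \<le> (\<integral>\<^sup>+h. f (x + sqrt r *\<^sub>R h) * ennreal (heat 1 h) \<partial>lborel)"
      proof (intro nn_integral_mono)
        fix h :: 'a
        have "of_nat M * indicator (ball 0 1) h \<le> f (x + sqrt r *\<^sub>R h)"
        proof (cases "norm h < 1")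
          case True
          have "sqrt r * norm h < \<rho>"
          proof (cases "h = 0")
            case False
            have "sqrt r * norm h < sqrt r * 1" using True r by (intro mult_strict_left_mono) auto
            then show ?thesis using sr by simp
          qed (use \<rho> in simp)
          then have "x + sqrt r *\<^sub>R h \<in> ball x \<rho>" using r by (simp add: dist_norm)
          from fM[OF this] True show ?thesis by simp
        qed simp
        from mult_right_mono[OF this, of "ennreal (heat 1 h)"]
        show "of_nat M * (indicator (ball 0 1) h * ennreal (heat 1 h)) \<le> f (x + sqrt r *\<^sub>R h) * ennreal (heat 1 h)"
          by (simp add: mult.assoc)
      qed
      also have "\<dots> = heat_flow r f x"
        unfolding heat_flow_def using r by (intro nn_integral_heat_scale[symmetric]) auto
      finally show "of_nat m \<le> heat_flow r f x" .
    qed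
  qed
qed

text \<open>A convolution of an integrable function with a bounded continuous kernel. The potential
  inherits continuity from it, and continuity is what makes a maximum over a compact ball
  exist.\<close>

lemma heat_flow_continuous:
  fixes f :: "'a::euclidean_space \<Rightarrow> ennreal"
  assumes [measurable]: "f \<in> borel_measurable borel" and fi: "integral\<^sup>N lborel f < \<infinity>" and r: "0 < r"
  shows "continuous_on UNIV (\<lambda>x. enn2real (heat_flow r f x))"
proof -
  define g where "g y = enn2real (f y)" for y
  have [measurable]: "g \<in> borel_measurable borel" unfolding g_def by measurable
  have gnn: "0 \<le> g y" for y by (simp add: g_def)
  have fin: "AE y in lborel. f y \<noteq> \<infinity>"
    using fi by (intro nn_integral_PInf_AE) auto
  have fg: "AE y in lborel. f y = ennreal (g y)"
    using fin by eventually_elim (simp add: g_def less_top)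
  have gi: "integrable lborel g"
  proof -
    have "(\<integral>\<^sup>+y. ennreal (norm (g y)) \<partial>lborel) = integral\<^sup>N lborel f"
      by (rule nn_integral_cong_AE, rule AE_mp[OF fg], rule AE_I2) (simp add: gnn)
    then show ?thesis unfolding integrable_iff_bounded using fi by simp
  qed
  let ?c = "1 / (r powr (real DIM('a) / 2) * gauss_mass TYPE('a))"
  have eq: "enn2real (heat_flow r f x) = (\<integral>y. g y * heat r (y - x) \<partial>lborel)" for x
  proof -
    have "heat_flow r f x = (\<integral>\<^sup>+y. ennreal (g y * heat r (y - x)) \<partial>lborel)"
      unfolding heat_flow_alt[OF assms(1)]
      by (rule nn_integral_cong_AE, rule AE_mp[OF fg], rule AE_I2) (simp add: ennreal_mult' gnn)
    then show ?thesis
      by (subst integral_eq_nn_integral) (auto simp: gnn heat_nonneg)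
  qed
  show ?thesis unfolding eq
  proof (rule continuous_at_imp_continuous_on, intro ballI)
    fix x :: 'a
    show "isCont (\<lambda>x. \<integral>y. g y * heat r (y - x) \<partial>lborel) x"
      unfolding continuous_at_sequentially
    proof (intro allI impI)
      fix X assume X: "X \<longlonglongrightarrow> x"
      show "((\<lambda>x. \<integral>y. g y * heat r (y - x) \<partial>lborel) \<circ> X) \<longlonglongrightarrow> (\<integral>y. g y * heat r (y - x) \<partial>lborel)"
        unfolding comp_def
      proof (rule integral_dominated_convergence[where w="\<lambda>y. \<bar>g y\<bar> * ?c"])
        show "integrable lborel (\<lambda>y. \<bar>g y\<bar> * ?c)" using gi by (intro integrable_mult_left integrable_abs)
        show "AE y in lborel. (\<lambda>n. g y * heat r (y - X n)) \<longlonglongrightarrow> g y * heat r (y - x)"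
          unfolding heat_def using X r gauss_mass_pos[where 'a='a] by (intro AE_I2 tendsto_intros) auto
        show "AE y in lborel. norm (g y * heat r (y - X n)) \<le> \<bar>g y\<bar> * ?c" for n
        proof (intro AE_I2)
          fix y
          show "norm (g y * heat r (y - X n)) \<le> \<bar>g y\<bar> * ?c"
            unfolding real_norm_def abs_mult abs_of_nonneg[OF heat_nonneg]
            by (rule mult_left_mono[OF heat_le[OF r]]) simp
        qed
      qed measurable
    qed
  qed
qed

abbreviation jump_op :: "real \<Rightarrow> real \<Rightarrow> ('a::euclidean_space \<Rightarrow> real) \<Rightarrow> 'a \<Rightarrow> real"
  where "jump_op s \<tau> u x \<equiv> (\<integral>h. (u x - u (x + h)) * jump_ker s \<tau> h \<partial>lborel)"

text \<open>The potential is the cut-off Riesz integral of the density from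
  \<open>null_set_density\<close>. By the semigroup law its integral against the jump kernel is the
  first term in \<open>potential_time_estimate\<close> with
  \<open>\<phi> r = heat_flow r f x\<close>. The error term there gives the lower bound
  \<open>- e\<close>, and the gain term is unbounded on \<open>E\<close> as \<open>\<tau>\<close>
  tends to 0.\<close>

lemma null_set_potential:
  fixes E :: "'a::euclidean_space set"
  assumes E: "E \<in> null_sets lebesgue" and s: "0 < s" "s < 1" and e: "0 < e"
  obtains w :: "'a \<Rightarrow> real" where "continuous_on UNIV w" "\<And>x. 0 \<le> w x" "\<And>x. w x \<le> e"
    "\<And>\<tau> x. 0 < \<tau> \<Longrightarrow> \<tau> \<le> 1 \<Longrightarrow> - e \<le> jump_op s \<tau> w x"
    "\<And>x K. x \<in> E \<Longrightarrow> \<exists>\<tau>0>0. \<forall>\<tau>. 0 < \<tau> \<and> \<tau> \<le> \<tau>0 \<longrightarrow> K \<le> jump_op s \<tau> w x"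
proof -
  define C where "C = (1 / (1 - s) + 1 / s) / s"
  have C: "0 < C" using s by (simp add: C_def add_pos_pos)
  \<comment> \<open>The first bound gives \<open>w x \<le> e\<close>, because
    \<open>r powr (s / 2 - 1)\<close> has integral \<open>2 / s\<close> over the unit interval; the
    second keeps the error \<open>A * C\<close> below \<open>e\<close>.\<close>
  define A where "A = min (e * s / 2) (e / C)"
  have A: "0 < A" using e s C by (simp add: A_def)
  have AC: "A * C \<le> e" using C by (simp add: A_def min_def field_simps)
  have A2: "A * (2 / s) \<le> e" using s by (simp add: A_def min_def field_simps)
  obtain f :: "'a \<Rightarrow> ennreal" where fm [measurable]: "f \<in> borel_measurable borel" and fi: "integral\<^sup>N lborel f < \<infinity>"
    and fb: "\<And>r x. 0 < r \<Longrightarrow> heat_flow r f x \<le> ennreal (r powr (- s / 2) * A)"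
    and fE: "\<And>x m. x \<in> E \<Longrightarrow> \<exists>r0>0. \<forall>r. 0 < r \<and> r \<le> r0 \<longrightarrow> of_nat m \<le> heat_flow r f x"
    using null_set_density[OF E s A] by metis
  define W where "W x = (\<integral>\<^sup>+r. riesz_weight s r * heat_flow r f x \<partial>lborel)" for x
  have Wm [measurable]: "W \<in> borel_measurable borel" unfolding W_def by measurable
  have pw: "r powr (s - 1) * r powr (- s / 2) = r powr (s / 2 - 1)" for r
    unfolding powr_add[symmetric] by (rule arg_cong[where f="\<lambda>x. r powr x"]) simp
  have We: "W x \<le> ennreal e" for x
  proof -
    have "W x \<le> (\<integral>\<^sup>+r. ennreal A * (ennreal (r powr (s / 2 - 1)) * indicator {0..1} r) \<partial>lborel)"
      unfolding W_def
    proof (intro nn_integral_mono)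
      fix r :: real
      show "riesz_weight s r * heat_flow r f x
          \<le> ennreal A * (ennreal (r powr (s / 2 - 1)) * indicator {0..1} r)"
      proof (cases "0 < r \<and> r \<le> 1")
        case True
        have "ennreal (r powr (s - 1)) * heat_flow r f x \<le> ennreal (r powr (s - 1)) * ennreal (r powr (- s / 2) * A)"
          using fb[of r x] True by (intro mult_left_mono) auto
        also have "\<dots> = ennreal (A * r powr (s / 2 - 1))"
          unfolding pw[symmetric] using A by (subst ennreal_mult[symmetric]) (auto simp: mult_ac)
        also have "\<dots> = ennreal A * ennreal (r powr (s / 2 - 1))" using A by (intro ennreal_mult) auto
        finally show ?thesis using True by simp
      qed (auto simp: indicator_def)
    qed
    also have "\<dots> = ennreal A * ennreal (2 / s)"
    proof -
      have "(\<integral>\<^sup>+t. ennreal (t powr (s / 2 - 1)) * indicator {0..1} t \<partial>lborel) = ennreal (2 / s)"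
        using nn_integral_powr_Ioc[of "s / 2 - 1" 1] s by simp
      then show ?thesis by (subst nn_integral_cmult) auto
    qed
    also have "\<dots> = ennreal (A * (2 / s))" using A s by (intro ennreal_mult[symmetric]) auto
    also have "\<dots> \<le> ennreal e" by (rule ennreal_leI[OF A2])
    finally show ?thesis .
  qed
  have Wfin: "W x < \<infinity>" for x using We[of x] by (auto intro: le_less_trans)
  define w where "w x = enn2real (W x)" for x
  have Ww: "W x = ennreal (w x)" for x using Wfin[of x] by (simp add: w_def)
  have w0: "0 \<le> w x" for x by (simp add: w_def)
  have we: "w x \<le> e" for x using We[of x] e unfolding Ww by simp
  have wm [measurable]: "w \<in> borel_measurable borel" unfolding w_def by measurable
  have hfin: "heat_flow r f x < \<infinity>" if "0 < r" for r x using fb[OF that, of x] by (auto intro: le_less_trans)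
  have cont: "continuous_on UNIV w"
  proof -
    define g where "g r x = enn2real (heat_flow r f x)" for r x
    have [measurable]: "(\<lambda>r. g r x) \<in> borel_measurable borel" for x unfolding g_def by measurable
    have g0: "0 \<le> g r x" for r x by (simp add: g_def)
    have gb: "g r x \<le> r powr (- s / 2) * A" if "0 < r" for r x
      unfolding g_def using fb[OF that, of x] A by (intro enn2real_leI) auto
    have gc: "isCont (g r) x" if "0 < r" for r x
      using heat_flow_continuous[OF fm fi that] unfolding g_def by (simp add: continuous_on_eq_continuous_at)
    have eq: "w x = (\<integral>r. r powr (s - 1) * indicator {0..1} r * g r x \<partial>lborel)" for x
    proof -
      have "W x = (\<integral>\<^sup>+r. ennreal (r powr (s - 1) * indicator {0..1} r * g r x) \<partial>lborel)"
        unfolding W_def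
      proof (intro nn_integral_cong)
        fix r :: real
        show "riesz_weight s r * heat_flow r f x = ennreal (r powr (s - 1) * indicator {0..1} r * g r x)"
          using hfin[of r x] s by (cases "0 < r") (auto simp: indicator_def ennreal_mult' g_def)
      qed
      then show ?thesis unfolding w_def
        by (subst integral_eq_nn_integral) (auto simp: g0)
    qed
    show ?thesis unfolding eq
    proof (rule continuous_at_imp_continuous_on, intro ballI)
      fix x :: 'a
      show "isCont (\<lambda>x. \<integral>r. r powr (s - 1) * indicator {0..1} r * g r x \<partial>lborel) x"
        unfolding continuous_at_sequentially
      proof (intro allI impI)
        fix X assume X: "X \<longlonglongrightarrow> x"
        show "((\<lambda>x. \<integral>r. r powr (s - 1) * indicator {0..1} r * g r x \<partial>lborel) \<circ> X)
            \<longlonglongrightarrow> (\<integral>r. r powr (s - 1) * indicator {0..1} r * g r x \<partial>lborel)"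
          unfolding comp_def
        proof (rule integral_dominated_convergence[where w="\<lambda>r. A * (r powr (s / 2 - 1) * indicator {0..1} r)"])
          have "(\<integral>\<^sup>+t. ennreal (t powr (s / 2 - 1) * indicator {0..1} t) \<partial>lborel) = ennreal (2 / s)"
            using nn_integral_powr_Ioc[of "s / 2 - 1" 1] s by (simp add: ennreal_mult' ennreal_indicator)
          then show "integrable lborel (\<lambda>r. A * (r powr (s / 2 - 1) * indicator {0..1} r))"
            by (intro integrable_mult_right) (simp add: integrable_iff_bounded)
          show "AE r in lborel. (\<lambda>n. r powr (s - 1) * indicator {0..1} r * g r (X n))
              \<longlonglongrightarrow> r powr (s - 1) * indicator {0..1} r * g r x"
          proof (intro AE_I2)
            fix r :: real
            show "(\<lambda>n. r powr (s - 1) * indicator {0..1} r * g r (X n))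
              \<longlonglongrightarrow> r powr (s - 1) * indicator {0..1} r * g r x"
            proof (cases "0 < r")
              case True
              show ?thesis by (intro tendsto_mult_left isCont_tendsto_compose[OF gc[OF True] X])
            next
              case False
              then have z: "r powr (s - 1) * indicator {0..1} r = 0" by (auto simp: indicator_def)
              show ?thesis unfolding z by simp
            qed
          qed
          show "AE r in lborel. norm (r powr (s - 1) * indicator {0..1} r * g r (X n))
              \<le> A * (r powr (s / 2 - 1) * indicator {0..1} r)" for n
          proof (intro AE_I2)
            fix r :: real
            show "norm (r powr (s - 1) * indicator {0..1} r * g r (X n)) \<le> A * (r powr (s / 2 - 1) * indicator {0..1} r)"
            proof (cases "0 < r \<and> r \<le> 1")
              case True
              have "r powr (s - 1) * g r (X n) \<le> r powr (s - 1) * (r powr (- s / 2) * A)"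
                using True by (intro mult_left_mono gb) auto
              also have "\<dots> = A * r powr (s / 2 - 1)" unfolding pw[symmetric] by simp
              finally show ?thesis using True g0[of r "X n"] by simp
            qed (auto simp: indicator_def)
          qed
        qed measurable
      qed
    qed
  qed
  have est: "ennreal (\<tau> powr (- s) / s) * (\<integral>\<^sup>+r. ennreal (r powr (s - 1)) * indicator {0..<\<tau>} r * heat_flow r f x \<partial>lborel)
      \<le> ennreal (jump_op s \<tau> w x + e)
     \<and> - e \<le> jump_op s \<tau> w x"
    if \<tau>: "0 < \<tau>" "\<tau> \<le> 1" for \<tau> x
  proof -
    let ?Y = "ennreal (\<tau> powr (- s) / s) * (\<integral>\<^sup>+r. ennreal (r powr (s - 1)) * indicator {0..<\<tau>} r * heat_flow r f x \<partial>lborel)"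
    define X where "X = (\<integral>h. w (x + h) * jump_ker s \<tau> h \<partial>lborel)"
    have iX: "integrable lborel (\<lambda>h. w (x + h) * jump_ker s \<tau> h)"
      using w0 we by (intro jump_ker_integrable_mult[where M=e] \<tau> s) auto
    have X0: "0 \<le> X" unfolding X_def by (intro integral_nonneg_AE AE_I2 mult_nonneg_nonneg w0 jump_ker_nonneg)
    have "ennreal X = (\<integral>\<^sup>+h. ennreal (w (x + h) * jump_ker s \<tau> h) \<partial>lborel)"
      unfolding X_def by (rule nn_integral_eq_integral[symmetric, OF iX]) (simp add: w0 jump_ker_nonneg)
    also have "\<dots> = (\<integral>\<^sup>+h. W (x + h) * jump_kernel s \<tau> h \<partial>lborel)"
      unfolding Ww by (intro nn_integral_cong) (simp add: ennreal_mult w0 jump_ker_nonneg ennreal_jump_ker \<tau> s)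
    also have "\<dots> = (\<integral>\<^sup>+t. time_weight s \<tau> t * (\<integral>\<^sup>+h. W (x + h) * heat t h \<partial>lborel) \<partial>lborel)"
      by (rule nn_integral_jump_kernel) measurable
    also have "\<dots> = (\<integral>\<^sup>+t. time_weight s \<tau> t *
           (\<integral>\<^sup>+r. riesz_weight s r * heat_flow (r + t) f x \<partial>lborel) \<partial>lborel)"
    proof (intro nn_integral_cong)
      fix t :: real
      show "time_weight s \<tau> t * (\<integral>\<^sup>+h. W (x + h) * heat t h \<partial>lborel)
        = time_weight s \<tau> t *
           (\<integral>\<^sup>+r. riesz_weight s r * heat_flow (r + t) f x \<partial>lborel)"
      proof (cases "\<tau> \<le> t")
        case True
        then have t: "0 < t" using \<tau> by simp
        have "(\<integral>\<^sup>+h. W (x + h) * heat t h \<partial>lborel)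
          = (\<integral>\<^sup>+h. (\<integral>\<^sup>+r. riesz_weight s r * (heat_flow r f (x + h) * heat t h) \<partial>lborel) \<partial>lborel)"
          unfolding W_def by (intro nn_integral_cong, subst nn_integral_multc[symmetric]) (auto simp: mult.assoc)
        also have "\<dots> = (\<integral>\<^sup>+r. (\<integral>\<^sup>+h. riesz_weight s r * (heat_flow r f (x + h) * heat t h) \<partial>lborel) \<partial>lborel)"
          by (rule tonelli_lborel) measurable
        also have "\<dots> = (\<integral>\<^sup>+r. riesz_weight s r * heat_flow (r + t) f x \<partial>lborel)"
        proof (intro nn_integral_cong)
          fix r :: real
          show "(\<integral>\<^sup>+h. riesz_weight s r * (heat_flow r f (x + h) * heat t h) \<partial>lborel)
            = riesz_weight s r * heat_flow (r + t) f x"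
          proof (cases "0 < r")
            case True
            show ?thesis
              using heat_flow_heat_flow[OF fm t True, of x] unfolding heat_flow_def[of t]
              by (subst nn_integral_cmult) auto
          next
            case False
            then have z: "riesz_weight s r = 0" by (auto simp: indicator_def)
            show ?thesis unfolding z by simp
          qed
        qed
        finally show ?thesis by simp
      qed simp
    qed
    finally have X: "ennreal X = \<dots>" .
    have "ennreal X + ?Y \<le> ennreal (\<tau> powr (- s) / s) * W x + ennreal (A * C)"
      unfolding X W_def C_def
    proof (rule potential_time_estimate[OF s _ _ _ \<tau>])
      show "heat_flow r f x \<le> ennreal A" if "1 \<le> r" for r
      proof -
        have "r powr (- s / 2) \<le> r powr 0" using that s by (intro powr_mono) auto
        then have "r powr (- s / 2) * A \<le> 1 * A" using A that by (intro mult_right_mono) auto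
        then show ?thesis using fb[of r x] that by (auto intro: order_trans ennreal_leI)
      qed
    qed (use A in auto)
    also have "\<dots> = ennreal (\<tau> powr (- s) / s * w x + A * C)"
    proof -
      have 1: "ennreal (\<tau> powr (- s) / s * w x + A * C) = ennreal (\<tau> powr (- s) / s * w x) + ennreal (A * C)"
        using A C s w0[of x] by (intro ennreal_plus mult_nonneg_nonneg) auto
      have 2: "ennreal (\<tau> powr (- s) / s * w x) = ennreal (\<tau> powr (- s) / s) * ennreal (w x)"
        using s w0[of x] by (intro ennreal_mult) auto
      show ?thesis unfolding Ww 1 2 ..
    qed
    also have "\<dots> \<le> ennreal (\<tau> powr (- s) / s * w x + e)" using AC by (intro ennreal_leI) simp
    finally have main: "ennreal X + ?Y \<le> ennreal (\<tau> powr (- s) / s * w x + e)" .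
    have J: "jump_op s \<tau> w x = \<tau> powr (- s) / s * w x - X"
    proof -
      have mass: "(\<integral>(h::'a). jump_ker s \<tau> h \<partial>lborel) = \<tau> powr (- s) / s"
      proof -
        have "0 \<le> \<tau> powr (- s) / s" using s by simp
        then show ?thesis
          using jump_kernel_mass[OF \<tau>(1) s(1), where 'a='a]
          by (subst integral_eq_nn_integral) (auto simp: jump_ker_nonneg ennreal_jump_ker \<tau>(1) s(1))
      qed
      have "jump_op s \<tau> w x = (\<integral>h. w x * jump_ker s \<tau> h - w (x + h) * jump_ker s \<tau> h \<partial>lborel)"
        by (simp add: left_diff_distrib)
      also have "\<dots> = (\<integral>(h::'a). w x * jump_ker s \<tau> h \<partial>lborel) - X"
        unfolding X_def using jump_ker_integrable[OF \<tau>(1) s(1), where 'a='a] iX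
        by (intro Bochner_Integration.integral_diff integrable_mult_right) auto
      also have "(\<integral>(h::'a). w x * jump_ker s \<tau> h \<partial>lborel) = w x * (\<tau> powr (- s) / s)"
        unfolding mass[symmetric] by (rule Bochner_Integration.integral_mult_right_zero)
      finally show ?thesis by simp
    qed
    have "ennreal X \<le> ennreal (\<tau> powr (- s) / s * w x + e)"
      using main by (rule order_trans[rotated]) simp
    then have Xe: "X \<le> \<tau> powr (- s) / s * w x + e"
      using w0[of x] e s by (subst (asm) ennreal_le_iff) auto
    have "?Y = (ennreal X + ?Y) - ennreal X" by simp
    also have "\<dots> \<le> ennreal (\<tau> powr (- s) / s * w x + e) - ennreal X" by (rule ennreal_minus_mono[OF main]) simp
    also have "\<dots> = ennreal (\<tau> powr (- s) / s * w x - X + e)" using X0 by (simp add: ennreal_minus algebra_simps)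
    finally show ?thesis unfolding J using Xe by simp
  qed
  show ?thesis
  proof
    show "continuous_on UNIV w" by fact
    show "0 \<le> w x" "w x \<le> e" for x by (rule w0, rule we)
    show "- e \<le> jump_op s \<tau> w x" if "0 < \<tau>" "\<tau> \<le> 1" for \<tau> x
      using est[OF that] by simp
    fix x K assume x: "x \<in> E"
    \<comment> \<open>If the flow is at least \<open>m\<close> up to time \<open>\<tau>\<close>, the
      gain is at least \<open>\<tau> powr (- s) / s * m * (\<tau> powr s / s) = m / (s * s)\<close>,
      in which \<open>\<tau>\<close> cancels.\<close>
    obtain m :: nat where m: "(K + e) * (s * s) \<le> real m" using real_arch_simple by blast
    obtain r0 where r0: "0 < r0" "\<And>r. 0 < r \<Longrightarrow> r \<le> r0 \<Longrightarrow> of_nat m \<le> heat_flow r f x" using fE[OF x, of m] by blast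
    show "\<exists>\<tau>0>0. \<forall>\<tau>. 0 < \<tau> \<and> \<tau> \<le> \<tau>0 \<longrightarrow> K \<le> jump_op s \<tau> w x"
    proof (intro exI[of _ "min 1 r0"] conjI allI impI)
      show "0 < min 1 r0" using r0 by simp
      fix \<tau> assume "0 < \<tau> \<and> \<tau> \<le> min 1 r0"
      then have \<tau>: "0 < \<tau>" "\<tau> \<le> 1" "\<tau> \<le> r0" by auto
      let ?J = "jump_op s \<tau> w x"
      have "ennreal (real m / (s * s)) = ennreal (\<tau> powr (- s) / s) * (ennreal (real m) * ennreal (\<tau> powr s / s))"
      proof -
        have "\<tau> powr (- s) / s * (real m * (\<tau> powr s / s)) = (\<tau> powr (- s) * \<tau> powr s) * real m / (s * s)" by simp
        also have "\<tau> powr (- s) * \<tau> powr s = 1" using \<tau> by (simp add: powr_add[symmetric])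
        finally show ?thesis using s by (simp add: ennreal_mult'[symmetric])
      qed
      also have "ennreal (\<tau> powr s / s) = (\<integral>\<^sup>+r. ennreal (r powr (s - 1)) * indicator {0..\<tau>} r \<partial>lborel)"
        using nn_integral_powr_Ioc[of "s - 1" \<tau>] s \<tau> by simp
      also have "ennreal (real m) * \<dots> = (\<integral>\<^sup>+r. ennreal (real m) * (ennreal (r powr (s - 1)) * indicator {0..\<tau>} r) \<partial>lborel)"
        by (rule nn_integral_cmult[symmetric]) measurable
      also have "\<dots> \<le> (\<integral>\<^sup>+r. ennreal (r powr (s - 1)) * indicator {0..<\<tau>} r * heat_flow r f x \<partial>lborel)"
      proof (rule nn_integral_mono_AE, rule AE_mp[OF AE_lborel_singleton[of \<tau>]], intro AE_I2 impI)
        fix r :: real assume r: "r \<noteq> \<tau>"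
        show "ennreal (real m) * (ennreal (r powr (s - 1)) * indicator {0..\<tau>} r)
           \<le> ennreal (r powr (s - 1)) * indicator {0..<\<tau>} r * heat_flow r f x"
        proof (cases "0 < r \<and> r < \<tau>")
          case True
          then have "ennreal (real m) \<le> heat_flow r f x"
            using r0(2)[of r] \<tau> by (simp add: ennreal_of_nat_eq_real_of_nat)
          from mult_right_mono[OF this, of "ennreal (r powr (s - 1))"] True
          show ?thesis by (simp add: mult.commute)
        qed (use r in \<open>auto simp: indicator_def\<close>)
      qed
      finally have "ennreal (real m / (s * s)) \<le> ennreal (\<tau> powr (- s) / s) * (\<integral>\<^sup>+r. ennreal (r powr (s - 1)) * indicator {0..<\<tau>} r * heat_flow r f x \<partial>lborel)"
        by (simp add: mult_left_mono)
      also have "\<dots> \<le> ennreal (?J + e)" using est[OF \<tau>(1,2)] by simp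
      finally have "real m / (s * s) \<le> ?J + e"
        using est[OF \<tau>(1,2), of x] by (subst (asm) ennreal_le_iff) auto
      moreover have "K + e \<le> real m / (s * s)" using m s by (simp add: pos_le_divide_eq)
      ultimately show "K \<le> ?J" by simp
    qed
  qed
qed

section \<open>Oscillation decay\<close>

lemma has_frac_laplacian_iff:
  fixes u :: "'a::euclidean_space \<Rightarrow> real"
  assumes [measurable]: "u \<in> borel_measurable borel"
  shows "has_frac_laplacian s u x L \<longleftrightarrow>
    (\<forall>\<epsilon>>0. integrable lborel (\<lambda>h. if \<epsilon> \<le> norm h then (u x - u (x + h)) / norm h powr (real DIM('a) + 2 * s) else 0)) \<and>
    ((\<lambda>\<epsilon>. frac_const DIM('a) s * (\<integral>h. (if \<epsilon> \<le> norm h then (u x - u (x + h)) / norm h powr (real DIM('a) + 2 * s) else 0) \<partial>lborel))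
      \<longlongrightarrow> L) (at_right 0)"
proof -
  let ?F = "\<lambda>\<epsilon> h. if \<epsilon> \<le> norm h then (u x - u (x + h)) / norm h powr (real DIM('a) + 2 * s) else 0"
  let ?G = "\<lambda>\<epsilon> y. if \<epsilon> \<le> norm (x - y) then (u x - u y) / norm (x - y) powr (real DIM('a) + 2 * s) else 0"
  have ind: "(\<lambda>y. indicator (- ball x \<epsilon>) y *\<^sub>R frac_kernel s u x y) = ?G \<epsilon>" for \<epsilon>
    by (auto simp: fun_eq_iff frac_kernel_def indicator_def dist_norm)
  have FG: "?F \<epsilon> = (\<lambda>h. ?G \<epsilon> (x + 1 *\<^sub>R h))" for \<epsilon> by (simp add: fun_eq_iff)
  have GF: "?G \<epsilon> = (\<lambda>y. ?F \<epsilon> (- x + 1 *\<^sub>R y))" for \<epsilon> by (simp add: fun_eq_iff norm_minus_commute)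
  have [measurable]: "?G \<epsilon> \<in> borel_measurable borel" for \<epsilon> by measurable
  have i: "set_integrable lebesgue (- ball x \<epsilon>) (frac_kernel s u x) \<longleftrightarrow> integrable lborel (?F \<epsilon>)" for \<epsilon>
  proof -
    have "set_integrable lebesgue (- ball x \<epsilon>) (frac_kernel s u x) \<longleftrightarrow> integrable lborel (?G \<epsilon>)"
      unfolding set_integrable_def ind by (rule integrable_completion) measurable
    also have "\<dots> \<longleftrightarrow> integrable lborel (?F \<epsilon>)"
    proof
      show "integrable lborel (?F \<epsilon>)" if "integrable lborel (?G \<epsilon>)"
        unfolding FG by (rule integrable_lborel_affine[OF that]) simp
      show "integrable lborel (?G \<epsilon>)" if "integrable lborel (?F \<epsilon>)"
        unfolding GF by (rule integrable_lborel_affine[OF that]) simp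
    qed
    finally show ?thesis .
  qed
  have e: "(LINT y:(- ball x \<epsilon>)|lebesgue. frac_kernel s u x y) = (\<integral>h. ?F \<epsilon> h \<partial>lborel)" for \<epsilon>
  proof -
    have "(LINT y:(- ball x \<epsilon>)|lebesgue. frac_kernel s u x y) = (\<integral>y. ?G \<epsilon> y \<partial>lborel)"
      unfolding set_lebesgue_integral_def ind by (rule integral_completion) measurable
    also have "\<dots> = (\<integral>h. ?F \<epsilon> h \<partial>lborel)"
      unfolding FG by (subst integral_lborel_affine[where c=1 and t=x]) auto
    finally show ?thesis .
  qed
  show ?thesis unfolding has_frac_laplacian_def i e ..
qed

text \<open>Of the factor \<open>R powr (N + 2 * s)\<close> in the kernel, the Jacobian
  \<open>R ^ N\<close> leaves \<open>R powr (2 * s)\<close>. The truncation radius becomes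
  \<open>R * \<epsilon>\<close>, which tends to 0 together with \<open>\<epsilon>\<close>.\<close>

lemma has_frac_laplacian_affine:
  fixes u :: "'a::euclidean_space \<Rightarrow> real"
  assumes m [measurable]: "u \<in> borel_measurable borel" and R: "0 < R"
    and L: "has_frac_laplacian s u (z + R *\<^sub>R x) L"
  shows "has_frac_laplacian s (\<lambda>y. A * (u (z + R *\<^sub>R y) - b)) x (A * R powr (2 * s) * L)"
proof -
  let ?q = "real DIM('a) + 2 * s"
  define F where "F \<epsilon> h = (if \<epsilon> \<le> norm h then (u (z + R *\<^sub>R x) - u (z + R *\<^sub>R x + h)) / norm h powr ?q else 0)" for \<epsilon> h
  have [measurable]: "F \<epsilon> \<in> borel_measurable borel" for \<epsilon> unfolding F_def by measurable
  have F: "\<And>\<epsilon>. 0 < \<epsilon> \<Longrightarrow> integrable lborel (F \<epsilon>)"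
    "((\<lambda>\<epsilon>. frac_const DIM('a) s * (\<integral>h. F \<epsilon> h \<partial>lborel)) \<longlongrightarrow> L) (at_right 0)"
    using L unfolding has_frac_laplacian_iff[OF m] F_def by auto
  let ?u = "\<lambda>y. A * (u (z + R *\<^sub>R y) - b)"
  have um: "?u \<in> borel_measurable borel" by measurable
  have eq: "(if \<epsilon> \<le> norm h then (?u x - ?u (x + h)) / norm h powr ?q else 0) = A * R powr ?q * F (R * \<epsilon>) (0 + R *\<^sub>R h)" for \<epsilon> h
  proof -
    have 1: "R * \<epsilon> \<le> norm (0 + R *\<^sub>R h) \<longleftrightarrow> \<epsilon> \<le> norm h" using R by simp
    have 2: "norm (0 + R *\<^sub>R h) powr ?q = R powr ?q * norm h powr ?q" using R by (simp add: powr_mult)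
    show ?thesis unfolding F_def 1 2 using R
      by (simp add: algebra_simps diff_divide_distrib)
  qed
  have i: "(\<integral>h. A * R powr ?q * F (R * \<epsilon>) (0 + R *\<^sub>R h) \<partial>lborel) = A * R powr (2 * s) * (\<integral>h. F (R * \<epsilon>) h \<partial>lborel)" for \<epsilon>
  proof -
    have "(\<integral>h. F (R * \<epsilon>) h \<partial>lborel) = R ^ DIM('a) * (\<integral>h. F (R * \<epsilon>) (0 + R *\<^sub>R h) \<partial>lborel)"
      using R by (subst integral_lborel_affine[where c=R and t=0]) auto
    moreover have "R powr ?q = R powr (2 * s) * R ^ DIM('a)"
      using R by (simp add: powr_add powr_realpow)
    ultimately show ?thesis by simp
  qed
  have lim: "((\<lambda>\<epsilon>. A * R powr (2 * s) * (frac_const DIM('a) s * (\<integral>h. F (R * \<epsilon>) h \<partial>lborel))) \<longlongrightarrow> A * R powr (2 * s) * L) (at_right 0)"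
  proof (rule tendsto_mult_left, rule filterlim_compose[OF F(2)])
    have "((\<lambda>\<epsilon>. R * \<epsilon>) \<longlongrightarrow> R * 0) (at_right 0)" by (intro tendsto_intros)
    then show "filterlim (\<lambda>\<epsilon>. R * \<epsilon>) (at_right 0) (at_right 0)"
      using R by (auto simp: filterlim_at eventually_at_right_field intro!: exI[of _ 1])
  qed
  show ?thesis unfolding has_frac_laplacian_iff[OF um] eq i
  proof (intro conjI allI impI)
    fix \<epsilon> :: real assume "0 < \<epsilon>"
    then show "integrable lborel (\<lambda>h. A * R powr ?q * F (R * \<epsilon>) (0 + R *\<^sub>R h))"
      using R by (intro integrable_mult_right integrable_lborel_affine F(1)) auto
  qed (use lim in \<open>simp add: mult_ac\<close>)
qed

lemma frac_const_pos:
  assumes "0 < s" "s < 1"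
  shows "0 < frac_const N s"
proof -
  have "- s \<notin> \<int>\<^sub>\<le>\<^sub>0"
  proof
    assume "- s \<in> \<int>\<^sub>\<le>\<^sub>0"
    then obtain n where "- s = - of_nat n" by (auto elim!: nonpos_Ints_cases')
    then have "s = real n" by simp
    then show False using assms by (cases n) auto
  qed
  then have "Gamma (- s) \<noteq> 0" by (simp add: Gamma_eq_zero_iff)
  moreover have "0 < Gamma (real N / 2 + s)" using assms by (intro Gamma_real_pos) auto
  ultimately show ?thesis unfolding frac_const_def by simp
qed

lemma has_frac_laplacian_jump:
  fixes v :: "'a::euclidean_space \<Rightarrow> real"
  assumes s: "0 < s" "s < 1" and [measurable]: "v \<in> borel_measurable borel" and M: "\<And>x. \<bar>v x\<bar> \<le> M"
    and L: "has_frac_laplacian s v x L"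
  shows "(\<lambda>n. jump_op s (1 / real (Suc n)) v x) \<longlonglongrightarrow>
     (LINT y:{0..}|lborel. radius_weight (real DIM('a) + 2 * s - 1) y) / gauss_mass TYPE('a) * (L / frac_const DIM('a) s)"
proof (rule tendsto_jump_ker[OF s(1)])
  show "\<bar>v x - v (x + h)\<bar> \<le> 2 * M" for h using M[of x] M[of "x + h"] by linarith
  show "integrable lborel (\<lambda>h. if \<delta> \<le> norm h then (v x - v (x + h)) / norm h powr (real DIM('a) + 2 * s) else 0)"
    if "0 < \<delta>" for \<delta>
    using L that unfolding has_frac_laplacian_iff[OF assms(3)] by blast
  have "((\<lambda>\<epsilon>. frac_const DIM('a) s * (\<integral>h. (if \<epsilon> \<le> norm h then (v x - v (x + h)) / norm h powr (real DIM('a) + 2 * s) else 0) \<partial>lborel) / frac_const DIM('a) s)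
      \<longlongrightarrow> L / frac_const DIM('a) s) (at_right 0)"
    using L frac_const_pos[OF s, of "DIM('a)"] unfolding has_frac_laplacian_iff[OF assms(3)]
    by (intro tendsto_divide tendsto_const) auto
  then show "((\<lambda>\<delta>. \<integral>h. (if \<delta> \<le> norm h then (v x - v (x + h)) / norm h powr (real DIM('a) + 2 * s) else 0) \<partial>lborel)
      \<longlongrightarrow> L / frac_const DIM('a) s) (at_right 0)"
    using frac_const_pos[OF s, of "DIM('a)"] by simp
  show "(\<lambda>n. 1 / real (Suc n)) \<longlonglongrightarrow> 0" using LIMSEQ_inverse_real_of_nat by (simp add: inverse_eq_divide)
qed auto

text \<open>Convexity of \<open>exp\<close>: with \<open>p = a / s\<close>, the number
  \<open>z powr a\<close> is a weighted geometric mean of 1 and \<open>z powr s\<close>, hence at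
  most the arithmetic mean. The factor \<open>a / s\<close> makes growth at infinity cheap when the
  exponent \<open>a\<close> is small.\<close>

lemma powr_diff_le:
  fixes z a s :: real
  assumes "1 \<le> z" "0 < a" "a \<le> s"
  shows "z powr a - 1 \<le> a / s * z powr s"
proof -
  define p where "p = a / s"
  have p: "0 \<le> p" "p \<le> 1" using assms by (auto simp: p_def)
  have "exp ((1 - p) *\<^sub>R 0 + p *\<^sub>R (s * ln z)) \<le> (1 - p) * exp 0 + p * exp (s * ln z)"
    using p by (intro convex_onD[OF exp_convex]) auto
  moreover have "p * (s * ln z) = a * ln z" using assms by (simp add: p_def)
  ultimately have "z powr a \<le> 1 - p + p * z powr s" using assms by (simp add: powr_def)
  then show ?thesis using p unfolding p_def[symmetric] by simp
qed

lemma jump_ker_odd: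
  fixes x :: "'a::euclidean_space"
  shows "(\<integral>h. (x \<bullet> h) * indicator (ball 0 r) h * jump_ker s \<tau> h \<partial>lborel) = 0"
proof -
  have [measurable]: "ball (0::'a) r \<in> sets borel" by simp
  let ?f = "\<lambda>h. (x \<bullet> h) * indicator (ball 0 r) h * jump_ker s \<tau> h"
  have "(\<integral>h. ?f h \<partial>lborel) = (\<integral>h. ?f (0 + (- 1) *\<^sub>R h) \<partial>lborel)"
    by (subst integral_lborel_affine[where c="-1" and t=0]) auto
  also have "\<dots> = (\<integral>h. - ?f h \<partial>lborel)"
    by (intro Bochner_Integration.integral_cong refl) (auto simp: indicator_def)
  also have "\<dots> = - (\<integral>h. ?f h \<partial>lborel)" by (rule Bochner_Integration.integral_minus)
  finally show ?thesis by simp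
qed

text \<open>At a maximum point of \<open>v - w + \<beta> * max 0 (1 - 4 * (norm x)\<^sup>2)\<close> the difference \<open>v - w\<close> lies
  below a paraboloid near the point, and below the value at the point by a fixed amount on
  \<open>{v \<le> 0}\<close>; the term \<open>8 * \<beta> * (x \<bullet> h)\<close> is odd in \<open>h\<close> and integrates to \<open>0\<close>.\<close>

lemma contact_point_estimate:
  fixes v v' :: "'a::euclidean_space \<Rightarrow> real"
  assumes s: "0 < s" "s < 1" and a: "0 < a" "a \<le> s" and \<beta>: "0 < \<beta>" "\<beta> \<le> 1/6"
    and v1: "\<And>y. norm y < 1 \<Longrightarrow> v y \<le> 1"
    and vt: "\<And>y. 1 \<le> norm y \<Longrightarrow> v y \<le> 2 * (16 * norm y) powr a - 1"
    and v': "\<And>y. v' y \<le> v y"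
    and x: "norm x < 1/2" and M1: "1 < v' x + \<beta> * max 0 (1 - 4 * (norm x)\<^sup>2)"
    and M: "\<And>y. norm y \<le> 1/2 \<Longrightarrow> v' y + \<beta> * max 0 (1 - 4 * (norm y)\<^sup>2) \<le> v' x + \<beta> * max 0 (1 - 4 * (norm x)\<^sup>2)"
  shows "(1/2) * indicator {y \<in> ball 0 1. v y \<le> 0} (x + h) - (4 * \<beta> + 256 * a / s) * min ((norm h)\<^sup>2) (norm h powr s)
    \<le> v' x - v' (x + h) + 8 * \<beta> * ((x \<bullet> h) * indicator (ball 0 (1/2)) h)"
proof -
  define b where "b y = max 0 (1 - 4 * (norm y)\<^sup>2)" for y :: 'a
  define y where "y = x + h"
  define \<Phi> where "\<Phi> = min ((norm h)\<^sup>2) (norm h powr s)"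
  define l where "l = 8 * \<beta> * ((x \<bullet> h) * indicator (ball 0 (1/2)) h)"
  define p where "p = v' x - v' y"
  have x2: "(norm x)\<^sup>2 < 1/4" using power_strict_mono[OF x, of 2] by (simp add: power_divide)
  have bx: "b x = 1 - 4 * (norm x)\<^sup>2" "b x \<le> 1" using x2 by (auto simp: b_def)
  have \<Phi>0: "0 \<le> \<Phi>" by (simp add: \<Phi>_def)
  \<comment> \<open>From distance 1/2 on, \<open>\<Phi>\<close> dominates constants as well as the
    growth at infinity; below that distance it is just the square.\<close>
  have big: "1/4 \<le> \<Phi>" "norm h powr s \<le> 4 * \<Phi>" if "1/2 \<le> norm h"
  proof -
    have 1: "1/4 \<le> (norm h)\<^sup>2" using power_mono[OF that, of 2] by (simp add: power_divide)
    have "(1/2) powr 1 \<le> (1/2 :: real) powr s" using s by (intro powr_mono') auto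
    also have "\<dots> \<le> norm h powr s" using that s by (intro powr_mono2) auto
    finally have 2: "1/2 \<le> norm h powr s" by simp
    show "1/4 \<le> \<Phi>" using 1 2 by (simp add: \<Phi>_def)
    show "norm h powr s \<le> 4 * \<Phi>"
    proof (cases "norm h \<le> 1")
      case True
      then have "norm h powr s \<le> 1" using s by (intro powr_le1) auto
      then show ?thesis using 1 2 by (simp add: \<Phi>_def)
    next
      case False
      then have "norm h powr s \<le> norm h powr 2" using s by (intro powr_mono) auto
      then have "norm h powr s \<le> (norm h)\<^sup>2" using False by simp
      then show ?thesis by (simp add: \<Phi>_def)
    qed
  qed
  have small: "\<Phi> = (norm h)\<^sup>2" if "norm h < 1/2"
  proof (cases "h = 0")
    case False
    then have "norm h powr 2 \<le> norm h powr s" using that s by (intro powr_mono') auto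
    then show ?thesis using False by (simp add: \<Phi>_def)
  qed (simp add: \<Phi>_def)
  have ny: "norm y \<le> 1/2 + norm h" using x norm_triangle_ineq[of x h] unfolding y_def by linarith
  \<comment> \<open>Maximality is assumed only on the half ball. On the rest of the unit ball the
    bump vanishes and \<open>v \<le> 1\<close> lies below the maximal value.\<close>
  have inB: "v' y + \<beta> * b y \<le> v' x + \<beta> * b x" if "norm y < 1"
  proof (cases "norm y \<le> 1/2")
    case True
    then show ?thesis using M unfolding b_def by blast
  next
    case False
    then have "1/4 \<le> (norm y)\<^sup>2" using power_mono[of "1/2" "norm y" 2] by (simp add: power_divide)
    then have "b y = 0" by (simp add: b_def)
    then show ?thesis using v1[OF that] v'[of y] M1 unfolding b_def by simp
  qed
  have vx: "1 - \<beta> < v' x"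
  proof -
    have "\<beta> * b x \<le> \<beta>" using mult_left_mono[OF bx(2), of \<beta>] \<beta> by simp
    then show ?thesis using M1 unfolding b_def[symmetric] by linarith
  qed
  have l0: "l = 0" if "1/2 \<le> norm h" using that by (simp add: l_def indicator_def)
  have as: "0 \<le> 256 * a / s * \<Phi>" using a s \<Phi>0 by simp
  have low: "- (4 * \<beta> + 256 * a / s) * \<Phi> \<le> p + l"
  proof (cases "norm y < 1")
    case True
    have p: "\<beta> * (b y - b x) \<le> p" using inB[OF True] by (simp add: p_def algebra_simps)
    have "- (4 * \<beta> * \<Phi>) \<le> p + l"
    proof (cases "norm h < 1/2")
      case h: True
      have "1 - 4 * (norm y)\<^sup>2 \<le> b y" by (simp add: b_def)
      moreover have "(norm y)\<^sup>2 = (norm x)\<^sup>2 + 2 * (x \<bullet> h) + (norm h)\<^sup>2"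
        unfolding y_def by (simp add: power2_norm_eq_inner inner_add_left inner_add_right inner_commute)
      ultimately have "- 8 * (x \<bullet> h) - 4 * (norm h)\<^sup>2 \<le> b y - b x" unfolding bx(1) by simp
      from order_trans[OF mult_left_mono[OF this less_imp_le[OF \<beta>(1)]] p]
      have "\<beta> * (- 8 * (x \<bullet> h) - 4 * (norm h)\<^sup>2) \<le> p" .
      then show ?thesis using h unfolding small[OF h] l_def by (simp add: algebra_simps)
    next
      case False
      then have h: "1/2 \<le> norm h" by simp
      have "0 \<le> b y" by (simp add: b_def)
      then have "- 1 \<le> b y - b x" using bx(2) by simp
      from order_trans[OF mult_left_mono[OF this less_imp_le[OF \<beta>(1)]] p] have "- \<beta> \<le> p" by simp
      moreover have "\<beta> * 1 \<le> \<beta> * (4 * \<Phi>)" using big(1)[OF h] \<beta> by (intro mult_left_mono) auto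
      ultimately show ?thesis using l0[OF h] by simp
    qed
    then show ?thesis using as by (simp add: algebra_simps)
  next
    case False
    then have y1: "1 \<le> norm y" by simp
    then have h: "1/2 \<le> norm h" using ny by simp
    have "(16 * norm y) powr a - 1 \<le> a / s * (16 * norm y) powr s"
      using y1 a by (intro powr_diff_le) auto
    \<comment> \<open>From \<open>1/2 \<le> norm h\<close> follows
      \<open>16 * norm y \<le> 32 * norm h\<close>; together with
      \<open>norm h powr s \<le> 4 * \<Phi>\<close> this gives 128, and the factor 2 in the growth
      bound makes it 256.\<close>
    also have "\<dots> \<le> a / s * (128 * \<Phi>)"
    proof (rule mult_left_mono)
      have "(16 * norm y) powr s \<le> (32 * norm h) powr s" using ny h s by (intro powr_mono2) auto
      also have "\<dots> = 32 powr s * norm h powr s" by (simp add: powr_mult)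
      also have "\<dots> \<le> 32 powr 1 * (4 * \<Phi>)" using s big(2)[OF h] by (intro mult_mono powr_mono) auto
      finally show "(16 * norm y) powr s \<le> 128 * \<Phi>" by simp
    qed (use a s in auto)
    finally have "2 * ((16 * norm y) powr a - 1) \<le> 256 * a / s * \<Phi>" by simp
    moreover have "- \<beta> - 2 * ((16 * norm y) powr a - 1) \<le> p"
      using vx vt[OF y1] v'[of y] unfolding p_def by simp
    moreover have "\<beta> * 1 \<le> \<beta> * (4 * \<Phi>)" using big(1)[OF h] \<beta> by (intro mult_left_mono) auto
    ultimately show ?thesis using l0[OF h] by (simp add: algebra_simps)
  qed
  \<comment> \<open>Here \<open>p \<ge> 1 - \<beta>\<close> and
    \<open>l \<ge> - 2 * \<beta>\<close>, so \<open>\<beta> \<le> 1/6\<close> is what leaves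
    1/2.\<close>
  have up: "1/2 \<le> p + l" if "norm y < 1" "v y \<le> 0"
  proof -
    have "1 - \<beta> \<le> p" using vx v'[of y] that by (simp add: p_def)
    moreover have "- (2 * \<beta>) \<le> l"
    proof (cases "norm h < 1/2")
      case True
      have "\<bar>x \<bullet> h\<bar> \<le> norm x * norm h" by (rule Cauchy_Schwarz_ineq2)
      also have "\<dots> \<le> 1/2 * (1/2)" using x True by (intro mult_mono) auto
      finally have "- (1/4) \<le> x \<bullet> h" by simp
      from mult_left_mono[OF this, of "8 * \<beta>"] \<beta>(1) True show ?thesis by (simp add: l_def mult.assoc)
    next
      case False
      then show ?thesis using l0 \<beta> by simp
    qed
    ultimately show ?thesis using \<beta> by simp
  qed
  have "(1/2) * indicator {y \<in> ball 0 1. v y \<le> 0} y - (4 * \<beta> + 256 * a / s) * \<Phi> \<le> p + l"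
  proof (cases "norm y < 1 \<and> v y \<le> 0")
    case True
    have "0 \<le> (4 * \<beta> + 256 * a / s) * \<Phi>" using as \<beta> \<Phi>0 by (simp add: distrib_right)
    then show ?thesis using up True by simp
  next
    case False
    then have i: "indicator {y \<in> ball 0 1. v y \<le> 0} y = (0::real)" by (auto simp: indicator_def)
    show ?thesis using low unfolding i minus_mult_left[symmetric] by linarith
  qed
  then show ?thesis unfolding y_def \<Phi>_def p_def l_def by simp
qed

text \<open>\<open>a\<close> measures the growth at infinity, \<open>\<mu>\<close> the size of the
  set, \<open>\<eta>\<close> the right-hand side, and \<open>\<gamma>\<close> is the gain. The
  equation is asked for only where \<open>v\<close> is positive, so that the ball may reach outside
  the domain; on \<open>E\<close> the value \<open>L\<close> merely has to exist. The bound outside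
  the unit ball is the one supplied by the induction over scales. The \<open>itself\<close> argument
  fixes the space, which the other parameters do not determine.\<close>

definition one_sided_decay :: "'a::euclidean_space itself \<Rightarrow> real \<Rightarrow> real \<Rightarrow> real \<Rightarrow> real \<Rightarrow> real \<Rightarrow> bool"
  where "one_sided_decay _ s a \<mu> \<eta> \<gamma> \<longleftrightarrow> (\<forall>(v :: 'a \<Rightarrow> real) E M x.
    continuous_on UNIV v \<longrightarrow> (\<forall>y. \<bar>v y\<bar> \<le> M) \<longrightarrow> E \<in> null_sets lebesgue \<longrightarrow>
    (\<forall>y. norm y < 1 \<longrightarrow> v y \<le> 1) \<longrightarrow> (\<forall>y. 1 \<le> norm y \<longrightarrow> v y \<le> 2 * (16 * norm y) powr a - 1) \<longrightarrow>
    ennreal \<mu> \<le> emeasure lborel {y \<in> ball 0 1. v y \<le> 0} \<longrightarrow>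
    (\<forall>y. norm y < 1/2 \<longrightarrow> 0 < v y \<longrightarrow> (\<exists>L. has_frac_laplacian s v y L \<and> (y \<in> E \<or> L \<le> \<eta>))) \<longrightarrow>
    norm x < 1/4 \<longrightarrow> v x \<le> 1 - \<gamma>)"

text \<open>\<open>\<kappa>\<close> and \<open>C\<close> are uniform in the truncation, so the
  contact estimate, integrated against the jump kernel, gives a bound that survives the limit of the
  truncated operators. A small exponent \<open>a\<close> keeps the contribution of far points below
  that of the set \<open>{v \<le> 0}\<close>.\<close>

lemma oscillation_decay:
  fixes \<mu> s :: real
  assumes s: "0 < s" "s < 1" and \<mu>: "0 < \<mu>"
  obtains a0 \<gamma> \<eta> :: real where "0 < a0" "0 < \<gamma>" "\<gamma> < 1" "0 < \<eta>"
    "\<And>a. 0 < a \<Longrightarrow> a \<le> a0 \<Longrightarrow> one_sided_decay TYPE('a::euclidean_space) s a \<mu> \<eta> \<gamma>"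
proof -
  obtain \<kappa> where \<kappa>: "0 < \<kappa>" "\<And>\<tau> (h::'a). 0 < \<tau> \<Longrightarrow> \<tau> \<le> 1 \<Longrightarrow> norm h \<le> 2 \<Longrightarrow> ennreal \<kappa> \<le> jump_kernel s \<tau> h"
    using jump_kernel_lower[where 'a='a] by metis
  obtain C where C: "0 < C" "\<And>\<tau>. 0 < \<tau> \<Longrightarrow>
      (\<integral>\<^sup>+(h::'a). ennreal (min ((norm h)\<^sup>2) (norm h powr s)) * jump_kernel s \<tau> h \<partial>lborel) \<le> ennreal C"
    using jump_kernel_moment[OF s, where 'a='a] by metis
  define c where "c = frac_const DIM('a) s"
  have c: "0 < c" unfolding c_def by (rule frac_const_pos[OF s])
  define G where "G = (LINT y:{0..}|lborel. radius_weight (real DIM('a) + 2 * s - 1) y) / gauss_mass TYPE('a)"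
  have G: "0 < G"
  proof -
    have "0 < real DIM('a) + 2 * s - 1" using s DIM_positive[where 'a='a] by linarith
    then show ?thesis unfolding G_def by (intro divide_pos_pos radius_weight_integral_pos gauss_mass_pos)
  qed
  \<comment> \<open>A lower bound for the kernel mass of \<open>{v \<le> 0}\<close> seen from the
    contact point; it is no cone angle here. The budget: \<open>\<theta> / 2\<close> from that set,
    less \<open>\<theta> / 8\<close> each for the bump and for the growth at infinity, leaves
    \<open>\<theta> / 4\<close>, of which the potential and the right-hand side may use
    \<open>\<theta> / 16\<close> each.\<close>
  define \<theta> where "\<theta> = \<kappa> * \<mu>"
  have \<theta>: "0 < \<theta>" using \<kappa> \<mu> by (simp add: \<theta>_def)
  define \<beta> where "\<beta> = min (1/6) (\<theta> / (32 * C))"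
  have \<beta>: "0 < \<beta>" "\<beta> \<le> 1/6" "4 * \<beta> * C \<le> \<theta> / 8" using \<theta> C by (auto simp: \<beta>_def min_def field_simps)
  define a0 where "a0 = min s (s * \<theta> / (2048 * C))"
  have a0: "0 < a0" "a0 \<le> s" "256 * a0 / s * C \<le> \<theta> / 8" using \<theta> C s by (auto simp: a0_def min_def field_simps)
  define e where "e = min (\<beta> / 2) (\<theta> / 16)"
  have e: "0 < e" "e \<le> \<beta> / 2" "e \<le> \<theta> / 16" using \<beta> \<theta> by (auto simp: e_def)
  define \<eta> where "\<eta> = \<theta> * c / (16 * G)"
  have \<eta>: "0 < \<eta>" "G * (\<eta> / c) = \<theta> / 16" using \<theta> c G by (auto simp: \<eta>_def)
  show ?thesis
  proof (rule that[of a0 "\<beta> / 4" \<eta>])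
    show "0 < a0" "0 < \<beta> / 4" "\<beta> / 4 < 1" "0 < \<eta>" using a0 \<beta> \<eta> by auto
    fix a assume a: "0 < a" "a \<le> a0"
    show "one_sided_decay TYPE('a) s a \<mu> \<eta> (\<beta> / 4)"
      unfolding one_sided_decay_def
    proof (intro allI impI, goal_cases)
      case (1 v E M x0)
      note vc = 1(1) and vM = 1(2)[rule_format] and E = 1(3) and v1 = 1(4)[rule_format] and vt = 1(5)[rule_format]
        and dens = 1(6) and eq = 1(7)[rule_format] and x0 = 1(8)
      have vm [measurable]: "v \<in> borel_measurable borel" using vc by (rule borel_measurable_continuous_onI)
      obtain w where wc: "continuous_on UNIV w" and w0: "\<And>x. 0 \<le> w x" and we: "\<And>x. w x \<le> e"
        and wl: "\<And>\<tau> x. 0 < \<tau> \<Longrightarrow> \<tau> \<le> 1 \<Longrightarrow> - e \<le> jump_op s \<tau> w x"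
        and wE: "\<And>x K. x \<in> E \<Longrightarrow> \<exists>\<tau>0>0. \<forall>\<tau>. 0 < \<tau> \<and> \<tau> \<le> \<tau>0 \<longrightarrow> K \<le> jump_op s \<tau> w x"
        by (rule null_set_potential[OF E s e(1)]) (rule that, assumption+)
      have wm [measurable]: "w \<in> borel_measurable borel" using wc by (rule borel_measurable_continuous_onI)
      show "v x0 \<le> 1 - \<beta> / 4"
      proof (rule ccontr)
        assume "\<not> v x0 \<le> 1 - \<beta> / 4"
        then have vx0: "1 - \<beta> / 4 < v x0" by simp
        define b where "b y = max 0 (1 - 4 * (norm y)\<^sup>2)" for y :: 'a
        define m where "m y = v y - w y + \<beta> * b y" for y
        have "continuous_on (cball 0 (1/2)) m"
          unfolding m_def b_def using vc wc
          by (intro continuous_intros) (auto intro: continuous_on_subset)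
        then obtain x where x: "x \<in> cball 0 (1/2)" "\<And>y. y \<in> cball 0 (1/2) \<Longrightarrow> m y \<le> m x"
          using continuous_attains_sup[of "cball (0::'a) (1/2)" m] by force
        \<comment> \<open>The gain \<open>\<beta> / 4\<close> comes from here: at \<open>x0\<close>
          the bump adds at least \<open>3 * \<beta> / 4\<close> and the potential costs at most
          \<open>\<beta> / 2\<close>, so \<open>v x0 > 1 - \<beta> / 4\<close> lifts the maximum
          above 1.\<close>
        have mx: "1 < m x"
        proof -
          have "(norm x0)\<^sup>2 \<le> 1/16" using power_mono[of "norm x0" "1/4" 2] x0 by (simp add: power_divide)
          then have "3/4 \<le> b x0" by (simp add: b_def)
          from mult_left_mono[OF this less_imp_le[OF \<beta>(1)]] have "\<beta> * (3/4) \<le> \<beta> * b x0" .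
          then have "1 < m x0" unfolding m_def using vx0 we[of x0] e(2) \<beta>(1) by linarith
          also have "m x0 \<le> m x" using x0 by (intro x) auto
          finally show ?thesis .
        qed
        \<comment> \<open>On the sphere of radius 1/2 the bump vanishes, and
          \<open>v \<le> 1\<close> together with \<open>w \<ge> 0\<close> contradicts a maximum
          above 1.\<close>
        have xn: "norm x < 1/2"
        proof (rule ccontr)
          assume "\<not> norm x < 1/2"
          then have nx: "norm x = 1/2" using x by simp
          have "b x = 0" unfolding b_def nx by (simp add: power_divide)
          then show False using mx v1[of x] nx w0[of x] by (simp add: m_def)
        qed
        have "b x \<le> 1" by (simp add: b_def)
        from mult_left_mono[OF this less_imp_le[OF \<beta>(1)]] \<beta> mx w0[of x] have vx: "0 < v x" unfolding m_def by linarith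
        obtain L where L: "has_frac_laplacian s v x L" "x \<in> E \<or> L \<le> \<eta>" using eq[OF xn vx] by blast
        let ?S = "{y \<in> ball 0 1. v y \<le> 0}"
        let ?q = "4 * \<beta> + 256 * a / s"
        have Sm [measurable]: "?S \<in> sets borel" by measurable
        have [measurable]: "ball (0::'a) (1/2) \<in> sets borel" by simp
        have ptw: "(1/2) * indicator ?S (x + h) - ?q * min ((norm h)\<^sup>2) (norm h powr s)
            \<le> (v x - w x) - (v (x + h) - w (x + h)) + 8 * \<beta> * ((x \<bullet> h) * indicator (ball 0 (1/2)) h)" for h
        proof (rule contact_point_estimate[OF s a(1) _ \<beta>(1,2) v1 vt])
          show "a \<le> s" using a a0 by simp
          show "1 < v x - w x + \<beta> * max 0 (1 - 4 * (norm x)\<^sup>2)" using mx unfolding m_def b_def .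
          show "v y - w y + \<beta> * max 0 (1 - 4 * (norm y)\<^sup>2) \<le> v x - w x + \<beta> * max 0 (1 - 4 * (norm x)\<^sup>2)"
            if "norm y \<le> 1/2" for y using x(2)[of y] that unfolding m_def b_def by simp
        qed (use w0 xn in auto)
        have low: "\<theta> / 4 + jump_op s \<tau> w x
            \<le> jump_op s \<tau> v x" if \<tau>: "0 < \<tau>" "\<tau> \<le> 1" for \<tau>
        proof -
          note jm = jump_ker_integrable_mult[OF _ \<tau>(1) s(1)]
          have iv: "integrable lborel (\<lambda>h. (v x - v (x + h)) * jump_ker s \<tau> h)"
          proof (rule jm)
            show "\<bar>v x - v (x + h)\<bar> \<le> 2 * M" for h using vM[of x] vM[of "x + h"] by linarith
          qed measurable
          have iw: "integrable lborel (\<lambda>h. (w x - w (x + h)) * jump_ker s \<tau> h)"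
          proof (rule jm)
            show "\<bar>w x - w (x + h)\<bar> \<le> e" for h using w0[of x] w0[of "x + h"] we[of x] we[of "x + h"] by linarith
          qed measurable
          have il: "integrable lborel (\<lambda>h. (x \<bullet> h) * indicator (ball 0 (1/2)) h * jump_ker s \<tau> h)"
          proof (rule jm)
            show "\<bar>(x \<bullet> h) * indicator (ball 0 (1/2)) h\<bar> \<le> norm x * (1/2)" for h
              using Cauchy_Schwarz_ineq2[of x h] mult_left_mono[of "norm h" "1/2" "norm x"]
              by (auto simp: indicator_def)
          qed measurable
          have iS: "integrable lborel (\<lambda>h. indicator ?S (x + h) * jump_ker s \<tau> h)"
            by (rule jm[of _ 1]) (auto simp: indicator_def)
          have Sl: "\<theta> \<le> (\<integral>h. indicator ?S (x + h) * jump_ker s \<tau> h \<partial>lborel)"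
          proof -
            have "ennreal \<theta> = ennreal \<kappa> * ennreal \<mu>" using \<kappa> \<mu> by (simp add: \<theta>_def ennreal_mult)
            also have "\<dots> \<le> ennreal \<kappa> * emeasure lborel ?S" using dens by (rule mult_left_mono) simp
            also have "\<dots> = (\<integral>\<^sup>+y. ennreal \<kappa> * indicator ?S y \<partial>lborel)"
              using Sm by (intro nn_integral_cmult_indicator[symmetric]) simp
            also have "\<dots> = (\<integral>\<^sup>+h. ennreal \<kappa> * indicator ?S (x + 1 *\<^sub>R h) \<partial>lborel)"
              by (subst nn_integral_lborel_affine[where c=1 and t=x]) auto
            also have "\<dots> \<le> (\<integral>\<^sup>+h. ennreal (indicator ?S (x + h) * jump_ker s \<tau> h) \<partial>lborel)"
            proof (intro nn_integral_mono)
              fix h :: 'a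
              show "ennreal \<kappa> * indicator ?S (x + 1 *\<^sub>R h) \<le> ennreal (indicator ?S (x + h) * jump_ker s \<tau> h)"
              proof (cases "x + h \<in> ?S")
                case True
                then have "norm (x + h) < 1" by simp
                then have "norm h \<le> 2" using xn norm_triangle_ineq4[of "x + h" x] by simp
                then have "ennreal \<kappa> \<le> ennreal (jump_ker s \<tau> h)"
                  using \<kappa>(2)[OF \<tau>] by (simp add: ennreal_jump_ker \<tau> s)
                then show ?thesis using True by simp
              qed (auto simp: indicator_def)
            qed
            also have "\<dots> = ennreal (\<integral>h. indicator ?S (x + h) * jump_ker s \<tau> h \<partial>lborel)"
              by (rule nn_integral_eq_integral[OF iS]) (simp add: jump_ker_nonneg)
            finally show ?thesis
              by (subst (asm) ennreal_le_iff) (auto intro!: integral_nonneg_AE simp: jump_ker_nonneg)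
          qed
          let ?\<Phi> = "\<lambda>h::'a. min ((norm h)\<^sup>2) (norm h powr s)"
          have P: "(\<integral>\<^sup>+(h::'a). ennreal (?\<Phi> h * jump_ker s \<tau> h) \<partial>lborel) \<le> ennreal C"
            using C(2)[OF \<tau>(1)] by (simp add: ennreal_mult jump_ker_nonneg ennreal_jump_ker \<tau> s)
          have i\<Phi>: "integrable lborel (\<lambda>h. ?\<Phi> h * jump_ker s \<tau> h)"
            using P unfolding integrable_iff_bounded
            by (auto simp: abs_mult jump_ker_nonneg abs_of_nonneg intro: le_less_trans)
          have \<Phi>u: "(\<integral>h. ?\<Phi> h * jump_ker s \<tau> h \<partial>lborel) \<le> C"
          proof -
            have "ennreal (\<integral>h. ?\<Phi> h * jump_ker s \<tau> h \<partial>lborel) \<le> ennreal C"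
              using P by (subst nn_integral_eq_integral[OF i\<Phi>, symmetric]) (auto simp: jump_ker_nonneg)
            then show ?thesis using C(1) by (subst (asm) ennreal_le_iff) auto
          qed
          have "(1/2) * \<theta> - ?q * C \<le> (1/2) * (\<integral>h. indicator ?S (x + h) * jump_ker s \<tau> h \<partial>lborel)
              - ?q * (\<integral>h. ?\<Phi> h * jump_ker s \<tau> h \<partial>lborel)"
            using Sl \<Phi>u \<beta> a s by (intro diff_mono mult_left_mono) auto
          also have "\<dots> = (\<integral>h. (1/2) * (indicator ?S (x + h) * jump_ker s \<tau> h) - ?q * (?\<Phi> h * jump_ker s \<tau> h) \<partial>lborel)"
            using iS i\<Phi> by simp
          also have "\<dots> \<le> (\<integral>h. (v x - v (x + h)) * jump_ker s \<tau> h - (w x - w (x + h)) * jump_ker s \<tau> h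
              + 8 * \<beta> * ((x \<bullet> h) * indicator (ball 0 (1/2)) h * jump_ker s \<tau> h) \<partial>lborel)"
          proof (rule integral_mono)
            fix h :: 'a
            from mult_right_mono[OF ptw[of h] jump_ker_nonneg[of s \<tau> h]]
            show "(1/2) * (indicator ?S (x + h) * jump_ker s \<tau> h) - ?q * (?\<Phi> h * jump_ker s \<tau> h)
              \<le> (v x - v (x + h)) * jump_ker s \<tau> h - (w x - w (x + h)) * jump_ker s \<tau> h
              + 8 * \<beta> * ((x \<bullet> h) * indicator (ball 0 (1/2)) h * jump_ker s \<tau> h)"
              by (simp only: left_diff_distrib distrib_right mult.assoc)
          qed (intro Bochner_Integration.integrable_diff Bochner_Integration.integrable_add integrable_mult_right iS i\<Phi> iv iw il)+
          also have "\<dots> = jump_op s \<tau> v x - jump_op s \<tau> w x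
              + 8 * \<beta> * (\<integral>h. (x \<bullet> h) * indicator (ball 0 (1/2)) h * jump_ker s \<tau> h \<partial>lborel)"
            using iv iw il by simp
          also have "(\<integral>h. (x \<bullet> h) * indicator (ball 0 (1/2)) h * jump_ker s \<tau> h \<partial>lborel) = 0"
            by (rule jump_ker_odd)
          finally have 1: "(1/2) * \<theta> - ?q * C + jump_op s \<tau> w x
            \<le> jump_op s \<tau> v x" by simp
          have "256 * a / s * C \<le> 256 * a0 / s * C"
            using a s C by (intro mult_right_mono divide_right_mono) auto
          then have "?q * C \<le> \<theta> / 4" using \<beta>(3) a0(3) by (simp add: distrib_right)
          then show ?thesis using 1 by simp
        qed
        let ?\<tau> = "\<lambda>n. 1 / real (Suc n)"
        have lim: "(\<lambda>n. jump_op s (?\<tau> n) v x) \<longlonglongrightarrow> G * (L / c)"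
          using has_frac_laplacian_jump[OF s vm vM L(1)] unfolding G_def c_def .
        \<comment> \<open>Off \<open>E\<close> the limit is at most \<open>\<theta> / 16\<close> but
          at least \<open>\<theta> / 4 - e\<close>. On \<open>E\<close> the limit
          \<open>G * (L / c)\<close> is still a real number; the truncated operators of
          \<open>w\<close> eventually exceed it, so the limit would exceed itself by
          \<open>\<theta> / 4\<close>.\<close>
        show False
        proof (cases "x \<in> E")
          case False
          then have "L \<le> \<eta>" using L by simp
          then have "G * (L / c) \<le> \<theta> / 16" unfolding \<eta>(2)[symmetric] using G c by (intro mult_left_mono divide_right_mono) auto
          moreover have "\<theta> / 4 - e \<le> G * (L / c)"
          proof (rule LIMSEQ_le_const[OF lim], intro exI allI impI)
            fix n
            show "\<theta> / 4 - e \<le> jump_op s (?\<tau> n) v x"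
              using low[of "?\<tau> n"] wl[of "?\<tau> n" x] by simp
          qed
          ultimately show False using e(3) \<theta> by linarith
        next
          case True
          obtain \<tau>0 where \<tau>0: "0 < \<tau>0" "\<And>\<tau>. 0 < \<tau> \<Longrightarrow> \<tau> \<le> \<tau>0 \<Longrightarrow> G * (L / c) \<le> jump_op s \<tau> w x"
            using wE[OF True] by metis
          obtain n0 where n0: "inverse (real (Suc n0)) < \<tau>0" using reals_Archimedean[OF \<tau>0(1)] by blast
          have "\<theta> / 4 + G * (L / c) \<le> G * (L / c)"
          proof (rule LIMSEQ_le_const[OF lim], intro exI allI impI)
            fix n assume n: "n0 \<le> n"
            have "?\<tau> n \<le> ?\<tau> n0" using n by (intro divide_left_mono) auto
            then have "?\<tau> n \<le> \<tau>0" using n0 by (simp add: inverse_eq_divide)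
            then show "\<theta> / 4 + G * (L / c) \<le> jump_op s (?\<tau> n) v x"
              using low[of "?\<tau> n"] \<tau>0(2)[of "?\<tau> n"] by simp
          qed
          then show False using \<theta> by simp
        qed
      qed
    qed
  qed
qed

section \<open>Exterior cones and the Hoelder estimate\<close>

lemma null_sets_affine_vimage:
  fixes E :: "'a::euclidean_space set"
  assumes E: "E \<in> null_sets lebesgue" and R: "R \<noteq> 0"
  shows "{y. z + R *\<^sub>R y \<in> E} \<in> null_sets lebesgue"
proof -
  have "{y. z + R *\<^sub>R y \<in> E} = (\<lambda>e. (1 / R) *\<^sub>R (e - z)) ` E"
  proof (intro set_eqI iffI)
    fix y assume "y \<in> {y. z + R *\<^sub>R y \<in> E}"
    then show "y \<in> (\<lambda>e. (1 / R) *\<^sub>R (e - z)) ` E"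
      using R by (intro image_eqI[of _ _ "z + R *\<^sub>R y"]) auto
  qed (use R in auto)
  moreover have "negligible ((\<lambda>e. (1 / R) *\<^sub>R (e - z)) ` E)"
    using E by (intro negligible_differentiable_image_negligible)
      (auto simp: negligible_iff_null_sets differentiable_on_def intro!: derivative_intros)
  ultimately show ?thesis by (simp add: negligible_iff_null_sets)
qed

lemma AE_lebesgue_ball:
  fixes c :: "'a::euclidean_space"
  assumes "AE x in lebesgue. P x" and r: "0 < r"
  obtains x where "x \<in> ball c r" "P x"
proof -
  obtain N where N: "\<And>x. x \<in> space lebesgue - N \<Longrightarrow> P x" "N \<in> null_sets lebesgue"
    using AE_E3[OF assms(1)] by blast
  have "\<not> ball c r \<subseteq> N"
  proof
    assume "ball c r \<subseteq> N"
    then have "emeasure lebesgue (ball c r) \<le> emeasure lebesgue N" using N(2) by (intro emeasure_mono) auto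
    also have "\<dots> = 0" using N(2) by auto
    finally show False
      using r unit_ball_vol_pos[of "real DIM('a)"] by (simp add: emeasure_ball del: unit_ball_vol_pos)
  qed
  then obtain x where "x \<in> ball c r" "x \<notin> N" by blast
  then show ?thesis using N(1)[of x] that[of x] by simp
qed

section \<open>Balls inside exterior cones, and vanishing of the solution outside the domain\<close>

lemma cone_ball_radius:
  fixes \<theta> :: real
  assumes "0 < \<theta>" "\<theta> < pi"
  shows "0 < (1 - cos \<theta>) / 8" "(1 - cos \<theta>) / 8 \<le> 1/4"
proof -
  have "cos \<theta> < cos 0" using assms by (intro cos_monotone_0_pi) auto
  then show "0 < (1 - cos \<theta>) / 8" by simp
  have "1 - cos \<theta> \<le> 2" using cos_ge_minus_one[of \<theta>] by (simp only: diff_le_eq)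
  then have "(1 - cos \<theta>) / 8 \<le> 2 / 8" by (rule divide_right_mono) simp
  also have "2 / 8 = (1/4 :: real)" by simp
  finally show "(1 - cos \<theta>) / 8 \<le> 1/4" .
qed

text \<open>With \<open>k = (1 - cos \<theta>) / 8\<close>, points of the ball satisfy
  \<open>e \<bullet> v > R * (1/4 - k)\<close> and \<open>norm v < R * (1/4 + k)\<close>. Since
  \<open>cos \<theta> = 1 - 8 * k\<close>, the product \<open>cos \<theta> * (1/4 + k)\<close>
  equals \<open>1/4 - k - 8 * k\<^sup>2\<close>, which stays below \<open>1/4 - k\<close>; this is
  where the 8 comes from. A negative cosine is harmless because \<open>e \<bullet> v\<close> is
  positive.\<close>

lemma angular_cone_ball:
  fixes e :: "'a::euclidean_space"
  assumes e: "norm e = 1" and \<theta>: "0 < \<theta>" "\<theta> < pi" and R: "0 < R"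
    and v: "dist ((R / 4) *\<^sub>R e) v < R * ((1 - cos \<theta>) / 8)"
  shows "v \<in> angular_cone e \<theta>"
proof -
  define k where "k = (1 - cos \<theta>) / 8"
  have c: "cos \<theta> < 1" "- 1 \<le> cos \<theta>" using cos_monotone_0_pi[of 0 \<theta>] \<theta> by auto
  have k: "0 < k" "k \<le> 1/4" unfolding k_def by (rule cone_ball_radius[OF \<theta>])+
  have d: "norm (v - (R / 4) *\<^sub>R e) < R * k" using v by (simp add: dist_norm norm_minus_commute k_def)
  have ee: "e \<bullet> e = 1" using e by (simp add: norm_eq_sqrt_inner)
  have "\<bar>e \<bullet> (v - (R / 4) *\<^sub>R e)\<bar> \<le> norm e * norm (v - (R / 4) *\<^sub>R e)" by (rule Cauchy_Schwarz_ineq2)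
  then have 1: "R * (1/4 - k) < e \<bullet> v" using d e ee by (simp add: inner_diff_right algebra_simps abs_le_iff)
  have 2: "norm v < R * (1/4 + k)"
    using norm_triangle_ineq[of "v - (R / 4) *\<^sub>R e" "(R / 4) *\<^sub>R e"] d e R by (simp add: algebra_simps)
  have 3: "0 \<le> R * (1/4 - k)" using R k by simp
  then have v0: "v \<noteq> 0" using 1 by auto
  have "cos \<theta> * norm v < e \<bullet> v"
  proof (cases "0 \<le> cos \<theta>")
    case True
    have "cos \<theta> * norm v \<le> cos \<theta> * (R * (1/4 + k))" using 2 True by (intro mult_left_mono) auto
    also have "\<dots> = R * (cos \<theta> * (1/4 + k))" by simp
    also have "\<dots> \<le> R * (1/4 - k)"
    proof (rule mult_left_mono)
      define C where "C = cos \<theta>"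
      have "k = (1 - C) / 8" by (simp add: k_def C_def)
      then have "C = 1 - 8 * k" by simp
      then have "cos \<theta> = 1 - 8 * k" by (simp only: C_def)
      moreover have "(1 - 8 * k) * (1/4 + k) = 1/4 - k - 8 * (k * k)" by (simp add: algebra_simps)
      ultimately have "cos \<theta> * (1/4 + k) = 1/4 - k - 8 * (k * k)" by (simp only:)
      then show "cos \<theta> * (1/4 + k) \<le> 1/4 - k" using k by simp
    qed (use R in simp)
    finally show ?thesis using 1 by simp
  next
    case False
    then have "cos \<theta> * norm v \<le> 0" by (simp add: mult_nonpos_nonneg)
    then show ?thesis using 1 3 by simp
  qed
  then have "cos \<theta> < e \<bullet> v / norm v" using v0 by (simp add: pos_less_divide_eq)
  moreover have "e \<bullet> v / norm v \<le> 1"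
    using Cauchy_Schwarz_ineq2[of e v] e v0 by (simp add: pos_divide_le_eq)
  ultimately have "arccos (e \<bullet> v / norm v) < arccos (cos \<theta>)"
    using c by (intro arccos_less_arccos) auto
  then show ?thesis using v0 \<theta> by (simp add: angular_cone_def arccos_cos)
qed

text \<open>A centre at distance \<open>R / 4\<close> and a radius of at most \<open>R / 4\<close>
  keep the ball within \<open>R / 2\<close> of \<open>x\<close>, hence inside every ball of radius
  \<open>R\<close> whose centre is closer than \<open>R / 2\<close> to \<open>x\<close>.\<close>

lemma exterior_cone_ball:
  fixes \<Omega> :: "'a::euclidean_space set"
  assumes cone: "uniform_exterior_cone \<theta> \<Omega>" and \<theta>: "0 < \<theta>" "\<theta> < pi" and x: "x \<in> frontier \<Omega>" and R: "0 < R"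
  obtains c where "dist x c = R / 4" "ball c (R * ((1 - cos \<theta>) / 8)) \<subseteq> - \<Omega>"
proof -
  obtain e where e: "norm e = 1" "(\<lambda>v. x + v) ` angular_cone e \<theta> \<subseteq> - \<Omega>"
    using cone x unfolding uniform_exterior_cone_def by blast
  show ?thesis
  proof (rule that[of "x + (R / 4) *\<^sub>R e"])
    show "dist x (x + (R / 4) *\<^sub>R e) = R / 4" using e R by (simp add: dist_norm)
    show "ball (x + (R / 4) *\<^sub>R e) (R * ((1 - cos \<theta>) / 8)) \<subseteq> - \<Omega>"
    proof
      fix y assume "y \<in> ball (x + (R / 4) *\<^sub>R e) (R * ((1 - cos \<theta>) / 8))"
      then have "dist ((R / 4) *\<^sub>R e) (y - x) < R * ((1 - cos \<theta>) / 8)"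
        by (simp add: dist_norm algebra_simps)
      then have "x + (y - x) \<in> (\<lambda>v. x + v) ` angular_cone e \<theta>"
        by (intro imageI angular_cone_ball[OF e(1) \<theta> R])
      then show "y \<in> - \<Omega>" using e(2) by auto
    qed
  qed
qed

text \<open>Every neighbourhood of a point outside the domain contains a ball outside the domain:
  inside the cone at a boundary point, around the point itself elsewhere. Such a ball meets the set
  of full measure where the exterior condition holds, and continuity does the rest.\<close>

lemma continuous_AE_zero_imp_zero:
  fixes u :: "'a::euclidean_space \<Rightarrow> real"
  assumes cone: "uniform_exterior_cone \<theta> \<Omega>" and \<theta>: "0 < \<theta>" "\<theta> < pi" and "open \<Omega>"
    and uc: "continuous_on UNIV u" and u0: "AE x in lebesgue. x \<notin> \<Omega> \<longrightarrow> u x = 0" and x: "x \<notin> \<Omega>"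
  shows "u x = 0"
proof (rule ccontr)
  assume "u x \<noteq> 0"
  then have "x \<in> {y. u y \<noteq> 0}" by simp
  moreover have "open {y. u y \<noteq> 0}" using uc by (intro open_Collect_neq continuous_on_const)
  ultimately obtain d where d: "0 < d" "ball x d \<subseteq> {y. u y \<noteq> 0}" by (meson open_contains_ball)
  obtain c r where c: "0 < r" "ball c r \<subseteq> ball x d" "ball c r \<subseteq> - \<Omega>"
  proof (cases "x \<in> frontier \<Omega>")
    case True
    obtain c where c: "dist x c = d / 4" "ball c (d * ((1 - cos \<theta>) / 8)) \<subseteq> - \<Omega>"
      using exterior_cone_ball[OF cone \<theta> True d(1)] .
    note k = cone_ball_radius[OF \<theta>]
    have "d * ((1 - cos \<theta>) / 8) \<le> d * (1/4)" using k d by (intro mult_left_mono) auto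
    then have "d * ((1 - cos \<theta>) / 8) \<le> d / 4" by simp
    then have "ball c (d * ((1 - cos \<theta>) / 8)) \<subseteq> ball c (d / 4)" by (rule subset_ball)
    also have "\<dots> \<subseteq> ball x d"
    proof
      fix y assume "y \<in> ball c (d / 4)"
      then show "y \<in> ball x d" using c(1) d(1) dist_triangle[of x y c] by simp
    qed
    finally have "ball c (d * ((1 - cos \<theta>) / 8)) \<subseteq> ball x d" .
    then show ?thesis using that[of "d * ((1 - cos \<theta>) / 8)" c] c k d by auto
  next
    case False
    then have "x \<in> - closure \<Omega>" using x \<open>open \<Omega>\<close> by (simp add: frontier_def interior_open)
    then obtain r where r: "0 < r" "ball x r \<subseteq> - closure \<Omega>" by (meson closed_closure open_Compl open_contains_ball)
    have "ball x (min r d) \<subseteq> ball x d" "ball x (min r d) \<subseteq> ball x r" by (auto intro: subset_ball)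
    moreover from this r have "ball x (min r d) \<subseteq> - \<Omega>" using closure_subset[of \<Omega>] by blast
    ultimately show ?thesis using that[of "min r d" x] r d by simp
  qed
  obtain y where "y \<in> ball c r" "y \<notin> \<Omega> \<longrightarrow> u y = 0" using AE_lebesgue_ball[OF u0 c(1)] .
  then show False using c d by auto
qed

section \<open>Pointwise consequences of essential bounds, and scales that are powers of 1/4\<close>

lemma Linfty_AE_le:
  assumes "Linfty S f"
  shows "AE x in lebesgue_on S. \<bar>f x\<bar> \<le> Linfty_norm S f"
proof -
  have "AE x in lebesgue_on S. ennreal \<bar>f x\<bar> \<le> esssup (lebesgue_on S) (\<lambda>x. ennreal \<bar>f x\<bar>)" by (rule esssup_AE)
  then show ?thesis
  proof eventually_elim
    case (elim x)
    have "ennreal \<bar>f x\<bar> \<le> ennreal (Linfty_norm S f)"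
      using elim assms unfolding Linfty_def Linfty_norm_def by simp
    then show ?case by (simp add: Linfty_norm_def)
  qed
qed

lemma Linfty_norm_nonneg: "0 \<le> Linfty_norm S f"
  by (simp add: Linfty_norm_def)

lemma continuous_Linfty_le:
  fixes u :: "'a::euclidean_space \<Rightarrow> real"
  assumes uc: "continuous_on UNIV u" and u: "Linfty UNIV u"
  shows "\<bar>u x\<bar> \<le> Linfty_norm UNIV u"
proof (rule ccontr)
  assume "\<not> \<bar>u x\<bar> \<le> Linfty_norm UNIV u"
  then have "x \<in> {y. Linfty_norm UNIV u < \<bar>u y\<bar>}" by simp
  moreover have "open {y. Linfty_norm UNIV u < \<bar>u y\<bar>}"
    using uc by (intro open_Collect_less continuous_intros) auto
  ultimately obtain d where d: "0 < d" "ball x d \<subseteq> {y. Linfty_norm UNIV u < \<bar>u y\<bar>}" by (meson open_contains_ball)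
  obtain y where "y \<in> ball x d" "\<bar>u y\<bar> \<le> Linfty_norm UNIV u"
    using AE_lebesgue_ball[OF Linfty_AE_le[OF u, unfolded lebesgue_on_UNIV_eq] d(1)] .
  then show False using d by force
qed

lemma uniform_exterior_cone_mono:
  "\<theta> \<le> \<theta>' \<Longrightarrow> uniform_exterior_cone \<theta>' \<Omega> \<Longrightarrow> uniform_exterior_cone \<theta> \<Omega>"
  unfolding uniform_exterior_cone_def angular_cone_def by fastforce

lemma quarter_power_bracket:
  fixes D :: real
  assumes "0 < D" "D < 1"
  obtains k :: nat where "(1/4) ^ Suc k \<le> D" "D < (1/4) ^ k"
proof -
  have "\<exists>n. (1/4) ^ n < D" by (rule real_arch_pow_inv[OF assms(1)]) simp
  then obtain n :: nat where n: "(1/4) ^ n < D" by (rule exE)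
  define j where "j = (LEAST n. (1/4) ^ n \<le> D)"
  have j: "(1/4) ^ j \<le> D" unfolding j_def by (rule LeastI[of "\<lambda>n. (1/4) ^ n \<le> D" n]) (use n in simp)
  have "j \<noteq> 0" using j assms by (intro notI) simp
  then obtain k where k: "j = Suc k" by (cases j) auto
  have "\<not> (1/4) ^ k \<le> D" using not_less_Least[of k "\<lambda>n. (1/4) ^ n \<le> D"] k unfolding j_def by auto
  then show ?thesis using that[of k] j k by simp
qed

text \<open>The density alternative needed for the one-sided decay comes from
  the exterior cone when \<open>\<partial>\<Omega>\<close> meets the half ball, and otherwise from choosing the sign of the
  normalised function; in the first case the sign is that of the value \<open>0\<close> outside \<open>\<Omega>\<close>.\<close>

lemma oscillation_step:
  fixes u :: "'a::euclidean_space \<Rightarrow> real"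
  assumes s: "0 < s" "s < 1" and \<alpha>: "0 < \<alpha>" "\<alpha> \<le> 1" "\<alpha> \<le> 2 * s" and \<gamma>: "1 - \<gamma> / 2 \<le> (1/4) powr \<alpha>"
    and decay: "one_sided_decay TYPE('a) s \<alpha> \<mu> \<eta> \<gamma>"
    and \<theta>: "0 < \<theta>" "\<theta> < pi"
    and \<mu>: "0 < \<mu>" "\<And>c. ennreal \<mu> \<le> emeasure lborel (ball (c::'a) ((1 - cos \<theta>) / 8))"
           "ennreal (2 * \<mu>) \<le> emeasure lborel (ball (0::'a) 1)"
    and \<Omega>: "open \<Omega>" "uniform_exterior_cone \<theta> \<Omega>"
    and uc: "continuous_on UNIV u" and U: "\<And>x. \<bar>u x\<bar> \<le> U" and u0: "\<And>x. x \<notin> \<Omega> \<Longrightarrow> u x = 0"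
    and E: "E \<in> null_sets lebesgue"
    and eq: "\<And>x. x \<in> \<Omega> \<Longrightarrow> \<exists>L. has_frac_laplacian s u x L \<and> (x \<in> E \<or> \<bar>L\<bar> \<le> G)"
    and K: "0 < K" "2 * U \<le> K" "8 * G \<le> K * \<eta>" and G: "0 \<le> G" and \<eta>: "0 < \<eta>"
    and IH: "\<And>i x y. i \<le> k \<Longrightarrow> dist z x < (1/4) ^ i \<Longrightarrow> dist z y < (1/4) ^ i \<Longrightarrow> u x - u y \<le> K * ((1/4) ^ i) powr \<alpha>"
    and x: "dist z x < (1/4) ^ Suc k" and y: "dist z y < (1/4) ^ Suc k"
  shows "u x - u y \<le> K * ((1/4) ^ Suc k) powr \<alpha>"
proof (rule ccontr)
  assume neg: "\<not> u x - u y \<le> K * ((1/4) ^ Suc k) powr \<alpha>"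
  define R :: real where "R = (1/4) ^ k"
  have R: "0 < R" "R \<le> 1" by (auto simp: R_def power_le_one)
  have R4: "(1/4) ^ Suc k = R / 4" by (simp add: R_def)
  have B: "bdd_above (u ` S)" "bdd_below (u ` S)" for S
    using U by (auto intro!: bdd_aboveI[of _ U] bdd_belowI[of _ "- U"] simp: abs_le_iff minus_le_iff)
  define Mx where "Mx = (SUP x\<in>ball z R. u x)"
  define mn where "mn = (INF x\<in>ball z R. u x)"
  define hf where "hf = (Mx - mn) / 2"
  define md where "md = (Mx + mn) / 2"
  have ball: "mn \<le> u X" "u X \<le> Mx" if "X \<in> ball z R" for X
    unfolding mn_def Mx_def using that by (auto intro!: cINF_lower cSUP_upper B)
  have ne: "ball z R \<noteq> {}" using R by simp
  have Mxle: "Mx \<le> c" if "\<And>X. X \<in> ball z R \<Longrightarrow> u X \<le> c" for c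
    unfolding Mx_def using that ne by (intro cSUP_least) auto
  have mnge: "c \<le> mn" if "\<And>X. X \<in> ball z R \<Longrightarrow> c \<le> u X" for c
    unfolding mn_def using that ne by (intro cINF_greatest) auto
  have "(1/4) ^ Suc k \<le> R" using R R4 by simp
  then have xy: "x \<in> ball z R" "y \<in> ball z R" using x y by auto
  \<comment> \<open>Refuting the claim at the next scale bounds the oscillation
    \<open>2 * hf\<close> over the present ball from below. After division by \<open>hf\<close> this
    controls both the growth at infinity and the right-hand side.\<close>
  have hf2: "K * (R / 4) powr \<alpha> < 2 * hf"
    using neg ball(2)[OF xy(1)] ball(1)[OF xy(2)] unfolding R4 hf_def by simp
  have Kp: "0 < K * (R / 4) powr \<alpha>" using K R by simp
  then have hf0: "0 < hf" using hf2 by simp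
  have hfK: "2 * hf \<le> K * R powr \<alpha>"
  proof -
    have "u X - u Y \<le> K * R powr \<alpha>" if "X \<in> ball z R" "Y \<in> ball z R" for X Y
      using IH[of k X Y] that unfolding R_def by simp
    then have "Mx \<le> u Y + K * R powr \<alpha>" if "Y \<in> ball z R" for Y
      using that by (intro Mxle) (auto simp: diff_le_eq add.commute)
    then have "Mx - K * R powr \<alpha> \<le> mn"
      by (intro mnge) (auto simp: diff_le_eq)
    then show ?thesis by (simp add: hf_def)
  qed
  \<comment> \<open>From distance 1 on, \<open>2 * U \<le> K\<close> suffices. Otherwise
    \<open>dist z Y\<close> lies between two consecutive powers of 1/4, and using the assumed bound
    at the larger one costs the factor 4.\<close>
  have tail: "\<bar>u Y - u X\<bar> \<le> K * (4 * dist z Y) powr \<alpha>" if X: "X \<in> ball z R" and Y: "R \<le> dist z Y" for X Y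
  proof (cases "dist z Y < 1")
    case False
    then have "1 \<le> (4 * dist z Y) powr \<alpha>" using \<alpha> by (intro ge_one_powr_ge_zero) auto
    then have "K * 1 \<le> K * (4 * dist z Y) powr \<alpha>" using K by (intro mult_left_mono) auto
    moreover have "\<bar>u Y - u X\<bar> \<le> 2 * U" using U[of X] U[of Y] by linarith
    ultimately show ?thesis using K(2) by linarith
  next
    case True
    then obtain i where i: "(1/4) ^ Suc i \<le> dist z Y" "dist z Y < (1/4) ^ i"
      using quarter_power_bracket[of "dist z Y"] R Y by (metis less_le_trans)
    have "i < k"
    proof (rule ccontr)
      assume "\<not> i < k"
      then have "(1/4 :: real) ^ i \<le> (1/4) ^ k" by (intro power_decreasing) auto
      then show False using i(2) Y unfolding R_def by linarith
    qed
    then have "(1/4 :: real) ^ k \<le> (1/4) ^ i" by (intro power_decreasing) auto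
    moreover have "dist z X < (1/4) ^ k" using X by (simp add: R_def)
    ultimately have X': "dist z X < (1/4) ^ i" by (rule less_le_trans[rotated])
    have "\<bar>u Y - u X\<bar> \<le> K * ((1/4) ^ i) powr \<alpha>"
      using IH[of i X Y] IH[of i Y X] X' i \<open>i < k\<close> by (simp add: abs_le_iff)
    also have "\<dots> \<le> K * (4 * dist z Y) powr \<alpha>"
      using i K \<alpha> by (intro mult_left_mono powr_mono2) auto
    finally show ?thesis .
  qed
  define w where "w \<sigma> y = (\<sigma> / hf) * (u (z + R *\<^sub>R y) - md)" for \<sigma> :: real and y
  define E' where "E' = {y. z + R *\<^sub>R y \<in> E}"
  have E': "E' \<in> null_sets lebesgue" unfolding E'_def using R by (intro null_sets_affine_vimage E) simp
  have um: "u \<in> borel_measurable borel" using uc by (rule borel_measurable_continuous_onI)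
  have zR: "z + R *\<^sub>R y \<in> ball z (R * r) \<longleftrightarrow> norm y < r" for y r
    using R by (simp add: dist_norm)
  have wc: "continuous_on UNIV (w \<sigma>)" for \<sigma>
    unfolding w_def by (intro continuous_intros continuous_on_compose2[OF uc]) auto
  have w1: "\<bar>w \<sigma> y\<bar> \<le> 1" if "norm y < 1" "\<bar>\<sigma>\<bar> = 1" for \<sigma> y
  proof -
    have "z + R *\<^sub>R y \<in> ball z R" using zR[of y 1] that by simp
    from ball[OF this] have "\<bar>u (z + R *\<^sub>R y) - md\<bar> \<le> hf" unfolding md_def hf_def by (simp add: abs_le_iff field_simps)
    then show ?thesis using hf0 that by (simp add: w_def abs_mult)
  qed
  have wt: "w \<sigma> y \<le> 2 * (16 * norm y) powr \<alpha> - 1" if y: "1 \<le> norm y" and \<sigma>: "\<sigma> = 1 \<or> \<sigma> = - 1" for \<sigma> y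
  proof -
    define Y where "Y = z + R *\<^sub>R y"
    have dY: "dist z Y = R * norm y" using R by (simp add: Y_def dist_norm)
    have Y: "R \<le> dist z Y" using y R by (simp add: dY)
    define T where "T = K * (4 * dist z Y) powr \<alpha>"
    have "Mx \<le> u Y + T" using tail[OF _ Y] by (intro Mxle) (fastforce simp: T_def abs_le_iff)
    moreover have "u Y - T \<le> mn" using tail[OF _ Y] by (intro mnge) (fastforce simp: T_def abs_le_iff)
    ultimately have "\<sigma> * (u Y - md) \<le> T - hf" using \<sigma> unfolding md_def hf_def by (auto simp: field_simps)
    then have "w \<sigma> y \<le> (T - hf) / hf" unfolding w_def Y_def[symmetric] using hf0 by (simp add: divide_right_mono)
    also have "\<dots> = T / hf - 1" using hf0 by (simp add: diff_divide_distrib)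
    also have "T / hf \<le> 2 * (16 * norm y) powr \<alpha>"
    proof -
      \<comment> \<open>Origin of the 16 in the growth bound: one factor 4 from bracketing the
        distance, another because the lower bound of \<open>2 * hf\<close> refers to
        \<open>R / 4\<close>.\<close>
      have "T = K * (R / 4) powr \<alpha> * (16 * norm y) powr \<alpha>"
        unfolding T_def dY using R by (simp add: powr_mult[symmetric] mult.assoc)
      also have "\<dots> \<le> 2 * hf * (16 * norm y) powr \<alpha>"
        using hf2 by (intro mult_right_mono) auto
      finally show ?thesis using hf0 by (simp add: pos_divide_le_eq mult_ac)
    qed
    finally show ?thesis by simp
  qed
  have weq: "\<exists>L. has_frac_laplacian s (w \<sigma>) y L \<and> (y \<in> E' \<or> L \<le> \<eta>)"
    if y: "z + R *\<^sub>R y \<in> \<Omega>" and \<sigma>: "\<bar>\<sigma>\<bar> = 1" for \<sigma> y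
  proof -
    obtain L where L: "has_frac_laplacian s u (z + R *\<^sub>R y) L" "z + R *\<^sub>R y \<in> E \<or> \<bar>L\<bar> \<le> G" using eq[OF y] by blast
    have 1: "has_frac_laplacian s (w \<sigma>) y (\<sigma> / hf * R powr (2 * s) * L)"
      unfolding w_def using has_frac_laplacian_affine[OF um R(1) L(1)] .
    have "\<sigma> / hf * R powr (2 * s) * L \<le> \<eta>" if "\<bar>L\<bar> \<le> G"
    proof -
      have "\<sigma> / hf * R powr (2 * s) * L \<le> \<bar>\<sigma> / hf * R powr (2 * s) * L\<bar>" by (rule abs_ge_self)
      also have "\<dots> = R powr (2 * s) * \<bar>L\<bar> / hf" using \<sigma> hf0 by (simp add: abs_mult)
      also have "\<dots> \<le> R powr \<alpha> * G / hf"
        using that R \<alpha> hf0 by (intro divide_right_mono mult_mono powr_mono') auto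
      \<comment> \<open>Origin of \<open>8 * G \<le> K * \<eta>\<close>: passing from
        \<open>R\<close> to \<open>R / 4\<close> costs at most a factor 4, and \<open>hf\<close> is
        only half of the oscillation.\<close>
      also have "\<dots> \<le> \<eta>"
      proof -
        have "R powr \<alpha> = 4 powr \<alpha> * (R / 4) powr \<alpha>" using R by (simp add: powr_mult[symmetric])
        also have "\<dots> \<le> 4 powr 1 * (R / 4) powr \<alpha>" using \<alpha> by (intro mult_right_mono powr_mono) auto
        finally have "R powr \<alpha> * G \<le> 4 * (R / 4) powr \<alpha> * G" using G by (intro mult_right_mono) auto
        also have "\<dots> = (R / 4) powr \<alpha> / 2 * (8 * G)" by simp
        also have "\<dots> \<le> (R / 4) powr \<alpha> / 2 * (K * \<eta>)" using K by (intro mult_left_mono) auto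
        also have "\<dots> = \<eta> * (K * (R / 4) powr \<alpha> / 2)" by simp
        also have "\<dots> \<le> \<eta> * hf" using hf2 \<eta> by (intro mult_left_mono) auto
        finally show ?thesis using hf0 by (simp add: pos_divide_le_eq)
      qed
      finally show ?thesis .
    qed
    then show ?thesis using 1 L(2) unfolding E'_def by blast
  qed
  have wM: "\<bar>w \<sigma> y\<bar> \<le> (U + \<bar>md\<bar>) / hf" if "\<bar>\<sigma>\<bar> = 1" for \<sigma> y
  proof -
    have "\<bar>u (z + R *\<^sub>R y) - md\<bar> \<le> U + \<bar>md\<bar>" using U[of "z + R *\<^sub>R y"] by linarith
    then show ?thesis using hf0 that by (simp add: w_def abs_mult divide_right_mono)
  qed
  have concl: False
    if \<sigma>: "\<sigma> = 1 \<or> \<sigma> = - 1" and dens: "ennreal \<mu> \<le> emeasure lborel {y \<in> ball 0 1. w \<sigma> y \<le> 0}"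
      and \<Omega>w: "\<And>y. norm y < 1/2 \<Longrightarrow> 0 < w \<sigma> y \<Longrightarrow> z + R *\<^sub>R y \<in> \<Omega>" for \<sigma>
  proof -
    have \<sigma>': "\<bar>\<sigma>\<bar> = 1" using \<sigma> by auto
    have le: "w \<sigma> X \<le> 1 - \<gamma>" if "norm X < 1/4" for X
    proof (rule decay[unfolded one_sided_decay_def, rule_format, OF wc wM[OF \<sigma>'] E' _ _ dens _ that])
      show "w \<sigma> y \<le> 1" if "norm y < 1" for y using w1[OF that \<sigma>'] by simp
      show "w \<sigma> y \<le> 2 * (16 * norm y) powr \<alpha> - 1" if "1 \<le> norm y" for y using wt[OF that \<sigma>] .
      show "\<exists>L. has_frac_laplacian s (w \<sigma>) y L \<and> (y \<in> E' \<or> L \<le> \<eta>)" if "norm y < 1/2" "0 < w \<sigma> y" for y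
        using weq[OF \<Omega>w[OF that] \<sigma>'] .
    qed
    have le': "\<sigma> * (u X - md) \<le> hf * (1 - \<gamma>)" if X: "dist z X < R / 4" for X
    proof -
      define Y where "Y = (1 / R) *\<^sub>R (X - z)"
      have Y: "z + R *\<^sub>R Y = X" using R by (simp add: Y_def)
      have "norm Y < 1/4" using X R by (simp add: Y_def dist_norm norm_minus_commute pos_divide_less_eq mult.commute)
      from le[OF this] have "\<sigma> * (u X - md) / hf \<le> 1 - \<gamma>" unfolding w_def Y by simp
      then show ?thesis using hf0 by (simp add: pos_divide_le_eq mult.commute)
    qed
    have "u x - u y \<le> 2 * hf * (1 - \<gamma> / 2)"
    proof -
      have e: "mn = md - hf" "Mx = md + hf" by (simp_all add: md_def hf_def field_simps)
      have r: "hf * (1 - \<gamma>) = hf - hf * \<gamma>" "2 * hf * (1 - \<gamma> / 2) = 2 * hf - hf * \<gamma>"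
        by (simp_all add: algebra_simps)
      from \<sigma> show ?thesis
      proof
        assume "\<sigma> = 1"
        then show ?thesis
          using le'[OF x[unfolded R4]] ball(1)[OF xy(2)] unfolding r e by simp
      next
        assume "\<sigma> = - 1"
        then show ?thesis
          using le'[OF y[unfolded R4]] ball(2)[OF xy(1)] unfolding r e by simp
      qed
    qed
    \<comment> \<open>One of the two extreme values moves inwards by \<open>\<gamma> * hf\<close>,
      which multiplies the oscillation by \<open>1 - \<gamma> / 2\<close>; the assumption on
      \<open>\<alpha>\<close> makes this at most the ratio of the bounds at consecutive
      scales.\<close>
    also have "\<dots> \<le> 2 * hf * (1/4) powr \<alpha>" using \<gamma> hf0 by (intro mult_left_mono) auto
    also have "\<dots> \<le> K * R powr \<alpha> * (1/4) powr \<alpha>" using hfK by (intro mult_right_mono) auto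
    also have "\<dots> = K * (R / 4) powr \<alpha>" using R by (simp add: powr_mult[symmetric] mult.assoc)
    finally show False using neg unfolding R4 by simp
  qed
  have wm [measurable]: "w \<sigma> \<in> borel_measurable borel" for \<sigma> using wc by (rule borel_measurable_continuous_onI)
  show False
  proof (cases "ball z (R / 2) \<inter> frontier \<Omega> = {}")
    case False
    then obtain \<zeta> where \<zeta>: "dist z \<zeta> < R / 2" "\<zeta> \<in> frontier \<Omega>" by auto
    let ?k = "(1 - cos \<theta>) / 8"
    have k: "?k \<le> 1/4" by (rule cone_ball_radius[OF \<theta>])
    obtain c where c: "dist \<zeta> c = R / 4" "ball c (R * ?k) \<subseteq> - \<Omega>"
      using exterior_cone_ball[OF \<Omega>(2) \<theta> \<zeta>(2) R(1)] .
    define c' where "c' = (1 / R) *\<^sub>R (c - z)"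
    have cc: "z + R *\<^sub>R c' = c" using R by (simp add: c'_def)
    \<comment> \<open>Outside the domain \<open>u\<close> is 0 and the normalised function equals
      \<open>- \<sigma> * md / hf\<close>; this sign makes it nonpositive there. Points where it is
      positive therefore lie in the domain, where the equation holds.\<close>
    define \<sigma> :: real where "\<sigma> = (if 0 \<le> md then 1 else - 1)"
    have \<sigma>0: "w \<sigma> y \<le> 0" if "z + R *\<^sub>R y \<notin> \<Omega>" for y
      using u0[OF that] hf0 by (auto simp: w_def \<sigma>_def divide_nonpos_pos)
    have sub: "ball c' ?k \<subseteq> {y \<in> ball 0 1. w \<sigma> y \<le> 0}"
    proof
      fix y assume "y \<in> ball c' ?k"
      then have y: "norm (c' - y) < ?k" by (simp add: dist_norm)
      have "dist c (z + R *\<^sub>R y) = norm (R *\<^sub>R (c' - y))" unfolding cc[symmetric] by (simp add: dist_norm algebra_simps)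
      also have "\<dots> = R * norm (c' - y)" using R by simp
      finally have d: "dist c (z + R *\<^sub>R y) = R * norm (c' - y)" .
      then have dk: "dist c (z + R *\<^sub>R y) < R * ?k" using y R by simp
      then have out: "z + R *\<^sub>R y \<notin> \<Omega>" using c(2) by auto
      have "R * ?k \<le> R * (1/4)" using k R by (intro mult_left_mono) auto
      then have "dist z (z + R *\<^sub>R y) < R"
        using dk c(1) \<zeta>(1) dist_triangle[of z c \<zeta>] dist_triangle[of z "z + R *\<^sub>R y" c] by linarith
      then have "norm y < 1" using zR[of y 1] by simp
      then show "y \<in> {y \<in> ball 0 1. w \<sigma> y \<le> 0}" using \<sigma>0[OF out] by simp
    qed
    have "ennreal \<mu> \<le> emeasure lborel (ball c' ?k)" by (rule \<mu>(2))
    also have "\<dots> \<le> emeasure lborel {y \<in> ball 0 1. w \<sigma> y \<le> 0}" by (rule emeasure_mono[OF sub]) measurable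
    finally have "ennreal \<mu> \<le> emeasure lborel {y \<in> ball 0 1. w \<sigma> y \<le> 0}" .
    then show False
    proof (rule concl[rotated])
      show "z + R *\<^sub>R y \<in> \<Omega>" if "0 < w \<sigma> y" for y using \<sigma>0[of y] that by force
    qed (auto simp: \<sigma>_def)
  next
    case True
    then consider "ball z (R / 2) \<inter> \<Omega> = {}" | "ball z (R / 2) \<subseteq> \<Omega>"
      using connected_Int_frontier[OF connected_ball, of z "R / 2" \<Omega>] by blast
    then show False
    proof cases
      case 1
      have "R / 4 \<le> R / 2" using R by simp
      then have "x \<in> ball z (R / 2)" "y \<in> ball z (R / 2)" using x y unfolding R4 by auto
      then have "x \<notin> \<Omega>" "y \<notin> \<Omega>" using 1 by auto
      then have "u x - u y = 0" using u0 by simp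
      then show False using neg Kp unfolding R4 by simp
    next
      case 2
      have in\<Omega>: "z + R *\<^sub>R y \<in> \<Omega>" if "norm y < 1/2" for y using 2 zR[of y "1/2"] that by auto
      let ?S = "\<lambda>\<sigma>. {y \<in> ball 0 1. w \<sigma> y \<le> 0}"
      have m: "?S \<sigma> \<in> sets lborel" for \<sigma> by measurable
      have "ball 0 1 \<subseteq> ?S 1 \<union> ?S (- 1)" using hf0 by (auto simp: w_def zero_le_divide_iff divide_le_0_iff)
      then have "emeasure lborel (ball (0::'a) 1) \<le> emeasure lborel (?S 1 \<union> ?S (- 1))"
        by (intro emeasure_mono sets.Un m)
      also have "\<dots> \<le> emeasure lborel (?S 1) + emeasure lborel (?S (- 1))" by (rule emeasure_subadditive[OF m m])
      finally have sum: "ennreal (2 * \<mu>) \<le> emeasure lborel (?S 1) + emeasure lborel (?S (- 1))"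
        using \<mu>(3) by (rule order_trans[rotated])
      have "ennreal \<mu> \<le> emeasure lborel (?S 1) \<or> ennreal \<mu> \<le> emeasure lborel (?S (- 1))"
      proof (rule ccontr)
        assume "\<not> ?thesis"
        then have "emeasure lborel (?S 1) + emeasure lborel (?S (- 1)) < ennreal \<mu> + ennreal \<mu>"
          by (intro add_strict_mono) auto
        also have "\<dots> = ennreal (2 * \<mu>)" using \<mu>(1) by (simp add: ennreal_plus[symmetric] del: ennreal_plus)
        finally show False using sum by simp
      qed
      then show False using concl[of 1] concl[of "- 1"] in\<Omega> by blast
    qed
  qed
qed

text \<open>The step consumes the bounds at all coarser scales around \<open>z\<close>, since these
  control the growth at infinity, hence the strong induction. Scale 0 is covered by
  \<open>2 * U \<le> K\<close>.\<close>

lemma oscillation_iterate: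
  fixes u :: "'a::euclidean_space \<Rightarrow> real"
  assumes step: "\<And>k x y. \<lbrakk>\<And>i x y. i \<le> k \<Longrightarrow> dist z x < (1/4) ^ i \<Longrightarrow> dist z y < (1/4) ^ i \<Longrightarrow> u x - u y \<le> K * ((1/4) ^ i) powr \<alpha>;
      dist z x < (1/4) ^ Suc k; dist z y < (1/4) ^ Suc k\<rbrakk> \<Longrightarrow> u x - u y \<le> K * ((1/4) ^ Suc k) powr \<alpha>"
    and U: "\<And>x. \<bar>u x\<bar> \<le> U" and K: "2 * U \<le> K"
    and x: "dist z x < (1/4) ^ k" and y: "dist z y < (1/4) ^ k"
  shows "u x - u y \<le> K * ((1/4) ^ k) powr \<alpha>"
  using x y
proof (induction k arbitrary: x y rule: less_induct)
  case (less k)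
  show ?case
  proof (cases k)
    case 0
    have "u x - u y \<le> 2 * U" using U[of x] U[of y] by linarith
    then show ?thesis using 0 K by simp
  next
    case (Suc j)
    show ?thesis unfolding Suc
    proof (rule step)
      show "u x - u y \<le> K * ((1/4) ^ i) powr \<alpha>" if "i \<le> j" "dist z x < (1/4) ^ i" "dist z y < (1/4) ^ i" for i x y
        using less.IH[of i x y] that Suc by simp
    qed (use less.prems Suc in auto)
  qed
qed

lemma holder_estimate:
  fixes s \<theta> :: real
  assumes s: "0 < s" "s < 1" and \<theta>: "0 < \<theta>" "\<theta> < pi"
  obtains \<alpha> C :: real where "0 < \<alpha>" "\<alpha> < s" "0 < C"
    "\<And>(\<Omega> :: 'a::euclidean_space set) g u x y. \<lbrakk>open \<Omega>; uniform_exterior_cone \<theta> \<Omega>; Linfty \<Omega> g; Linfty UNIV u; classical_solution s \<Omega> g u\<rbrakk>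
       \<Longrightarrow> \<bar>u x - u y\<bar> \<le> C * (1 + Linfty_norm UNIV u + Linfty_norm \<Omega> g) * norm (x - y) powr \<alpha>"
proof -
  define b where "b = measure lborel (ball (0::'a) 1)"
  have b: "emeasure lborel (ball (0::'a) 1) = ennreal b" "0 < b"
    unfolding b_def using emeasure_lborel_ball_finite[of "0::'a" 1] content_ball_pos[of 1 "0::'a"]
    by (auto simp: emeasure_eq_ennreal_measure)
  define k where "k = (1 - cos \<theta>) / 8"
  have k: "0 < k" unfolding k_def by (rule cone_ball_radius[OF \<theta>])
  define \<mu> where "\<mu> = min (k ^ DIM('a) * b) (b / 2)"
  have \<mu>: "0 < \<mu>" using b k by (simp add: \<mu>_def)
  have \<mu>1: "ennreal \<mu> \<le> emeasure lborel (ball (c::'a) k)" for c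
  proof -
    have "ennreal \<mu> \<le> ennreal (k ^ DIM('a) * b)" by (intro ennreal_leI) (simp add: \<mu>_def)
    also have "\<dots> = emeasure lborel (ball c k)"
      unfolding emeasure_ball_scale[OF k, of c] b(1) using k b by (intro ennreal_mult) auto
    finally show ?thesis .
  qed
  have \<mu>2: "ennreal (2 * \<mu>) \<le> emeasure lborel (ball (0::'a) 1)"
    unfolding b(1) by (intro ennreal_leI) (simp add: \<mu>_def)
  obtain a0 \<gamma> \<eta> where a0: "0 < a0" and \<gamma>: "0 < \<gamma>" "\<gamma> < 1" and \<eta>: "0 < \<eta>"
    and decay: "\<And>a. 0 < a \<Longrightarrow> a \<le> a0 \<Longrightarrow> one_sided_decay TYPE('a) s a \<mu> \<eta> \<gamma>"
    using oscillation_decay[OF s \<mu>, where 'a='a] by metis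
  define a1 where "a1 = ln (1 - \<gamma> / 2) / ln (1/4)"
  have a1: "0 < a1" unfolding a1_def using \<gamma> by (intro divide_neg_neg) auto
  define \<alpha> where "\<alpha> = min (min a0 a1) (s / 2)"
  have \<alpha>: "0 < \<alpha>" "\<alpha> \<le> a0" "\<alpha> \<le> a1" "\<alpha> \<le> s / 2" using a0 a1 s by (auto simp: \<alpha>_def)
  have \<alpha>\<gamma>: "1 - \<gamma> / 2 \<le> (1/4) powr \<alpha>"
  proof -
    have "(1/4) powr a1 = 1 - \<gamma> / 2" using \<gamma> by (simp add: powr_def a1_def)
    moreover have "(1/4 :: real) powr a1 \<le> (1/4) powr \<alpha>" using \<alpha> by (intro powr_mono') auto
    ultimately show ?thesis by simp
  qed
  \<comment> \<open>The 4 is the cost of rounding a distance up to a power of 1/4; the bracket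
    bounds \<open>K\<close> by a multiple of \<open>1 + U + G\<close>.\<close>
  define C where "C = 4 * (2 + 8 / \<eta> + 1)"
  have C: "0 < C" using \<eta> by (simp add: C_def add_pos_pos)
  show ?thesis
  proof (rule that[of \<alpha> C])
    show "0 < \<alpha>" "\<alpha> < s" "0 < C" using \<alpha> s C by auto
    fix \<Omega> :: "'a set" and g u x y
    assume \<Omega>: "open \<Omega>" "uniform_exterior_cone \<theta> \<Omega>" and g: "Linfty \<Omega> g" and u: "Linfty UNIV u"
      and sol: "classical_solution s \<Omega> g u"
    define U where "U = Linfty_norm UNIV u"
    define G where "G = Linfty_norm \<Omega> g"
    have UG: "0 \<le> U" "0 \<le> G" by (simp_all add: U_def G_def Linfty_norm_nonneg)
    have uc: "continuous_on UNIV u" using sol by (simp add: classical_solution_def)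
    have uU: "\<bar>u x\<bar> \<le> U" for x unfolding U_def by (rule continuous_Linfty_le[OF uc u])
    have u0: "u x = 0" if "x \<notin> \<Omega>" for x
      using sol by (intro continuous_AE_zero_imp_zero[OF \<Omega>(2) \<theta> \<Omega>(1) uc _ that]) (simp add: classical_solution_def)
    have "AE x in lebesgue. x \<in> \<Omega> \<longrightarrow> \<bar>g x\<bar> \<le> G"
      using Linfty_AE_le[OF g] \<Omega>(1) unfolding G_def by (subst (asm) AE_restrict_space_iff) auto
    then obtain E where E: "\<And>x. x \<in> space lebesgue - E \<Longrightarrow> x \<in> \<Omega> \<longrightarrow> \<bar>g x\<bar> \<le> G" "E \<in> null_sets lebesgue"
      using AE_E3 by blast
    have eq: "\<exists>L. has_frac_laplacian s u x L \<and> (x \<in> E \<or> \<bar>L\<bar> \<le> G)" if "x \<in> \<Omega>" for x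
      using sol that E(1)[of x] unfolding classical_solution_def by (intro exI[of _ "g x"]) auto
    \<comment> \<open>The summands serve \<open>2 * U \<le> K\<close>,
      \<open>8 * G \<le> K * \<eta>\<close> and, also when \<open>U\<close> and \<open>G\<close>
      vanish, \<open>0 < K\<close>.\<close>
    define K where "K = 2 * U + 8 * G / \<eta> + 1"
    have K: "0 < K" "2 * U \<le> K" "8 * G \<le> K * \<eta>"
    proof -
      have "0 \<le> 8 * G / \<eta>" using UG \<eta> by simp
      then show "0 < K" "2 * U \<le> K" using UG unfolding K_def by linarith+
      have "K * \<eta> = 2 * U * \<eta> + 8 * G + \<eta>" using \<eta> by (simp add: K_def distrib_right)
      moreover have "0 \<le> 2 * U * \<eta>" using UG \<eta> by simp
      ultimately show "8 * G \<le> K * \<eta>" using \<eta> by linarith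
    qed
    have osc: "u x' - u y' \<le> K * ((1/4) ^ k) powr \<alpha>" if "dist z x' < (1/4) ^ k" "dist z y' < (1/4) ^ k" for k x' y' z
    proof (rule oscillation_iterate[OF _ uU K(2) that])
      fix k x' y'
      assume IH: "\<And>i x y. i \<le> k \<Longrightarrow> dist z x < (1/4) ^ i \<Longrightarrow> dist z y < (1/4) ^ i \<Longrightarrow> u x - u y \<le> K * ((1/4) ^ i) powr \<alpha>"
        and xy: "dist z x' < (1/4) ^ Suc k" "dist z y' < (1/4) ^ Suc k"
      show "u x' - u y' \<le> K * ((1/4) ^ Suc k) powr \<alpha>"
      proof (rule oscillation_step[where \<mu>=\<mu> and \<eta>=\<eta> and \<gamma>=\<gamma> and G=G and \<Omega>=\<Omega> and E=E and \<theta>=\<theta>])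
        show "\<alpha> \<le> 1" "\<alpha> \<le> 2 * s" using \<alpha> s by auto
        show "ennreal \<mu> \<le> emeasure lborel (ball (c::'a) ((1 - cos \<theta>) / 8))" for c
          using \<mu>1[of c] unfolding k_def .
        show "one_sided_decay TYPE('a) s \<alpha> \<mu> \<eta> \<gamma>" by (rule decay[OF \<alpha>(1,2)])
      qed (fact s \<alpha> \<alpha>\<gamma> \<theta> \<mu> \<mu>2 \<Omega> uc uU u0 E(2) eq K UG \<eta> IH xy)+
    qed
    have hol: "\<bar>u x - u y\<bar> \<le> 4 * K * norm (x - y) powr \<alpha>"
    proof -
      consider "x = y" | "0 < dist x y" "dist x y < 1" | "1 \<le> dist x y" by fastforce
      then show ?thesis
      proof cases
        case 2
        then obtain k where k: "(1/4) ^ Suc k \<le> dist x y" "dist x y < (1/4) ^ k"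
          using quarter_power_bracket[of "dist x y"] by blast
        have "\<bar>u x - u y\<bar> \<le> K * ((1/4) ^ k) powr \<alpha>"
          using osc[of x x k y] osc[of x y k x] k by (simp add: abs_le_iff)
        also have "\<dots> \<le> K * (4 * dist x y) powr \<alpha>"
          using k K \<alpha> by (intro mult_left_mono powr_mono2) auto
        also have "\<dots> = 4 powr \<alpha> * K * dist x y powr \<alpha>" by (simp add: powr_mult)
        also have "\<dots> \<le> 4 powr 1 * K * dist x y powr \<alpha>"
          using \<alpha> s K by (intro mult_right_mono powr_mono) auto
        finally show ?thesis by (simp add: dist_norm)
      next
        case 3
        have "\<bar>u x - u y\<bar> \<le> 2 * U" using uU[of x] uU[of y] by linarith
        also have "\<dots> \<le> 4 * K * 1" using K by simp
        also have "\<dots> \<le> 4 * K * dist x y powr \<alpha>"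
          using 3 K \<alpha> by (intro mult_left_mono ge_one_powr_ge_zero) auto
        finally show ?thesis by (simp add: dist_norm)
      qed simp
    qed
    also have "\<dots> \<le> C * (1 + U + G) * norm (x - y) powr \<alpha>"
    proof (rule mult_right_mono)
      define e where "e = 8 / \<eta>"
      have "K = 2 * U + e * G + 1" by (simp add: K_def e_def)
      then have "(2 + e + 1) * (1 + U + G) = K + 2 + e + e * U + U + 3 * G"
        by (simp add: algebra_simps)
      moreover have "0 \<le> e" "0 \<le> e * U" using \<eta> UG by (auto simp: e_def)
      ultimately have "K \<le> (2 + e + 1) * (1 + U + G)" using UG by linarith
      then have "4 * K \<le> 4 * ((2 + e + 1) * (1 + U + G))" by (rule mult_left_mono) simp
      then show "4 * K \<le> C * (1 + U + G)" unfolding C_def e_def[symmetric] mult.assoc .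
    qed simp
    finally show "\<bar>u x - u y\<bar> \<le> C * (1 + Linfty_norm UNIV u + Linfty_norm \<Omega> g) * norm (x - y) powr \<alpha>"
      unfolding U_def G_def .
  qed
qed

section \<open>The Hoelder norm and the monotone choice of the exponent\<close>

lemma holder_norm_le:
  fixes u :: "'a::euclidean_space \<Rightarrow> real"
  assumes U: "\<And>x. \<bar>u x\<bar> \<le> U" and H: "\<And>x y. \<bar>u x - u y\<bar> \<le> H * norm (x - y) powr \<alpha>"
  shows "holder_space \<alpha> u" "holder_norm \<alpha> u \<le> U + H"
proof -
  show "holder_space \<alpha> u"
    unfolding holder_space_def using U H by (auto intro!: boundedI[of _ U])
  obtain e :: 'a where "e \<in> Basis" using nonempty_Basis by blast
  then have "(e, 0) \<in> {(x, y). x \<noteq> y}" using nonzero_Basis[of e] by simp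
  then have ne: "{(x :: 'a, y :: 'a). x \<noteq> y} \<noteq> {}" by blast
  have 1: "(SUP x. \<bar>u x\<bar>) \<le> U" using U by (intro cSUP_least) auto
  have 2: "(SUP (x, y)\<in>{(x, y). x \<noteq> y}. \<bar>u x - u y\<bar> / norm (x - y) powr \<alpha>) \<le> H"
    using ne H by (intro cSUP_least) (auto simp: pos_divide_le_eq)
  show "holder_norm \<alpha> u \<le> U + H" unfolding holder_norm_def using 1 2 by (rule add_mono)
qed

text \<open>The admissible exponents form a down-closed set which grows with \<open>\<theta>\<close>; half of its supremum is
  therefore a monotone choice.\<close>

theorem theorem1p5:
  fixes s :: real
  assumes "0 < s" and "s < 1"
  shows "\<exists>\<alpha> C :: real \<Rightarrow> real.
    (\<forall>\<theta>\<in>{0<..<pi/2}.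
       0 < \<alpha> \<theta> \<and> \<alpha> \<theta> < s \<and> 0 < C \<theta> \<and>
       (\<forall>(\<Omega> :: (real ^ 'n) set) (g :: real ^ 'n \<Rightarrow> real) (u :: real ^ 'n \<Rightarrow> real).
          open \<Omega> \<and> uniform_exterior_cone \<theta> \<Omega> \<and>
          Linfty \<Omega> g \<and> Linfty UNIV u \<and> classical_solution s \<Omega> g u \<longrightarrow>
          holder_space (\<alpha> \<theta>) u \<and>
          holder_norm (\<alpha> \<theta>) u
            \<le> C \<theta> * ((1 + Linfty_norm UNIV u)
                        * (1 + Linfty_norm \<Omega> g powr (\<alpha> \<theta> / (2 * s - 2 * \<alpha> \<theta>)))
                      + Linfty_norm \<Omega> g))) \<and>
    mono_on {0<..<pi/2} \<alpha>"
proof -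
  define hyp where "hyp \<theta> \<Omega> g u \<longleftrightarrow> open \<Omega> \<and> uniform_exterior_cone \<theta> \<Omega> \<and>
    Linfty \<Omega> g \<and> Linfty UNIV u \<and> classical_solution s \<Omega> g u"
    for \<theta> and \<Omega> :: "(real ^ 'n) set" and g u
  \<comment> \<open>The quotient bound linear in the norms is recorded instead of the final
    estimate, because it passes to smaller exponents and to larger openings at once; the final
    estimate has the exponent in a power of the norm of \<open>g\<close> as well.\<close>
  define est where "est \<theta> a C \<longleftrightarrow> 0 < C \<and> (\<forall>\<Omega> g u x y. hyp \<theta> \<Omega> g u \<longrightarrow>
    \<bar>u x - u y\<bar> \<le> C * (1 + Linfty_norm UNIV u + Linfty_norm \<Omega> g) * norm (x - y) powr a)" for \<theta> a C
  define V where "V \<theta> = {a. 0 < a \<and> a < s \<and> (\<exists>C. est \<theta> a C)}" for \<theta>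
  \<comment> \<open>The supremum may equal \<open>s\<close> or fail to be admissible. Half of it is
    below \<open>s\<close> and strictly below some admissible exponent, from which it inherits an
    estimate.\<close>
  define \<alpha> where "\<alpha> \<theta> = Sup (V \<theta>) / 2" for \<theta>
  have hU: "\<bar>u x\<bar> \<le> Linfty_norm UNIV u" if "hyp \<theta> \<Omega> g u" for \<theta> \<Omega> g u x
    using that continuous_Linfty_le[of u x] by (auto simp: hyp_def classical_solution_def)
  have bdd: "bdd_above (V \<theta>)" for \<theta> by (auto simp: V_def intro!: bdd_aboveI[of _ s])
  have ne: "V \<theta> \<noteq> {}" if "\<theta> \<in> {0<..<pi/2}" for \<theta>
  proof -
    have \<theta>: "0 < \<theta>" "\<theta> < pi" using that by auto
    show ?thesis
    proof (rule holder_estimate[OF assms \<theta>, where 'a="real ^ 'n"], goal_cases)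
      case (1 a C)
      have "est \<theta> a C" unfolding est_def hyp_def using 1(3,4) by blast
      then have "a \<in> V \<theta>" unfolding V_def using 1(1,2) by blast
      then show ?case by blast
    qed
  qed
  have \<alpha>b: "0 < \<alpha> \<theta>" "\<alpha> \<theta> < s" "\<exists>a\<in>V \<theta>. \<alpha> \<theta> < a" if \<theta>: "\<theta> \<in> {0<..<pi/2}" for \<theta>
  proof -
    obtain a where a: "a \<in> V \<theta>" using ne[OF \<theta>] by blast
    have pos: "0 < Sup (V \<theta>)" using cSup_upper[OF a bdd] a by (auto simp: V_def)
    have "Sup (V \<theta>) \<le> s" using ne[OF \<theta>] by (intro cSup_least) (auto simp: V_def)
    then show "0 < \<alpha> \<theta>" "\<alpha> \<theta> < s" using pos assms by (auto simp: \<alpha>_def)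
    have "\<alpha> \<theta> < Sup (V \<theta>)" using pos by (simp add: \<alpha>_def)
    then show "\<exists>a\<in>V \<theta>. \<alpha> \<theta> < a" using less_cSup_iff[OF ne[OF \<theta>] bdd] by blast
  qed
  have "\<exists>C. est \<theta> (\<alpha> \<theta>) C" if \<theta>: "\<theta> \<in> {0<..<pi/2}" for \<theta>
  proof -
    obtain a C where a: "\<alpha> \<theta> < a" "est \<theta> a C" using \<alpha>b(3)[OF \<theta>] unfolding V_def by blast
    have C: "0 < C" using a(2) by (simp add: est_def)
    \<comment> \<open>Distances up to 1 inherit the bound with the larger exponent \<open>a\<close>;
      beyond 1 the difference is at most twice the sup norm, which accounts for the 2.\<close>
    have "est \<theta> (\<alpha> \<theta>) (max C 2)"
      unfolding est_def
    proof (intro conjI allI impI)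
      fix \<Omega> g u x y assume h: "hyp \<theta> \<Omega> g u"
      let ?T = "1 + Linfty_norm UNIV u + Linfty_norm \<Omega> g"
      have T: "0 \<le> ?T" using Linfty_norm_nonneg[of UNIV u] Linfty_norm_nonneg[of \<Omega> g] by simp
      show "\<bar>u x - u y\<bar> \<le> max C 2 * ?T * norm (x - y) powr \<alpha> \<theta>"
      proof (cases "norm (x - y) \<le> 1")
        case True
        have "\<bar>u x - u y\<bar> \<le> C * ?T * norm (x - y) powr a" using a(2) h unfolding est_def by blast
        also have "\<dots> \<le> max C 2 * ?T * norm (x - y) powr \<alpha> \<theta>"
          using T C a(1) True by (intro mult_mono powr_mono') auto
        finally show ?thesis .
      next
        case False
        have "\<bar>u x - u y\<bar> \<le> 2 * Linfty_norm UNIV u" using hU[OF h, of x] hU[OF h, of y] by linarith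
        also have "\<dots> \<le> 2 * ?T * 1" using Linfty_norm_nonneg[of \<Omega> g] by simp
        also have "\<dots> \<le> max C 2 * ?T * norm (x - y) powr \<alpha> \<theta>"
          using T False \<alpha>b(1)[OF \<theta>] by (intro mult_mono ge_one_powr_ge_zero) auto
        finally show ?thesis .
      qed
    qed (use C in simp)
    then show ?thesis by blast
  qed
  then obtain C where C: "\<And>\<theta>. \<theta> \<in> {0<..<pi/2} \<Longrightarrow> est \<theta> (\<alpha> \<theta>) (C \<theta>)" by metis
  show ?thesis
  \<comment> \<open>The additional 1 absorbs the sup-norm part of the Hoelder norm.\<close>
  proof (rule exI[of _ \<alpha>], rule exI[of _ "\<lambda>\<theta>. 1 + C \<theta>"], intro conjI ballI allI impI)
    fix \<theta> :: real assume \<theta>: "\<theta> \<in> {0<..<pi/2}"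
    show "0 < \<alpha> \<theta>" "\<alpha> \<theta> < s" by (fact \<alpha>b(1,2)[OF \<theta>])+
    have C0: "0 < C \<theta>" using C[OF \<theta>] by (simp add: est_def)
    then show "0 < 1 + C \<theta>" by simp
    fix \<Omega> :: "(real ^ 'n) set" and g u :: "real ^ 'n \<Rightarrow> real"
    assume "open \<Omega> \<and> uniform_exterior_cone \<theta> \<Omega> \<and> Linfty \<Omega> g \<and> Linfty UNIV u \<and> classical_solution s \<Omega> g u"
    then have h: "hyp \<theta> \<Omega> g u" by (simp add: hyp_def)
    define U where "U = Linfty_norm UNIV u"
    define G where "G = Linfty_norm \<Omega> g"
    have UG: "0 \<le> U" "0 \<le> G" by (simp_all add: U_def G_def Linfty_norm_nonneg)
    have H: "\<bar>u x - u y\<bar> \<le> C \<theta> * (1 + U + G) * norm (x - y) powr \<alpha> \<theta>" for x y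
      using C[OF \<theta>] h unfolding est_def U_def G_def by blast
    note hn = holder_norm_le[of u U, OF hU[OF h, folded U_def] H]
    show "holder_space (\<alpha> \<theta>) u" by (rule hn(1))
    have "holder_norm (\<alpha> \<theta>) u \<le> U + C \<theta> * (1 + U + G)" by (rule hn(2))
    also have "\<dots> \<le> (1 + C \<theta>) * (1 + U + G)" using UG by (simp add: distrib_right)
    also have "\<dots> \<le> (1 + C \<theta>) * ((1 + U) * (1 + G powr (\<alpha> \<theta> / (2 * s - 2 * \<alpha> \<theta>))) + G)"
    proof (rule mult_left_mono)
      have "(1 + U) * 1 \<le> (1 + U) * (1 + G powr (\<alpha> \<theta> / (2 * s - 2 * \<alpha> \<theta>)))"
        using UG by (intro mult_left_mono) auto
      then show "1 + U + G \<le> (1 + U) * (1 + G powr (\<alpha> \<theta> / (2 * s - 2 * \<alpha> \<theta>))) + G" by simp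
    qed (use C0 in simp)
    finally show "holder_norm (\<alpha> \<theta>) u
        \<le> (1 + C \<theta>) * ((1 + Linfty_norm UNIV u)
            * (1 + Linfty_norm \<Omega> g powr (\<alpha> \<theta> / (2 * s - 2 * \<alpha> \<theta>))) + Linfty_norm \<Omega> g)"
      unfolding U_def G_def .
  next
    show "mono_on {0<..<pi/2} \<alpha>"
    proof (rule mono_onI)
      fix \<theta> \<theta>' :: real assume \<theta>: "\<theta> \<in> {0<..<pi/2}" "\<theta>' \<in> {0<..<pi/2}" "\<theta> \<le> \<theta>'"
      have "hyp \<theta> \<Omega> g u" if "hyp \<theta>' \<Omega> g u" for \<Omega> g u
        using that uniform_exterior_cone_mono[OF \<theta>(3), of \<Omega>] by (simp add: hyp_def)
      then have "est \<theta>' a C" if "est \<theta> a C" for a C using that unfolding est_def by blast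
      then have "V \<theta> \<subseteq> V \<theta>'" unfolding V_def by blast
      then have "Sup (V \<theta>) \<le> Sup (V \<theta>')" by (intro cSup_subset_mono ne[OF \<theta>(1)] bdd)
      then show "\<alpha> \<theta> \<le> \<alpha> \<theta>'" by (simp add: \<alpha>_def)
    qed
  qed
qed

end
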